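(* Let $\Omega\subset\mathbb R^N$ be a bounded domain with $C^{1,1}$ boundary and $\delta(x)=\mathrm{dist}(x,\Omega^c)$. There exists $\rho>0$, depending on $N,p,s,\Omega$, such that $\delta^s$ is a weak solution of $(-\Delta)^s_p\delta^s=f$ in $\Omega_\rho:=\{x\in\Omega:\delta(x)<\rho\}$ for some $f\in L^\infty(\Omega_\rho)$.
   Context: Fixed $s\in(0,1)$, $p\in(1,\infty)$. $a^q:=|a|^{q-1}a$. $\delta^s$ is extended by $0$ on $\Omega^c$. Weak solution of $(-\Delta)^s_pu=f$ in an open set $U$: for every bounded open $U'\subseteq U$ and every $\varphi\in W^{s,p}_0(U')$, $\int_{\mathbb R^N\times\mathbb R^N}\frac{(u(x)-u(y))^{p-1}(\varphi(x)-\varphi(y))}{|x-y|^{N+ps}}dxdy=\int f\varphi\,dx$. *)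

theory Defs
  imports "HOL-Analysis.Analysis"
begin

definition spow :: "real \<Rightarrow> real \<Rightarrow> real" where
  "spow a q = \<bar>a\<bar> powr (q - 1) * a"

definition C11 :: "('a::euclidean_space \<Rightarrow> real) \<Rightarrow> bool" where
  "C11 \<gamma> \<longleftrightarrow> (\<exists>D :: 'a \<Rightarrow> 'a. (\<forall>x. (\<gamma> has_derivative (\<lambda>h. D x \<bullet> h)) (at x)) \<and>
       (\<exists>L. \<forall>x y. norm (D x - D y) \<le> L * dist x y))"

text \<open>Bounded domain with C^{1,1} boundary: near each boundary point, in suitable
  Cartesian coordinates (vertical direction nu, horizontal hyperplane orthogonal to nu),
  Omega is the supergraph of a C^{1,1} function of the horizontal variables.\<close>
definition C11_domain :: "'a::euclidean_space set \<Rightarrow> bool" where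
  "C11_domain \<Omega> \<longleftrightarrow> open \<Omega> \<and> connected \<Omega> \<and> \<Omega> \<noteq> {} \<and> bounded \<Omega> \<and>
     (\<forall>x0\<in>frontier \<Omega>. \<exists>r>0. \<exists>\<nu> :: 'a. \<exists>\<gamma> :: 'a \<Rightarrow> real.
        norm \<nu> = 1 \<and> C11 \<gamma> \<and> (\<forall>x. \<gamma> x = \<gamma> (x - (x \<bullet> \<nu>) *\<^sub>R \<nu>)) \<and>
        \<Omega> \<inter> ball x0 r = {x \<in> ball x0 r. x \<bullet> \<nu> > \<gamma> x})"

definition Wsp :: "real \<Rightarrow> real \<Rightarrow> ('a::euclidean_space \<Rightarrow> real) set" where
  "Wsp s p = {u. u \<in> borel_measurable lebesgue \<and>
      integrable lebesgue (\<lambda>x. \<bar>u x\<bar> powr p) \<and>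
      integrable (lebesgue :: ('a \<times> 'a) measure)
        (\<lambda>(x, y). \<bar>u x - u y\<bar> powr p / dist x y powr (real DIM('a) + p * s))}"

definition Wsp0 :: "real \<Rightarrow> real \<Rightarrow> 'a::euclidean_space set \<Rightarrow> ('a \<Rightarrow> real) set" where
  "Wsp0 s p U = {u \<in> Wsp s p. AE x in lebesgue. x \<notin> U \<longrightarrow> u x = 0}"

definition weak_solution ::
    "real \<Rightarrow> real \<Rightarrow> ('a::euclidean_space \<Rightarrow> real) \<Rightarrow> ('a \<Rightarrow> real) \<Rightarrow> 'a set \<Rightarrow> bool" where
  "weak_solution s p u f U \<longleftrightarrow>
     (\<forall>U'. open U' \<and> bounded U' \<and> U' \<subseteq> U \<longrightarrow>
       (\<forall>\<phi>\<in>Wsp0 s p U'.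
          let K = (\<lambda>(x, y). spow (u x - u y) (p - 1) * (\<phi> x - \<phi> y)
                              / dist x y powr (real DIM('a) + p * s))
          in integrable (lebesgue :: ('a \<times> 'a) measure) K \<and>
             integrable lebesgue (\<lambda>x. f x * \<phi> x) \<and>
             integral\<^sup>L (lebesgue :: ('a \<times> 'a) measure) K
               = integral\<^sup>L lebesgue (\<lambda>x. f x * \<phi> x)))"

definition Linfty_on :: "'a::euclidean_space set \<Rightarrow> ('a \<Rightarrow> real) \<Rightarrow> bool" where
  "Linfty_on U f \<longleftrightarrow> f \<in> borel_measurable (restrict_space lebesgue U) \<and>
     (\<exists>C. AE x in lebesgue. x \<in> U \<longrightarrow> \<bar>f x\<bar> \<le> C)"

end

theory Submission
  imports Defs
begin

text \<open>
  Put \<open>u = \<delta>\<^sup>s\<close>, \<open>q = p - 1\<close> and let \<open>n\<close> be the dimension. Near a boundary point, uniform interior and exterior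
  balls show that \<open>\<delta> (x + z)\<close> differs from \<open>(\<delta> x + z \<bullet> \<nu>)\<^sub>+\<close>, the distance to a half-space, by at most \<open>|z|\<^sup>2 / R\<close>. For the half-space the
  principal value integral vanishes: pairing \<open>z\<close> with \<open>- z\<close> and projecting onto \<open>\<nu>\<close> reduces it to the half-line, where an explicit
  antiderivative is available. The error of the comparison is absolutely integrable against \<open>|z|\<close> to the power \<open>- n - p s\<close>,
  uniformly in \<open>x\<close>, so the truncated integrals converge to a bounded function \<open>f / 2\<close> and are dominated by \<open>C \<delta>\<^sup>-\<^sup>s\<close>.
  By the Hardy inequality \<open>\<phi> \<delta>\<^sup>-\<^sup>s\<close> is integrable for every test function \<open>\<phi>\<close>, and dominated convergence
  in the truncated weak formulation gives the equation.
\<close>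

section \<open>Power inequalities\<close>

text \<open>The delicate point is that the comparison error is singular on two hyperplanes:
  \<open>d + z \<bullet> \<nu> = 0\<close>, where the half-space profile has infinite slope, and,
  for \<open>p < 2\<close>, \<open>z \<bullet> \<nu> = 0\<close>, where the signed power is not
  Lipschitz. The quadratic factor gained from the curvature keeps the total singularity integrable
  exactly because \<open>s < 1\<close>; the bookkeeping is done with exponent triples.

  The truncated integrals are not bounded uniformly, although their limit is: by homogeneity the
  half-space integral at height \<open>d\<close> with cutoff \<open>\<epsilon>\<close> is
  \<open>d powr (- s)\<close> times its value at height 1 with cutoff \<open>\<epsilon> / d\<close>.
  This loss is what calls for a Hardy inequality. That inequality holds here for every value of
  \<open>p * s\<close>, because the seminorm runs over the whole space and so counts the pairs with
  one point in an exterior ball, where the test function vanishes.\<close>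

lemma bernoulli_powr_le:
  fixes r s :: real
  assumes "0 \<le> s" "s \<le> 1" "0 \<le> r"
  shows "r powr s \<le> 1 + s * (r - 1)"
proof (cases "r = 0")
  case True
  then show ?thesis using assms by simp
next
  case False
  then have r: "r > 0" using assms by simp
  have "exp ((1 - s) *\<^sub>R 0 + s *\<^sub>R ln r) \<le> (1 - s) * exp 0 + s * exp (ln r)"
    by (rule convex_onD[OF exp_convex]) (use assms in auto)
  then show ?thesis using r by (simp add: powr_def algebra_simps)
qed

lemma bernoulli_powr_ge:
  fixes r q :: real
  assumes "1 \<le> q" "0 \<le> r"
  shows "1 + q * (r - 1) \<le> r powr q"
proof -
  have "(r powr q) powr (1/q) \<le> 1 + (1/q) * (r powr q - 1)"
    by (rule bernoulli_powr_le) (use assms in auto)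
  then have "r \<le> 1 + (1/q) * (r powr q - 1)" using assms by (simp add: powr_powr)
  then show ?thesis using assms by (simp add: field_simps)
qed

lemma powr_tangent_le:
  fixes x y s :: real
  assumes "0 \<le> s" "s \<le> 1" "0 \<le> x" "0 < y"
  shows "x powr s \<le> y powr s + s * y powr (s - 1) * (x - y)"
proof -
  have "(x / y) powr s \<le> 1 + s * (x / y - 1)" using bernoulli_powr_le[of s "x / y"] assms by simp
  then have "(x / y) powr s * y powr s \<le> (1 + s * (x / y - 1)) * y powr s"
    by (rule mult_right_mono) simp
  moreover have "(x / y) powr s * y powr s = x powr s" using assms by (simp add: powr_divide)
  moreover have "(1 + s * (x / y - 1)) * y powr s = y powr s + s * y powr (s - 1) * (x - y)"
    using assms by (simp add: powr_diff field_simps)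
  ultimately show ?thesis by simp
qed

lemma powr_tangent_ge:
  fixes x y q :: real
  assumes "1 \<le> q" "0 \<le> x" "0 < y"
  shows "y powr q + q * y powr (q - 1) * (x - y) \<le> x powr q"
proof -
  have "1 + q * (x / y - 1) \<le> (x / y) powr q" using bernoulli_powr_ge[of q "x / y"] assms by simp
  then have "(1 + q * (x / y - 1)) * y powr q \<le> (x / y) powr q * y powr q"
    by (rule mult_right_mono) simp
  moreover have "(x / y) powr q * y powr q = x powr q" using assms by (simp add: powr_divide)
  moreover have "(1 + q * (x / y - 1)) * y powr q = y powr q + q * y powr (q - 1) * (x - y)"
    using assms by (simp add: powr_diff field_simps)
  ultimately show ?thesis by simp
qed

text \<open>The constant 1 in place of the derivative factor \<open>s\<close> keeps the bound valid
  down to \<open>A = 0\<close>, where both sides equal \<open>t powr s\<close>. It therefore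
  survives at points outside the domain, whose distance to the complement is 0.\<close>

lemma abs_powr_diff_le_tangent:
  fixes A t s :: real
  assumes "0 \<le> s" "s \<le> 1" "0 \<le> A" "0 < t"
  shows "\<bar>A powr s - t powr s\<bar> \<le> \<bar>A - t\<bar> * t powr (s - 1)"
proof (cases "A \<ge> t")
  case True
  have "A powr s - t powr s \<le> s * (t powr (s - 1) * (A - t))" using powr_tangent_le[of s A t] assms by simp
  also have "\<dots> \<le> 1 * (t powr (s - 1) * (A - t))" using assms True by (intro mult_right_mono) auto
  finally show ?thesis using True assms powr_mono2[of s t A] by (simp add: mult.commute)
next
  case False
  have "t powr s = t * t powr (s - 1)" using assms by (simp add: powr_diff)
  moreover have "A * t powr (s - 1) \<le> A powr s"
  proof (cases "A = 0")
    case False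
    then have "t powr (s - 1) \<le> A powr (s - 1)"
      using assms \<open>\<not> A \<ge> t\<close> by (intro powr_mono2') auto
    then have "A * t powr (s - 1) \<le> A * A powr (s - 1)" using assms by (intro mult_left_mono) auto
    then show ?thesis using assms False by (simp add: powr_diff)
  qed simp
  ultimately show ?thesis using False assms powr_mono2[of s A t] by (simp add: algebra_simps)
qed

lemma powr_subadditive:
  fixes x y s :: real
  assumes "0 \<le> s" "s \<le> 1" "0 \<le> x" "0 \<le> y"
  shows "(x + y) powr s \<le> x powr s + y powr s"
proof (cases "x = 0 \<or> y = 0")
  case False
  then have pos: "x > 0" "y > 0" using assms by auto
  have "(x + y) powr s = (x + y) * (x + y) powr (s - 1)" using pos by (simp add: powr_diff)
  also have "\<dots> = x * (x + y) powr (s - 1) + y * (x + y) powr (s - 1)" by (rule distrib_right)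
  also have "\<dots> \<le> x * x powr (s - 1) + y * y powr (s - 1)"
    using pos assms by (intro add_mono mult_left_mono powr_mono2') auto
  also have "\<dots> = x powr s + y powr s" using pos by (simp add: powr_diff)
  finally show ?thesis .
qed auto

lemma abs_powr_diff_le_holder:
  fixes A B s :: real
  assumes "0 \<le> s" "s \<le> 1" "0 \<le> A" "0 \<le> B"
  shows "\<bar>A powr s - B powr s\<bar> \<le> \<bar>A - B\<bar> powr s"
proof -
  have *: "\<bar>A powr s - B powr s\<bar> \<le> \<bar>A - B\<bar> powr s" if "0 \<le> B" "B \<le> A" for A B
    using powr_subadditive[of s "A - B" B] powr_mono2[of s B A] that assms by simp
  show ?thesis using *[of A B] *[of B A] assms by (cases "B \<le> A") (auto simp: abs_minus_commute)
qed

text \<open>By concavity the slope between the two points is at least the slope at the larger one. A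
  lower bound is required because for \<open>p < 2\<close> the difference enters with the negative
  exponent \<open>p - 2\<close>.\<close>

lemma abs_powr_diff_ge:
  fixes d t s :: real
  assumes "0 < s" "s \<le> 1" "0 < d" "0 < t"
  shows "s * \<bar>d - t\<bar> * (max d t) powr (s - 1) \<le> \<bar>d powr s - t powr s\<bar>"
proof -
  have *: "s * \<bar>d - t\<bar> * (max d t) powr (s - 1) \<le> \<bar>d powr s - t powr s\<bar>" if "0 < t" "t \<le> d" for d t
    using powr_tangent_le[of s t d] powr_mono2[of s t d] that assms by (simp add: algebra_simps)
  show ?thesis using *[of d t] *[of t d] assms by (cases "t \<le> d") (auto simp: abs_minus_commute max.commute)
qed

section \<open>Signed powers and their moduli of continuity\<close>

lemma spow_nonneg: "0 \<le> a \<Longrightarrow> spow a q = a powr q"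
  by (cases "a = 0") (auto simp: spow_def powr_diff)

lemma spow_minus: "spow (- a) q = - spow a q"
  by (simp add: spow_def)

lemma spow_0 [simp]: "spow 0 q = 0"
  by (simp add: spow_def)

lemma abs_spow: "\<bar>spow a q\<bar> = \<bar>a\<bar> powr q"
  by (cases "a = 0") (auto simp: spow_def abs_mult powr_diff)

lemma spow_mult: "0 < c \<Longrightarrow> spow (c * a) q = c powr q * spow a q"
  by (simp add: spow_def abs_mult powr_mult powr_diff)

lemma spow_measurable [measurable]: "(\<lambda>a. spow a q) \<in> borel_measurable borel"
  unfolding spow_def by measurable

text \<open>Oddness of \<open>spow\<close> reduces two reals to equal or opposite signs. Reflecting
  the case \<open>a < 0\<close>, \<open>0 \<le> b\<close> moves the strict inequality to the first
  argument, which is why there are two opposite-sign cases.\<close>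

lemma spow_diff_induct:
  assumes sym: "\<And>a b. P a b \<Longrightarrow> P (- a) (- b)"
    and same: "\<And>a b. 0 \<le> a \<Longrightarrow> 0 \<le> b \<Longrightarrow> P a b"
    and opp: "\<And>a b. 0 \<le> a \<Longrightarrow> 0 < b \<Longrightarrow> P a (- b)"
    and opp': "\<And>a b. 0 < a \<Longrightarrow> 0 \<le> b \<Longrightarrow> P a (- b)"
  shows "P (a :: real) (b :: real)"
proof -
  consider "0 \<le> a" "0 \<le> b" | "0 \<le> a" "b < 0" | "a < 0" "b \<ge> 0" | "a < 0" "b < 0" by linarith
  then show ?thesis
  proof cases
    case 1 then show ?thesis by (rule same)
  next
    case 2 then show ?thesis using opp[of a "- b"] by simp
  next
    case 3 then show ?thesis using sym[of "- a" "- b"] opp'[of "- a" b] by simp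
  next
    case 4 then show ?thesis using sym[of "- a" "- b"] same[of "- a" "- b"] by simp
  qed
qed

text \<open>A mean value estimate obtained from tangent lines: the slope is largest at
  \<open>M\<close>. For opposite signs each power is at most \<open>M powr (q - 1)\<close> times its
  base, and \<open>\<bar>a - b\<bar>\<close> is the sum of the two absolute values.\<close>

lemma spow_diff_le_ge1:
  assumes "1 \<le> q" "\<bar>a\<bar> \<le> M" "\<bar>b\<bar> \<le> M"
  shows "\<bar>spow a q - spow b q\<bar> \<le> q * (\<bar>a - b\<bar> * M powr (q - 1))"
proof -
  have ord: "\<bar>x powr q - y powr q\<bar> \<le> q * (\<bar>x - y\<bar> * M powr (q - 1))"
    if "0 \<le> y" "y \<le> x" "x \<le> M" for x y
  proof (cases "x = 0")
    case True
    then show ?thesis using that by simp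
  next
    case False
    have "x powr q - y powr q \<le> q * (x powr (q - 1) * (x - y))"
      using powr_tangent_ge[of q y x] that assms False by (simp add: algebra_simps)
    also have "\<dots> \<le> q * (M powr (q - 1) * (x - y))"
      using that assms by (intro mult_left_mono mult_right_mono powr_mono2) auto
    finally show ?thesis using that assms powr_mono2[of q y x] by (simp add: mult.commute)
  qed
  have pw: "x powr q \<le> M powr (q - 1) * x" if "0 \<le> x" "x \<le> M" for x
  proof (cases "x = 0")
    case False
    then have "x powr q = x powr (q - 1) * x" using that by (simp add: powr_diff)
    also have "\<dots> \<le> M powr (q - 1) * x" using that assms by (intro mult_right_mono powr_mono2) auto
    finally show ?thesis .
  qed simp
  have opp: "\<bar>x powr q + y powr q\<bar> \<le> q * (\<bar>x + y\<bar> * M powr (q - 1))"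
    if "0 \<le> x" "x \<le> M" "0 \<le> y" "y \<le> M" for x y
  proof -
    have "\<bar>x powr q + y powr q\<bar> \<le> 1 * ((x + y) * M powr (q - 1))"
      using pw[of x] pw[of y] that by (simp add: algebra_simps)
    also have "\<dots> \<le> q * ((x + y) * M powr (q - 1))"
      using that assms by (intro mult_right_mono) auto
    finally show ?thesis using that by simp
  qed
  have "\<bar>a\<bar> \<le> M \<longrightarrow> \<bar>b\<bar> \<le> M \<longrightarrow> ?thesis"
  proof (induction a b rule: spow_diff_induct)
    case (1 a b) then show ?case by (simp add: spow_minus abs_minus_commute)
  next
    case (2 a b) then show ?case
      using ord[of a b] ord[of b a] by (cases "a \<le> b") (auto simp: spow_nonneg abs_minus_commute)
  next
    case (3 a b) then show ?case using opp[of a b] by (simp add: spow_minus spow_nonneg)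
  next
    case (4 a b) then show ?case using opp[of a b] by (simp add: spow_minus spow_nonneg)
  qed
  then show ?thesis using assms by simp
qed

text \<open>Equal signs are covered by subadditivity. For opposite signs both powers are at most
  \<open>\<bar>a - b\<bar> powr q\<close>, whence the factor 2.\<close>

lemma spow_diff_le_holder:
  assumes "0 \<le> q" "q \<le> 1"
  shows "\<bar>spow a q - spow b q\<bar> \<le> 2 * \<bar>a - b\<bar> powr q"
proof -
  have opp: "\<bar>x powr q + y powr q\<bar> \<le> 2 * \<bar>x + y\<bar> powr q" if "0 \<le> x" "0 \<le> y" for x y
    using powr_mono2[of q x "x + y"] powr_mono2[of q y "x + y"] that assms by simp
  show ?thesis
  proof (induction a b rule: spow_diff_induct)
    case (1 a b) then show ?case by (simp add: spow_minus abs_minus_commute)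
  next
    case (2 a b) then show ?case using abs_powr_diff_le_holder[of q a b] assms
      using powr_ge_zero[of "\<bar>a - b\<bar>" q] by (simp add: spow_nonneg)
  next
    case (3 a b) then show ?case using opp[of a b] by (simp add: spow_minus spow_nonneg)
  next
    case (4 a b) then show ?case using opp[of a b] by (simp add: spow_minus spow_nonneg)
  qed
qed

text \<open>Linearisation at \<open>b\<close> for a concave power. The slope
  \<open>\<bar>b\<bar> powr (q - 1)\<close> blows up as \<open>b\<close> tends to 0; this produces
  the second singular hyperplane when \<open>p < 2\<close>. For opposite signs
  \<open>\<bar>a - b\<bar>\<close> dominates both absolute values, so each power obeys the same
  bound.\<close>

lemma spow_diff_le_tangent:
  assumes "0 \<le> q" "q \<le> 1" "b \<noteq> 0"
  shows "\<bar>spow a q - spow b q\<bar> \<le> 2 * (\<bar>a - b\<bar> * \<bar>b\<bar> powr (q - 1))"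
proof -
  have opp: "\<bar>x powr q + y powr q\<bar> \<le> 2 * (\<bar>x + y\<bar> * y powr (q - 1))" if "0 \<le> x" "0 < y" for x y
  proof -
    have y: "y powr q = y * y powr (q - 1)" using that by (simp add: powr_diff)
    have x: "x powr q \<le> (x + y) * y powr (q - 1)"
    proof (cases "x \<le> y")
      case True
      have "x powr q \<le> y powr q" using True that assms by (intro powr_mono2) auto
      also have "\<dots> \<le> (x + y) * y powr (q - 1)" unfolding y using that by (intro mult_right_mono) auto
      finally show ?thesis .
    next
      case False
      then have "x powr q = x * x powr (q - 1)" using that by (simp add: powr_diff)
      also have "\<dots> \<le> (x + y) * y powr (q - 1)"
        using that False assms by (intro mult_mono powr_mono2') auto
      finally show ?thesis .
    qed
    have "y powr q \<le> (x + y) * y powr (q - 1)" unfolding y using that by (intro mult_right_mono) auto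
    with x show ?thesis using that by simp
  qed
  have "b \<noteq> 0 \<longrightarrow> ?thesis"
  proof (induction a b rule: spow_diff_induct)
    case (1 a b) then show ?case by (simp add: spow_minus abs_minus_commute)
  next
    case (2 a b)
    show ?case
    proof
      assume "b \<noteq> 0"
      then have "\<bar>a powr q - b powr q\<bar> \<le> \<bar>a - b\<bar> * b powr (q - 1)"
        using 2 assms by (intro abs_powr_diff_le_tangent) auto
      also have "\<dots> \<le> 2 * (\<bar>a - b\<bar> * b powr (q - 1))" by simp
      finally show "\<bar>spow a q - spow b q\<bar> \<le> 2 * (\<bar>a - b\<bar> * \<bar>b\<bar> powr (q - 1))"
        using 2 by (simp add: spow_nonneg)
    qed
  next
    case (3 a b) then show ?case using opp[of a b] by (simp add: spow_minus spow_nonneg)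
  next
    case (4 a b) then show ?case using opp[of a b] by (auto simp: spow_minus spow_nonneg)
  qed
  then show ?thesis using assms by simp
qed

section \<open>Homogeneous kernels\<close>

text \<open>The dimension is split off from the exponent because, for \<open>0 < a\<close>, a
  projection to a line turns this density into a multiple of \<open>t powr (- 1 - a)\<close>, with
  the same \<open>a\<close> in every dimension.\<close>

abbreviation kern :: "real \<Rightarrow> 'a::euclidean_space \<Rightarrow> real" where
  "kern a z \<equiv> norm z powr (- (real DIM('a) + a))"

lemma nn_integral_powr_atLeast:
  fixes e a :: real
  assumes "e < -1" "0 < a"
  shows "(\<integral>\<^sup>+x. ennreal (x powr e) * indicator {a..} x \<partial>lborel) = ennreal (a powr (e + 1) / (- e - 1))"
proof -
  have "(\<integral>\<^sup>+x. ennreal (indicator {a..} x * x powr e) \<partial>lborel) = ennreal (- (a powr (e + 1)) / (e + 1))"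
    by (rule nn_integral_has_integral_lebesgue[OF _ has_integral_powr_to_inf]) (use assms in auto)
  moreover have "- (a powr (e + 1)) / (e + 1) = a powr (e + 1) / (- e - 1)"
    using assms by (simp add: field_simps)
  ultimately show ?thesis by (simp add: ennreal_mult' mult.commute ennreal_indicator)
qed

lemma nn_integral_powr_from_0:
  fixes e c :: real
  assumes "- 1 < e" "0 \<le> c"
  shows "(\<integral>\<^sup>+x. ennreal (x powr e) * indicator {0..c} x \<partial>lborel) = ennreal (c powr (e + 1) / (e + 1))"
proof -
  have "(\<integral>\<^sup>+x. ennreal (indicator {0..c} x * x powr e) \<partial>lborel) = ennreal (c powr (e + 1) / (e + 1))"
    by (rule nn_integral_has_integral_lebesgue[OF _ has_integral_powr_from_0]) (use assms in auto)
  then show ?thesis by (simp add: ennreal_mult' mult.commute ennreal_indicator)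
qed

lemma nn_integral_lborel_uminus:
  fixes f :: "'a::euclidean_space \<Rightarrow> ennreal"
  assumes [measurable]: "f \<in> borel_measurable borel"
  shows "(\<integral>\<^sup>+x. f (- x) \<partial>lborel) = (\<integral>\<^sup>+x. f x \<partial>lborel)"
  by (subst (2) lborel_affine[of "-1" 0]) (simp_all add: nn_integral_density nn_integral_distr)

lemma nn_integral_lborel_translate:
  fixes f :: "'a::euclidean_space \<Rightarrow> ennreal"
  assumes [measurable]: "f \<in> borel_measurable borel"
  shows "(\<integral>\<^sup>+x. f (c + x) \<partial>lborel) = (\<integral>\<^sup>+x. f x \<partial>lborel)"
  by (subst (2) lborel_distr_plus[of c, symmetric]) (simp add: nn_integral_distr)

lemma nn_integral_lborel_scale:
  fixes f :: "'a::euclidean_space \<Rightarrow> ennreal"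
  assumes [measurable]: "f \<in> borel_measurable borel" and c: "0 < c"
  shows "(\<integral>\<^sup>+x. f x \<partial>lborel) = ennreal (c ^ DIM('a)) * (\<integral>\<^sup>+x. f (c *\<^sub>R x) \<partial>lborel)"
  using c by (subst lborel_affine[of c 0]) (simp_all add: nn_integral_density nn_integral_distr nn_integral_cmult)

lemma nn_integral_abs_powr_ball:
  fixes g c :: real
  assumes "g < 1" "0 \<le> c"
  shows "(\<integral>\<^sup>+t. ennreal (\<bar>t\<bar> powr (- g)) * indicator {-c..c} t \<partial>lborel) \<le> ennreal (2 * (c powr (1 - g) / (1 - g)))"
proof -
  have "(\<integral>\<^sup>+t. ennreal (\<bar>t\<bar> powr (- g)) * indicator {-c..c} t \<partial>lborel)
      \<le> (\<integral>\<^sup>+t. ennreal (t powr (- g)) * indicator {0..c} t + ennreal ((- t) powr (- g)) * indicator {0..c} (- t) \<partial>lborel)"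
    by (intro nn_integral_mono) (auto simp: indicator_def)
  also have "\<dots> = (\<integral>\<^sup>+t. ennreal (t powr (- g)) * indicator {0..c} t \<partial>lborel)
      + (\<integral>\<^sup>+t. ennreal ((- t) powr (- g)) * indicator {0..c} (- t) \<partial>lborel)"
    by (rule nn_integral_add) auto
  also have "(\<integral>\<^sup>+t. ennreal ((- t) powr (- g)) * indicator {0..c} (- t) \<partial>lborel)
     = (\<integral>\<^sup>+t. ennreal (t powr (- g)) * indicator {0..c} t \<partial>lborel)"
    by (rule nn_integral_lborel_uminus[of "\<lambda>t. ennreal (t powr (- g)) * indicator {0..c} t"]) simp
  also have "(\<integral>\<^sup>+t. ennreal (t powr (- g)) * indicator {0..c} t \<partial>lborel) = ennreal (c powr (1 - g) / (1 - g))"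
    using nn_integral_powr_from_0[of "- g" c] assms by (simp add: add.commute)
  also have "\<dots> + ennreal (c powr (1 - g) / (1 - g)) = ennreal (2 * (c powr (1 - g) / (1 - g)))"
    using assms by (subst ennreal_plus[symmetric]) auto
  finally show ?thesis .
qed

text \<open>Layer cake: for \<open>z \<noteq> 0\<close> the value \<open>norm z powr (- b)\<close>
  is the integral of \<open>b * r powr (- b - 1)\<close> over \<open>r \<ge> norm z\<close>, and
  Tonelli exchanges the integrals. Only an inequality is claimed since at \<open>z = 0\<close> the
  power is 0 by convention while the integral diverges.\<close>

lemma nn_integral_norm_powr_le_layers:
  fixes g :: "'a::euclidean_space \<Rightarrow> ennreal"
  assumes [measurable]: "g \<in> borel_measurable borel" and b: "0 < b"
  shows "(\<integral>\<^sup>+z. g z * ennreal (norm z powr (- b)) \<partial>lborel)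
     \<le> (\<integral>\<^sup>+r. ennreal (b * r powr (- b - 1)) * indicator {0<..} r * (\<integral>\<^sup>+z. g z * indicator (cball 0 r) z \<partial>lborel) \<partial>lborel)"
proof -
  have "(\<integral>\<^sup>+z. g z * ennreal (norm z powr (- b)) \<partial>lborel)
    \<le> (\<integral>\<^sup>+z. g z * (\<integral>\<^sup>+r. ennreal b * (ennreal (r powr (- b - 1)) * indicator {norm z..} r) * indicator {0<..} r \<partial>lborel) \<partial>lborel)"
  proof (intro nn_integral_mono mult_left_mono)
    fix z :: 'a
    show "ennreal (norm z powr (- b)) \<le> (\<integral>\<^sup>+r. ennreal b * (ennreal (r powr (- b - 1)) * indicator {norm z..} r) * indicator {0<..} r \<partial>lborel)"
    proof (cases "z = 0")
      case False
      have "(\<integral>\<^sup>+r. ennreal b * (ennreal (r powr (- b - 1)) * indicator {norm z..} r) * indicator {0<..} r \<partial>lborel)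
         = (\<integral>\<^sup>+r. ennreal b * (ennreal (r powr (- b - 1)) * indicator {norm z..} r) \<partial>lborel)"
      proof (intro nn_integral_cong)
        fix r :: real
        have "0 < r" if "norm z \<le> r" using that False by (metis less_le_trans zero_less_norm_iff)
        then show "ennreal b * (ennreal (r powr (- b - 1)) * indicator {norm z..} r) * indicator {0<..} r
          = ennreal b * (ennreal (r powr (- b - 1)) * indicator {norm z..} r)"
          by (cases "norm z \<le> r") auto
      qed
      also have "\<dots> = ennreal b * (\<integral>\<^sup>+r. ennreal (r powr (- b - 1)) * indicator {norm z..} r \<partial>lborel)"
        by (rule nn_integral_cmult) simp
      also have "\<dots> = ennreal b * ennreal (norm z powr (- b) / b)"
        using nn_integral_powr_atLeast[of "- b - 1" "norm z"] False b by simp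
      also have "\<dots> = ennreal (norm z powr (- b))"
        using b by (simp add: ennreal_mult'[symmetric])
      finally show ?thesis by simp
    qed simp
  qed auto
  also have "\<dots> = (\<integral>\<^sup>+z. (\<integral>\<^sup>+r. g z * (ennreal b * (ennreal (r powr (- b - 1)) * indicator {norm z..} r) * indicator {0<..} r) \<partial>lborel) \<partial>lborel)"
    by (subst nn_integral_cmult) auto
  also have "\<dots> = (\<integral>\<^sup>+z. (\<integral>\<^sup>+r. ennreal (b * r powr (- b - 1)) * indicator {0<..} r * (g z * indicator {z. norm z \<le> r} z) \<partial>lborel) \<partial>lborel)"
    using b by (intro nn_integral_cong) (auto simp: indicator_def ennreal_mult mult_ac)
  also have "\<dots> = (\<integral>\<^sup>+r. (\<integral>\<^sup>+z. ennreal (b * r powr (- b - 1)) * indicator {0<..} r * (g z * indicator {z. norm z \<le> r} z) \<partial>lborel) \<partial>lborel)"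
    by (rule lborel_pair.Fubini') (simp add: indicator_def split_beta', measurable)
  also have "\<dots> = (\<integral>\<^sup>+r. ennreal (b * r powr (- b - 1)) * indicator {0<..} r * (\<integral>\<^sup>+z. g z * indicator (cball 0 r) z \<partial>lborel) \<partial>lborel)"
    by (subst nn_integral_cmult) (auto simp: cball_def dist_norm)
  finally show ?thesis .
qed

lemma nn_integral_norm_powr_outside_unit_finite:
  assumes a: "0 < a"
  shows "(\<integral>\<^sup>+z. indicator {z. 1 < norm z} z * ennreal (kern a (z::'a::euclidean_space)) \<partial>lborel) < \<infinity>"
proof -
  let ?n = "real DIM('a)" let ?V = "unit_ball_vol (real DIM('a))"
  have "(\<integral>\<^sup>+z. indicator {z. 1 < norm z} z * ennreal (kern a (z::'a)) \<partial>lborel)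
     \<le> (\<integral>\<^sup>+r. ennreal ((?n + a) * r powr (- (?n + a) - 1)) * indicator {0<..} r * (\<integral>\<^sup>+z. indicator {z::'a. 1 < norm z} z * indicator (cball 0 r) z \<partial>lborel) \<partial>lborel)"
    by (rule nn_integral_norm_powr_le_layers) (use a in auto)
  \<comment> \<open>Balls of radius below 1 miss the set, and the others have volume of order
    \<open>r\<close> to the dimension, which lowers the exponent to \<open>- a - 1\<close>.\<close>
  also have "\<dots> \<le> (\<integral>\<^sup>+r. ennreal ((?n + a) * ?V) * (ennreal (r powr (- a - 1)) * indicator {1..} r) \<partial>lborel)"
  proof (intro nn_integral_mono)
    fix r :: real
    show "ennreal ((?n + a) * r powr (- (?n + a) - 1)) * indicator {0<..} r * (\<integral>\<^sup>+z. indicator {z::'a. 1 < norm z} z * indicator (cball 0 r) z \<partial>lborel)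
      \<le> ennreal ((?n + a) * ?V) * (ennreal (r powr (- a - 1)) * indicator {1..} r)"
    proof (cases "r \<ge> 1")
      case True
      have "(\<integral>\<^sup>+z. indicator {z::'a. 1 < norm z} z * indicator (cball 0 r) z \<partial>lborel) \<le> (\<integral>\<^sup>+z. indicator (cball (0::'a) r) z \<partial>lborel)"
        by (intro nn_integral_mono) (auto simp: indicator_def)
      also have "\<dots> = ennreal (?V * r ^ DIM('a))" using True by (simp add: emeasure_cball)
      finally have "ennreal ((?n + a) * r powr (- (?n + a) - 1)) * indicator {0<..} r * (\<integral>\<^sup>+z. indicator {z::'a. 1 < norm z} z * indicator (cball 0 r) z \<partial>lborel)
        \<le> ennreal ((?n + a) * r powr (- (?n + a) - 1)) * 1 * ennreal (?V * r ^ DIM('a))"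
        by (intro mult_mono) (auto simp: indicator_def)
      also have "\<dots> = ennreal ((?n + a) * r powr (- (?n + a) - 1) * (?V * r powr ?n))"
        using True a ennreal_mult[of "(?n + a) * r powr (- (?n + a) - 1)" "?V * r ^ DIM('a)"]
        by (simp only: powr_realpow mult_1_right) simp
      also have "(?n + a) * r powr (- (?n + a) - 1) * (?V * r powr ?n) = (?n + a) * ?V * (r powr (- (?n + a) - 1) * r powr ?n)"
        by simp
      also have "r powr (- (?n + a) - 1) * r powr ?n = r powr (- a - 1)"
        using True by (simp add: powr_add[symmetric])
      finally show ?thesis using True a by (simp add: ennreal_mult[symmetric])
    next
      case False
      then have "(\<integral>\<^sup>+z. indicator {z::'a. 1 < norm z} z * indicator (cball 0 r) z \<partial>lborel) = 0"
        by (auto simp: indicator_def nn_integral_0_iff_AE)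
      then show ?thesis by simp
    qed
  qed
  also have "\<dots> = ennreal ((?n + a) * ?V) * ennreal (1 powr (- a) / a)"
    using nn_integral_powr_atLeast[of "- a - 1" 1] a by (subst nn_integral_cmult) auto
  also have "\<dots> < \<infinity>" by (simp add: ennreal_mult_less_top)
  finally show ?thesis .
qed

text \<open>The mass near \<open>0\<close> may be infinite, so the library rule for half-lines does not apply directly.\<close>

lemma measure_eqI_greaterThan_pos:
  fixes M N :: "real measure"
  assumes sets: "sets M = sets borel" "sets N = sets borel"
    and null: "emeasure M {..0} = 0" "emeasure N {..0} = 0"
    and fin: "\<And>x. 0 < x \<Longrightarrow> emeasure M {x<..} < \<infinity>"
    and eq: "\<And>x. 0 < x \<Longrightarrow> emeasure M {x<..} = emeasure N {x<..}"
  shows "M = N"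
proof (rule measure_eqI)
  show "sets M = sets N" using sets by simp
  fix A assume A: "A \<in> sets M"
  then have [measurable]: "A \<in> sets borel" using sets by simp
  \<comment> \<open>Restricted to \<open>{c<..}\<close>, both measures are finite on every ray, so
    uniqueness from rays is available.\<close>
  have k: "emeasure M (A \<inter> {c<..}) = emeasure N (A \<inter> {c<..})" if "0 < c" for c
  proof -
    have dens: "emeasure (density P (indicator {c<..})) B = emeasure P (B \<inter> {c<..})"
      if "sets P = sets borel" "B \<in> sets borel" for P B
    proof -
      have [measurable]: "{c<..} \<in> sets P" "B \<in> sets P" using that by auto
      have "emeasure (density P (indicator {c<..})) B = (\<integral>\<^sup>+x. indicator {c<..} x * indicator B x \<partial>P)"
        by (rule emeasure_density) auto
      also have "\<dots> = (\<integral>\<^sup>+x. indicator (B \<inter> {c<..}) x \<partial>P)"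
        by (intro nn_integral_cong) (auto simp: indicator_def)
      also have "\<dots> = emeasure P (B \<inter> {c<..})" by (rule nn_integral_indicator) simp
      finally show ?thesis .
    qed
    have Int: "{x<..} \<inter> {c<..} = {max x c<..}" for x by auto
    have fin': "emeasure M {max x c<..} < top" and eq': "emeasure M {max x c<..} = emeasure N {max x c<..}" for x
      using fin[of "max x c"] eq[of "max x c"] that by auto
    have d: "emeasure (density P (indicator {c<..})) {x<..} = emeasure P {max x c<..}" if "sets P = sets borel" for P x
      using dens[OF that, of "{x<..}"] by (simp only: Int) simp
    have "density M (indicator {c<..}) = density N (indicator {c<..})"
    proof (rule measure_eqI_lessThan)
      fix x
      show "emeasure (density M (indicator {c<..})) {x<..} < \<infinity>"
        unfolding d[OF sets(1)] using fin' by (simp only: infinity_ennreal_def)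
      show "emeasure (density M (indicator {c<..})) {x<..} = emeasure (density N (indicator {c<..})) {x<..}"
        unfolding d[OF sets(1)] d[OF sets(2)] by (rule eq')
    qed (simp_all add: sets)
    then show ?thesis using dens[of M A] dens[of N A] sets by simp
  qed
  \<comment> \<open>The rays starting at \<open>inverse (real (Suc k))\<close> exhaust the positive
    reals, and \<open>{..0}\<close> carries no mass.\<close>
  have lim: "(\<lambda>k. emeasure P (A \<inter> {inverse (real (Suc k))<..})) \<longlonglongrightarrow> emeasure P A"
    if P: "sets P = sets borel" "emeasure P {..0} = 0" for P
  proof -
    have "(\<lambda>k. emeasure P (A \<inter> {inverse (real (Suc k))<..})) \<longlonglongrightarrow> emeasure P (\<Union>k. A \<inter> {inverse (real (Suc k))<..})"
    proof (rule Lim_emeasure_incseq)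
      show "range (\<lambda>k. A \<inter> {inverse (real (Suc k))<..}) \<subseteq> sets P"
        unfolding P(1) by (intro image_subsetI sets.Int \<open>A \<in> sets borel\<close> greaterThan_borel)
      show "incseq (\<lambda>k. A \<inter> {inverse (real (Suc k))<..})"
      proof (rule incseq_SucI)
        fix k
        have "inverse (real (Suc (Suc k))) \<le> inverse (real (Suc k))" by (rule le_imp_inverse_le) auto
        then show "A \<inter> {inverse (real (Suc k))<..} \<le> A \<inter> {inverse (real (Suc (Suc k)))<..}"
          by (meson Int_mono greaterThan_subset_iff order_refl)
      qed
    qed
    also have "(\<Union>k. A \<inter> {inverse (real (Suc k))<..}) = A - {..0}"
    proof -
      have "(\<exists>k. inverse (real (Suc k)) < x) \<longleftrightarrow> 0 < x" for x :: real
        by (meson inverse_positive_iff_positive of_nat_0_less_iff order_less_trans zero_less_Suc reals_Archimedean)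
      then have "x \<in> (\<Union>k. A \<inter> {inverse (real (Suc k))<..}) \<longleftrightarrow> x \<in> A - {..0}" for x
        by (simp only: UN_iff Int_iff greaterThan_iff Diff_iff atMost_iff not_le) blast
      then show ?thesis by (rule set_eqI)
    qed
    also have "emeasure P (A - {..0}) = emeasure P A"
    proof (rule emeasure_Diff_null_set)
      show "{..0} \<in> null_sets P" by (rule null_setsI) (simp_all only: P atMost_borel)
      show "A \<in> sets P" by (simp only: P \<open>A \<in> sets borel\<close>)
    qed
    finally show ?thesis .
  qed
  have "(\<lambda>k. emeasure M (A \<inter> {inverse (real (Suc k))<..})) \<longlonglongrightarrow> emeasure N A"
    unfolding k[OF positive_imp_inverse_positive[OF of_nat_0_less_iff[THEN iffD2, OF zero_less_Suc]]]
    by (rule lim[OF sets(2) null(2)])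
  then show "emeasure M A = emeasure N A"
    using lim[OF sets(1) null(1)] LIMSEQ_unique by blast
qed

text \<open>The surface measure of the unit sphere, as the pushforward constant of
  \<open>norm\<close>. It dominates the constants of all homogeneous maps bounded by
  \<open>norm\<close>.\<close>

definition kernel_const :: "'a::euclidean_space itself \<Rightarrow> real \<Rightarrow> real" where
  "kernel_const _ a = a * enn2real (\<integral>\<^sup>+z. indicator {z. 1 < norm z} z * ennreal (kern a (z::'a)) \<partial>lborel)"

text \<open>Scaling by \<open>t\<close> shows that the mass of \<open>t < l z\<close> is
  \<open>t powr (- a)\<close> times the mass of \<open>1 < l z\<close>, and these tails determine
  the image measure. The bound on \<open>C\<close> gives uniformity over all directions
  \<open>\<nu>\<close> without appeal to rotation invariance.\<close>

lemma homogeneous_pushforward: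
  fixes l :: "'a::euclidean_space \<Rightarrow> real"
  assumes [measurable]: "l \<in> borel_measurable borel"
    and hom: "\<And>c z. 0 < c \<Longrightarrow> l (c *\<^sub>R z) = c * l z"
    and le: "\<And>z. l z \<le> norm z" and a: "0 < a"
  obtains C where "0 \<le> C" "C \<le> kernel_const TYPE('a) a"
    "distr (density lborel (\<lambda>z. ennreal (kern a z) * indicator {z. 0 < l z} z)) borel l
      = density lborel (\<lambda>t. ennreal (C * t powr (- 1 - a)) * indicator {0<..} t)"
proof -
  let ?n = "real DIM('a)"
  define w where "w z = kern a z" for z :: 'a
  have [measurable]: "w \<in> borel_measurable borel" unfolding w_def[abs_def] by simp
  define m where "m t = (\<integral>\<^sup>+z. indicator {z. t < l z} z * ennreal (w z) \<partial>lborel)" for t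
  have out: "(\<integral>\<^sup>+z. indicator {z. 1 < norm z} z * ennreal (w z) \<partial>lborel) < \<infinity>"
    unfolding w_def by (rule nn_integral_norm_powr_outside_unit_finite[OF a])
  have m1le: "m 1 \<le> (\<integral>\<^sup>+z. indicator {z. 1 < norm z} z * ennreal (w z) \<partial>lborel)"
    unfolding m_def using le by (intro nn_integral_mono) (auto simp: indicator_def dest: order_less_le_trans)
  define C where "C = a * enn2real (m 1)"
  have m1: "m 1 = ennreal (C / a)" unfolding C_def using a m1le out by (simp add: order_le_less_trans)
  have mt: "m t = ennreal (t powr (- a) * (C / a))" if "0 < t" for t
  proof -
    have "m t = ennreal (t ^ DIM('a)) * (\<integral>\<^sup>+z. indicator {z. t < l z} (t *\<^sub>R z) * ennreal (w (t *\<^sub>R z)) \<partial>lborel)"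
      unfolding m_def by (rule nn_integral_lborel_scale) (use that in auto)
    also have "(\<integral>\<^sup>+z. indicator {z. t < l z} (t *\<^sub>R z) * ennreal (w (t *\<^sub>R z)) \<partial>lborel)
       = (\<integral>\<^sup>+z. ennreal (t powr (- (?n + a))) * (indicator {z. 1 < l z} z * ennreal (w z)) \<partial>lborel)"
      using that by (intro nn_integral_cong) (auto simp: indicator_def hom w_def powr_mult ennreal_mult)
    also have "\<dots> = ennreal (t powr (- (?n + a))) * m 1"
      unfolding m_def by (rule nn_integral_cmult) simp
    also have "ennreal (t ^ DIM('a)) * (ennreal (t powr (- (?n + a))) * m 1) = ennreal (t powr ?n * t powr (- (?n + a)) * (C / a))"
      unfolding m1 using that a by (simp add: ennreal_mult[symmetric] powr_realpow C_def mult.assoc)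
    also have "t powr ?n * t powr (- (?n + a)) = t powr (- a)"
      using that by (simp add: powr_add[symmetric])
    finally show ?thesis .
  qed
  show ?thesis
  proof (rule that)
    show "0 \<le> C" unfolding C_def using a by simp
    show "C \<le> kernel_const TYPE('a) a" unfolding C_def kernel_const_def using a m1le out
      by (intro mult_left_mono enn2real_mono) (auto simp: w_def)
    show "distr (density lborel (\<lambda>z. ennreal (kern a z) * indicator {z. 0 < l z} z)) borel l
      = density lborel (\<lambda>t. ennreal (C * t powr (- 1 - a)) * indicator {0<..} t)"
      unfolding w_def[symmetric]
    proof (rule measure_eqI_greaterThan_pos)
      have dM: "emeasure (distr (density lborel (\<lambda>z. ennreal (w z) * indicator {z. 0 < l z} z)) borel l) A
         = (\<integral>\<^sup>+z. ennreal (w z) * indicator {z. 0 < l z} z * indicator A (l z) \<partial>lborel)" if [measurable]: "A \<in> sets borel" for A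
      proof -
        have "(\<integral>\<^sup>+z. ennreal (w z) * indicator {z. 0 < l z} z * indicator (l -` A) z \<partial>lborel) = (\<integral>\<^sup>+z. ennreal (w z) * indicator {z. 0 < l z} z * indicator A (l z) \<partial>lborel)"
          by (intro nn_integral_cong) (auto simp: indicator_def)
        moreover have "l -` A \<in> sets borel" using measurable_sets[of l borel borel A] by simp
        ultimately show ?thesis by (simp add: emeasure_distr emeasure_density)
      qed
      show "emeasure (distr (density lborel (\<lambda>z. ennreal (w z) * indicator {z. 0 < l z} z)) borel l) {..0} = 0"
      proof -
        have z0: "ennreal (w z) * indicator {z. 0 < l z} z * indicator {..0} (l z) = 0" for z by (auto simp: indicator_def)
        show ?thesis by (subst dM[OF atMost_borel]) (simp only: z0, simp)
      qed
      show "emeasure (density lborel (\<lambda>t. ennreal (C * t powr (- 1 - a)) * indicator {0<..} t)) {..0} = 0"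
      proof -
        have z0: "ennreal (C * t powr (- 1 - a)) * indicator {0<..} t * indicator {..0} t = 0" for t by (auto simp: indicator_def)
        show ?thesis by (subst emeasure_density) (simp, simp, simp only: z0, simp)
      qed
      fix x :: real assume x: "0 < x"
      have "emeasure (distr (density lborel (\<lambda>z. ennreal (w z) * indicator {z. 0 < l z} z)) borel l) {x<..} = m x"
        unfolding m_def using x by (subst dM) (auto intro!: nn_integral_cong simp: indicator_def)
      also have "m x = ennreal (x powr (- a) * (C / a))" by (rule mt[OF x])
      finally have 1: "emeasure (distr (density lborel (\<lambda>z. ennreal (w z) * indicator {z. 0 < l z} z)) borel l) {x<..} = ennreal (x powr (- a) * (C / a))" .
      then show "emeasure (distr (density lborel (\<lambda>z. ennreal (w z) * indicator {z. 0 < l z} z)) borel l) {x<..} < \<infinity>" by simp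
      have "emeasure (density lborel (\<lambda>t. ennreal (C * t powr (- 1 - a)) * indicator {0<..} t)) {x<..}
         = (\<integral>\<^sup>+t. ennreal (C * t powr (- 1 - a)) * indicator {0<..} t * indicator {x<..} t \<partial>lborel)"
        by (rule emeasure_density) auto
      also have "\<dots> = (\<integral>\<^sup>+t. ennreal C * (ennreal (t powr (- 1 - a)) * indicator {x..} t) \<partial>lborel)"
        using AE_lborel_singleton[of x] x \<open>0 \<le> C\<close>
        by (intro nn_integral_cong_AE) (auto simp: indicator_def ennreal_mult elim!: eventually_mono)
      also have "\<dots> = ennreal C * ennreal (x powr (- a) / a)"
        using nn_integral_powr_atLeast[of "- 1 - a" x] a x by (subst nn_integral_cmult) auto
      finally show "emeasure (distr (density lborel (\<lambda>z. ennreal (w z) * indicator {z. 0 < l z} z)) borel l) {x<..}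
        = emeasure (density lborel (\<lambda>t. ennreal (C * t powr (- 1 - a)) * indicator {0<..} t)) {x<..}"
        unfolding 1 using \<open>0 \<le> C\<close> a by (simp add: ennreal_mult[symmetric] mult.commute)
    qed auto
  qed
qed

text \<open>Polar coordinates without a surface measure: this is the pushforward for
  \<open>l = norm\<close>. The origin is harmless because \<open>kern a 0 = 0\<close>.\<close>

lemma nn_integral_radial:
  assumes a: "0 < a"
  obtains C where "0 \<le> C"
    "\<forall>g\<in>borel_measurable borel.
       (\<integral>\<^sup>+z. ennreal (kern a z) * g (norm (z::'a::euclidean_space)) \<partial>lborel)
        = (\<integral>\<^sup>+t. ennreal (C * t powr (- 1 - a)) * indicator {0<..} t * g t \<partial>lborel)"
proof -
  obtain C where C: "0 \<le> C"
    "distr (density lborel (\<lambda>z. ennreal (kern a z) * indicator {z. 0 < norm z} z)) borel (norm :: 'a \<Rightarrow> real)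
      = density lborel (\<lambda>t. ennreal (C * t powr (- 1 - a)) * indicator {0<..} t)"
    using homogeneous_pushforward[of "norm :: 'a \<Rightarrow> real" a] a by auto
  show ?thesis
  proof (rule that[OF C(1)], intro ballI)
    fix g :: "real \<Rightarrow> ennreal" assume [measurable]: "g \<in> borel_measurable borel"
    have "(\<integral>\<^sup>+z. ennreal (kern a z) * g (norm (z::'a)) \<partial>lborel)
       = (\<integral>\<^sup>+z. (ennreal (kern a z) * indicator {z. 0 < norm z} z) * g (norm (z::'a)) \<partial>lborel)"
      by (intro nn_integral_cong) (auto simp: indicator_def)
    also have "\<dots> = (\<integral>\<^sup>+t. g t \<partial>distr (density lborel (\<lambda>z. ennreal (kern a z) * indicator {z. 0 < norm z} z)) borel (norm :: 'a \<Rightarrow> real))"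
      by (simp add: nn_integral_distr nn_integral_density)
    also have "\<dots> = (\<integral>\<^sup>+t. ennreal (C * t powr (- 1 - a)) * indicator {0<..} t * g t \<partial>lborel)"
      unfolding C(2) by (simp add: nn_integral_density)
    finally show "(\<integral>\<^sup>+z. ennreal (kern a z) * g (norm (z::'a)) \<partial>lborel)
       = (\<integral>\<^sup>+t. ennreal (C * t powr (- 1 - a)) * indicator {0<..} t * g t \<partial>lborel)" .
  qed
qed

lemma nn_integral_norm_powr_outside:
  assumes a: "0 < a"
  obtains C where "0 \<le> C"
    "\<forall>r>0. (\<integral>\<^sup>+z. ennreal (kern a z) * indicator {z. r \<le> norm z} (z::'a::euclidean_space) \<partial>lborel) \<le> ennreal (C * r powr (- a))"
proof -
  obtain C where C: "0 \<le> C"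
    "\<forall>g\<in>borel_measurable borel.
       (\<integral>\<^sup>+z. ennreal (kern a z) * g (norm (z::'a)) \<partial>lborel)
        = (\<integral>\<^sup>+t. ennreal (C * t powr (- 1 - a)) * indicator {0<..} t * g t \<partial>lborel)"
    by (rule nn_integral_radial[where 'a='a, OF a])
  show ?thesis
  proof (rule that[of "C / a"], use C a in simp, intro allI impI)
    fix r :: real assume r: "0 < r"
    have "(\<integral>\<^sup>+z. ennreal (kern a z) * indicator {z. r \<le> norm z} (z::'a) \<partial>lborel)
      = (\<integral>\<^sup>+z. ennreal (kern a z) * indicator {r..} (norm (z::'a)) \<partial>lborel)"
      by (intro nn_integral_cong) (auto simp: indicator_def)
    also have "\<dots> = (\<integral>\<^sup>+t. ennreal (C * t powr (- 1 - a)) * indicator {0<..} t * indicator {r..} t \<partial>lborel)"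
      by (rule C(2)[rule_format]) simp
    also have "\<dots> = (\<integral>\<^sup>+t. ennreal C * (ennreal (t powr (- 1 - a)) * indicator {r..} t) \<partial>lborel)"
      using r C(1) by (intro nn_integral_cong) (auto simp: indicator_def ennreal_mult)
    also have "\<dots> = ennreal C * ennreal (r powr (- a) / a)"
      using nn_integral_powr_atLeast[of "- 1 - a" r] a r by (subst nn_integral_cmult) auto
    also have "\<dots> = ennreal (C / a * r powr (- a))" using C(1) a by (simp add: ennreal_mult[symmetric])
    finally show "(\<integral>\<^sup>+z. ennreal (kern a z) * indicator {z. r \<le> norm z} (z::'a) \<partial>lborel) \<le> ennreal (C / a * r powr (- a))"
      by simp
  qed
qed

lemma nn_integral_norm_powr_inside:
  assumes b: "0 < b"
  obtains C where "0 \<le> C"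
    "\<forall>r>0. (\<integral>\<^sup>+z. ennreal (norm z powr (b - real DIM('a))) * indicator {z. norm z < r} (z::'a::euclidean_space) \<partial>lborel) \<le> ennreal (C * r powr b)"
proof -
  \<comment> \<open>The radial formula asks for a positive order. It is used with order 1, and the
    remaining power \<open>b + 1\<close> of the norm goes into \<open>g\<close>.\<close>
  obtain C where C: "0 \<le> C"
    "\<forall>g\<in>borel_measurable borel.
       (\<integral>\<^sup>+z. ennreal (kern 1 z) * g (norm (z::'a)) \<partial>lborel)
        = (\<integral>\<^sup>+t. ennreal (C * t powr (- 1 - 1)) * indicator {0<..} t * g t \<partial>lborel)"
    by (rule nn_integral_radial[where 'a='a, OF zero_less_one])
  show ?thesis
  proof (rule that[of "C / b"], use C b in simp, intro allI impI)
    fix r :: real assume r: "0 < r"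
    have "(\<integral>\<^sup>+z. ennreal (norm z powr (b - real DIM('a))) * indicator {z. norm z < r} (z::'a) \<partial>lborel)
      = (\<integral>\<^sup>+z. ennreal (kern 1 z) * (ennreal (norm z powr (b + 1)) * indicator {..<r} (norm (z::'a))) \<partial>lborel)"
    proof (intro nn_integral_cong)
      fix z :: 'a
      have "norm z powr (b - real DIM('a)) = kern 1 z * norm z powr (b + 1)"
        by (simp add: powr_add[symmetric])
      then show "ennreal (norm z powr (b - real DIM('a))) * indicator {z. norm z < r} (z::'a)
        = ennreal (kern 1 z) * (ennreal (norm z powr (b + 1)) * indicator {..<r} (norm (z::'a)))"
        by (simp add: ennreal_mult indicator_def mult_ac)
    qed
    also have "\<dots> = (\<integral>\<^sup>+t. ennreal (C * t powr (- 1 - 1)) * indicator {0<..} t * (ennreal (t powr (b + 1)) * indicator {..<r} t) \<partial>lborel)"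
      by (rule C(2)[rule_format]) simp
    also have "\<dots> \<le> (\<integral>\<^sup>+t. ennreal C * (ennreal (t powr (b - 1)) * indicator {0..r} t) \<partial>lborel)"
    proof (intro nn_integral_mono)
      fix t :: real
      have "t powr (b - 1) = t powr (- 1 - 1) * t powr (b + 1)" by (simp add: powr_add[symmetric])
      then show "ennreal (C * t powr (- 1 - 1)) * indicator {0<..} t * (ennreal (t powr (b + 1)) * indicator {..<r} t)
         \<le> ennreal C * (ennreal (t powr (b - 1)) * indicator {0..r} t)"
        using C(1) by (auto simp: indicator_def ennreal_mult[symmetric] mult_ac)
    qed
    also have "\<dots> = ennreal C * ennreal (r powr b / b)"
      using nn_integral_powr_from_0[of "b - 1" r] b r by (subst nn_integral_cmult) auto
    also have "\<dots> = ennreal (C / b * r powr b)" using C(1) b by (simp add: ennreal_mult[symmetric])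
    finally show "(\<integral>\<^sup>+z. ennreal (norm z powr (b - real DIM('a))) * indicator {z. norm z < r} (z::'a) \<partial>lborel) \<le> ennreal (C / b * r powr b)" .
  qed
qed

text \<open>The ball is shifted by \<open>2 * r\<close> along \<open>\<nu>\<close>, so that the Lebesgue measure on it is comparable to the kernel
  \<open>norm z powr (- (n + 1))\<close>, whose image under the projection to \<open>\<nu>\<close> is known exactly.\<close>

lemma nn_integral_inner_cball_le:
  obtains C where "0 \<le> C"
    "\<forall>g\<in>borel_measurable borel. \<forall>\<nu>::'a::euclidean_space. \<forall>r>0. norm \<nu> = 1 \<longrightarrow>
      (\<integral>\<^sup>+z. g (z \<bullet> \<nu>) * indicator (cball 0 r) z \<partial>lborel) \<le> ennreal (C * r powr (real DIM('a) - 1)) * (\<integral>\<^sup>+t. g t * indicator {-r..r} t \<partial>lborel)"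
proof -
  let ?n = "real DIM('a)"
  define K where "K = kernel_const TYPE('a) 1"
  have K: "0 \<le> K" unfolding K_def kernel_const_def by simp
  show ?thesis
  proof (rule that[of "3 powr (?n + 1) * K"], use K in simp, intro ballI allI impI)
    fix g :: "real \<Rightarrow> ennreal" and \<nu> :: 'a and r :: real
    assume [measurable]: "g \<in> borel_measurable borel" and r: "0 < r" and \<nu>: "norm \<nu> = 1"
    have \<nu>\<nu>: "\<nu> \<bullet> \<nu> = 1" using \<nu> by (simp add: norm_eq_1)
    have inl: "\<bar>z \<bullet> \<nu>\<bar> \<le> norm z" for z using Cauchy_Schwarz_ineq2[of z \<nu>] \<nu> by simp
    obtain C where C: "0 \<le> C" "C \<le> K"
      "distr (density lborel (\<lambda>z. ennreal (kern 1 z) * indicator {z. 0 < z \<bullet> \<nu>} z)) borel (\<lambda>z. z \<bullet> \<nu>)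
        = density lborel (\<lambda>t. ennreal (C * t powr (- 1 - 1)) * indicator {0<..} t)"
      by (rule homogeneous_pushforward[of "\<lambda>z. z \<bullet> \<nu>", OF _ _ _ zero_less_one, folded K_def])
        (use inl abs_le_D1 in auto)
    have [measurable]: "cball (0::'a) r \<in> sets borel" by simp
    \<comment> \<open>On the shifted ball the projection \<open>z \<bullet> \<nu>\<close> lies
      between \<open>r\<close> and \<open>3 * r\<close>; \<open>?G\<close> is the shifted integrand
      cut off to that range.\<close>
    let ?G = "\<lambda>t. g (t - 2 * r) * indicator {-r..r} (t - 2 * r)"
    have "(\<integral>\<^sup>+z. g (z \<bullet> \<nu>) * indicator (cball 0 r) z \<partial>lborel)
       = (\<integral>\<^sup>+z. g ((- (2 * r) *\<^sub>R \<nu> + z) \<bullet> \<nu>) * indicator (cball 0 r) (- (2 * r) *\<^sub>R \<nu> + z) \<partial>lborel)"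
      by (rule nn_integral_lborel_translate[symmetric]) measurable
    \<comment> \<open>On the shifted ball \<open>norm z \<le> 3 * r\<close> and
      \<open>0 < z \<bullet> \<nu>\<close>, so the inserted factor
      \<open>(3 * r) powr (?n + 1) * kern 1 z\<close> is at least 1.\<close>
    also have "\<dots> \<le> (\<integral>\<^sup>+z. ennreal ((3 * r) powr (?n + 1)) * ((ennreal (kern 1 z) * indicator {z. 0 < z \<bullet> \<nu>} z) * ?G (z \<bullet> \<nu>)) \<partial>lborel)"
    proof (intro nn_integral_mono)
      fix z :: 'a
      show "g ((- (2 * r) *\<^sub>R \<nu> + z) \<bullet> \<nu>) * indicator (cball 0 r) (- (2 * r) *\<^sub>R \<nu> + z)
         \<le> ennreal ((3 * r) powr (?n + 1)) * ((ennreal (kern 1 z) * indicator {z. 0 < z \<bullet> \<nu>} z) * ?G (z \<bullet> \<nu>))"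
      proof (cases "norm (- (2 * r) *\<^sub>R \<nu> + z) \<le> r")
        case True
        have e: "(- (2 * r) *\<^sub>R \<nu> + z) \<bullet> \<nu> = z \<bullet> \<nu> - 2 * r" using \<nu>\<nu> by (simp add: inner_diff_left)
        have b: "\<bar>z \<bullet> \<nu> - 2 * r\<bar> \<le> r" using inl[of "- (2 * r) *\<^sub>R \<nu> + z"] True e by simp
        have "norm z \<le> norm ((2 * r) *\<^sub>R \<nu>) + norm (- (2 * r) *\<^sub>R \<nu> + z)"
          using norm_triangle_ineq[of "(2 * r) *\<^sub>R \<nu>" "- (2 * r) *\<^sub>R \<nu> + z"] by simp
        then have n3: "norm z \<le> 3 * r" using True \<nu> r by simp
        have zp: "0 < z \<bullet> \<nu>" using b r by linarith
        then have "0 < norm z" using inl[of z] by linarith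
        then have "1 = norm z powr (?n + 1) * kern 1 z" by (simp add: powr_add[symmetric] del: powr_minus)
        also have "\<dots> \<le> (3 * r) powr (?n + 1) * kern 1 z"
          using n3 by (intro mult_right_mono powr_mono2) auto
        finally have "ennreal 1 \<le> ennreal ((3 * r) powr (?n + 1) * kern 1 z)" by (intro ennreal_leI)
        then have 1: "1 \<le> ennreal ((3 * r) powr (?n + 1)) * ennreal (kern 1 z)"
          by (simp add: ennreal_mult)
        have "g (z \<bullet> \<nu> - 2 * r) \<le> g (z \<bullet> \<nu> - 2 * r) * (ennreal ((3 * r) powr (?n + 1)) * ennreal (kern 1 z))"
          using mult_left_mono[OF 1, of "g (z \<bullet> \<nu> - 2 * r)"] by simp
        then show ?thesis using True b zp unfolding e by (simp add: indicator_def abs_le_iff mult_ac)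
      qed (simp add: indicator_def)
    qed
    also have "\<dots> = ennreal ((3 * r) powr (?n + 1)) * (\<integral>\<^sup>+z. (ennreal (kern 1 z) * indicator {z. 0 < z \<bullet> \<nu>} z) * ?G (z \<bullet> \<nu>) \<partial>lborel)"
      by (rule nn_integral_cmult) simp
    also have "(\<integral>\<^sup>+z. (ennreal (kern 1 z) * indicator {z. 0 < z \<bullet> \<nu>} z) * ?G (z \<bullet> \<nu>) \<partial>lborel)
       = (\<integral>\<^sup>+t. ?G t \<partial>distr (density lborel (\<lambda>z. ennreal (kern 1 z) * indicator {z. 0 < z \<bullet> \<nu>} z)) borel (\<lambda>z. z \<bullet> \<nu>))"
      by (simp add: nn_integral_distr nn_integral_density)
    also have "\<dots> = (\<integral>\<^sup>+t. ennreal (C * t powr (- 1 - 1)) * indicator {0<..} t * ?G t \<partial>lborel)"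
      unfolding C(3) by (simp add: nn_integral_density)
    also have "\<dots> \<le> (\<integral>\<^sup>+t. ennreal (K * r powr (- 2)) * ?G t \<partial>lborel)"
    proof (intro nn_integral_mono)
      fix t :: real
      show "ennreal (C * t powr (- 1 - 1)) * indicator {0<..} t * ?G t \<le> ennreal (K * r powr (- 2)) * ?G t"
      proof (cases "t \<ge> r")
        case True
        then have "C * t powr (- 1 - 1) \<le> K * r powr (- 2)"
          using C(1,2) K r powr_mono2'[of "-2" r t] by (intro mult_mono) auto
        then show ?thesis by (intro mult_right_mono) (auto simp: indicator_def ennreal_leI)
      qed (auto simp: indicator_def)
    qed
    also have "\<dots> = ennreal (K * r powr (- 2)) * (\<integral>\<^sup>+t. ?G t \<partial>lborel)"
      by (rule nn_integral_cmult) simp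
    also have "(\<integral>\<^sup>+t. ?G t \<partial>lborel) = (\<integral>\<^sup>+t. g t * indicator {-r..r} t \<partial>lborel)"
      using nn_integral_lborel_translate[of "\<lambda>t. g t * indicator {-r..r} t" "- (2 * r)"] by simp
    also have "ennreal ((3 * r) powr (?n + 1)) * (ennreal (K * r powr (- 2)) * (\<integral>\<^sup>+t. g t * indicator {-r..r} t \<partial>lborel))
       = ennreal ((3 * r) powr (?n + 1) * (K * r powr (- 2))) * (\<integral>\<^sup>+t. g t * indicator {-r..r} t \<partial>lborel)"
      using K by (simp add: ennreal_mult mult.assoc)
    also have "(3 * r) powr (?n + 1) * (K * r powr (- 2)) = 3 powr (?n + 1) * K * (r powr (?n + 1) * r powr (- 2))"
      using r by (simp add: powr_mult)
    also have "r powr (?n + 1) * r powr (- 2) = r powr (?n - 1)" by (simp add: powr_add[symmetric])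
    finally show "(\<integral>\<^sup>+z. g (z \<bullet> \<nu>) * indicator (cball 0 r) z \<partial>lborel) \<le> ennreal (3 powr (?n + 1) * K * r powr (?n - 1)) * (\<integral>\<^sup>+t. g t * indicator {-r..r} t \<partial>lborel)"
      by (simp add: add_mono mult_left_mono order_trans)
  qed
qed

lemma nn_integral_inner_kernel_le:
  assumes a: "-1 < a"
  obtains C where "0 \<le> C"
    "\<forall>g\<in>borel_measurable borel. \<forall>\<nu>::'a::euclidean_space. norm \<nu> = 1 \<longrightarrow>
      (\<integral>\<^sup>+z. g (z \<bullet> \<nu>) * ennreal (kern a z) \<partial>lborel) \<le> ennreal C * (\<integral>\<^sup>+t. g t * ennreal (\<bar>t\<bar> powr (- 1 - a)) \<partial>lborel)"
proof -
  let ?n = "real DIM('a)"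
  obtain C where C: "0 \<le> C"
    "\<forall>g\<in>borel_measurable borel. \<forall>\<nu>::'a. \<forall>r>0. norm \<nu> = 1 \<longrightarrow>
      (\<integral>\<^sup>+z. g (z \<bullet> \<nu>) * indicator (cball 0 r) z \<partial>lborel) \<le> ennreal (C * r powr (?n - 1)) * (\<integral>\<^sup>+t. g t * indicator {-r..r} t \<partial>lborel)"
    by (rule nn_integral_inner_cball_le[where 'a='a])
  have n1: "1 \<le> ?n" using DIM_positive[where 'a='a] by linarith
  have b: "0 < ?n + a" using n1 a by linarith
  show ?thesis
  proof (rule that[of "C * (?n + a) / (1 + a)"], use C b a in simp, intro ballI allI impI)
    fix g :: "real \<Rightarrow> ennreal" and \<nu> :: 'a
    assume [measurable]: "g \<in> borel_measurable borel" and \<nu>: "norm \<nu> = 1"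
    have "(\<integral>\<^sup>+z. g (z \<bullet> \<nu>) * ennreal (kern a z) \<partial>lborel)
       \<le> (\<integral>\<^sup>+r. ennreal ((?n + a) * r powr (- (?n + a) - 1)) * indicator {0<..} r * (\<integral>\<^sup>+z. g (z \<bullet> \<nu>) * indicator (cball 0 r) z \<partial>lborel) \<partial>lborel)"
      by (rule nn_integral_norm_powr_le_layers) (use b in auto)
    also have "\<dots> \<le> (\<integral>\<^sup>+r. (\<integral>\<^sup>+t. ennreal (C * (?n + a)) * (ennreal (r powr (- a - 2)) * indicator {0<..} r) * (g t * indicator {t. \<bar>t\<bar> \<le> r} t) \<partial>lborel) \<partial>lborel)"
    proof (intro nn_integral_mono)
      fix r :: real
      show "ennreal ((?n + a) * r powr (- (?n + a) - 1)) * indicator {0<..} r * (\<integral>\<^sup>+z. g (z \<bullet> \<nu>) * indicator (cball 0 r) z \<partial>lborel)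
         \<le> (\<integral>\<^sup>+t. ennreal (C * (?n + a)) * (ennreal (r powr (- a - 2)) * indicator {0<..} r) * (g t * indicator {t. \<bar>t\<bar> \<le> r} t) \<partial>lborel)"
      proof (cases "0 < r")
        case True
        have "ennreal ((?n + a) * r powr (- (?n + a) - 1)) * indicator {0<..} r * (\<integral>\<^sup>+z. g (z \<bullet> \<nu>) * indicator (cball 0 r) z \<partial>lborel)
          \<le> ennreal ((?n + a) * r powr (- (?n + a) - 1)) * 1 * (ennreal (C * r powr (?n - 1)) * (\<integral>\<^sup>+t. g t * indicator {-r..r} t \<partial>lborel))"
          using True \<nu> by (intro mult_mono C(2)[rule_format]) auto
        also have "\<dots> = ennreal ((?n + a) * r powr (- (?n + a) - 1) * (C * r powr (?n - 1))) * (\<integral>\<^sup>+t. g t * indicator {-r..r} t \<partial>lborel)"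
          using C(1) b by (simp add: ennreal_mult mult.assoc)
        also have "(?n + a) * r powr (- (?n + a) - 1) * (C * r powr (?n - 1)) = C * (?n + a) * (r powr (- (?n + a) - 1) * r powr (?n - 1))"
          by simp
        also have "r powr (- (?n + a) - 1) * r powr (?n - 1) = r powr (- a - 2)" by (simp add: powr_add[symmetric])
        also have "{-r..r} = {t. \<bar>t\<bar> \<le> r}" by auto
        also have "ennreal (C * (?n + a) * r powr (- a - 2)) * (\<integral>\<^sup>+t. g t * indicator {t. \<bar>t\<bar> \<le> r} t \<partial>lborel)
          = (\<integral>\<^sup>+t. ennreal (C * (?n + a)) * (ennreal (r powr (- a - 2)) * indicator {0<..} r) * (g t * indicator {t. \<bar>t\<bar> \<le> r} t) \<partial>lborel)"
          using True C(1) b by (subst nn_integral_cmult) (auto simp: ennreal_mult)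
        finally show ?thesis .
      qed simp
    qed
    also have "\<dots> = (\<integral>\<^sup>+t. (\<integral>\<^sup>+r. ennreal (C * (?n + a)) * (ennreal (r powr (- a - 2)) * indicator {0<..} r) * (g t * indicator {t. \<bar>t\<bar> \<le> r} t) \<partial>lborel) \<partial>lborel)"
      by (rule lborel_pair.Fubini') (simp add: indicator_def split_beta', measurable)
    also have "\<dots> \<le> (\<integral>\<^sup>+t. ennreal (C * (?n + a) / (1 + a)) * (g t * ennreal (\<bar>t\<bar> powr (- 1 - a))) \<partial>lborel)"
    proof (rule nn_integral_mono_AE, rule AE_mp[OF AE_lborel_singleton[of "0::real"]], intro AE_I2 impI)
      fix t :: real assume t: "t \<noteq> 0"
      have "(\<integral>\<^sup>+r. ennreal (C * (?n + a)) * (ennreal (r powr (- a - 2)) * indicator {0<..} r) * (g t * indicator {t. \<bar>t\<bar> \<le> r} t) \<partial>lborel)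
        = (\<integral>\<^sup>+r. (ennreal (C * (?n + a)) * g t) * (ennreal (r powr (- a - 2)) * indicator {\<bar>t\<bar>..} r) \<partial>lborel)"
        using t by (intro nn_integral_cong) (auto simp: indicator_def mult_ac)
      also have "\<dots> = (ennreal (C * (?n + a)) * g t) * ennreal (\<bar>t\<bar> powr (- 1 - a) / (1 + a))"
        using nn_integral_powr_atLeast[of "- a - 2" "\<bar>t\<bar>"] t a by (subst nn_integral_cmult) (auto simp: algebra_simps)
      also have "\<dots> = ennreal (C * (?n + a)) * ennreal (\<bar>t\<bar> powr (- 1 - a) / (1 + a)) * g t" by (simp add: mult_ac)
      also have "ennreal (C * (?n + a)) * ennreal (\<bar>t\<bar> powr (- 1 - a) / (1 + a)) = ennreal (C * (?n + a) / (1 + a)) * ennreal (\<bar>t\<bar> powr (- 1 - a))"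
        using C(1) b a by (simp add: ennreal_mult[symmetric])
      finally show "(\<integral>\<^sup>+r. ennreal (C * (?n + a)) * (ennreal (r powr (- a - 2)) * indicator {0<..} r) * (g t * indicator {t. \<bar>t\<bar> \<le> r} t) \<partial>lborel)
        \<le> ennreal (C * (?n + a) / (1 + a)) * (g t * ennreal (\<bar>t\<bar> powr (- 1 - a)))"
        by (simp add: mult_ac)
    qed
    also have "\<dots> = ennreal (C * (?n + a) / (1 + a)) * (\<integral>\<^sup>+t. g t * ennreal (\<bar>t\<bar> powr (- 1 - a)) \<partial>lborel)"
      by (rule nn_integral_cmult) simp
    finally show "(\<integral>\<^sup>+z. g (z \<bullet> \<nu>) * ennreal (kern a z) \<partial>lborel)
      \<le> ennreal (C * (?n + a) / (1 + a)) * (\<integral>\<^sup>+t. g t * ennreal (\<bar>t\<bar> powr (- 1 - a)) \<partial>lborel)" .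
  qed
qed

text \<open>The smaller base dominates the product. This separates singularities sitting at two
  different points, so that each can be integrated on its own.\<close>

lemma powr_neg_mult_le_sum:
  fixes x y :: real
  assumes "0 \<le> al" "0 \<le> be" "0 \<le> x" "0 \<le> y"
  shows "x powr (- al) * y powr (- be) \<le> x powr (- (al + be)) + y powr (- (al + be))"
proof (cases "x = 0 \<or> y = 0")
  case False
  then have p: "0 < x" "0 < y" using assms by auto
  show ?thesis
  proof (cases "x \<le> y")
    case True
    have "x powr (- al) * y powr (- be) \<le> x powr (- al) * x powr (- be)"
      using True p assms by (intro mult_left_mono powr_mono2') auto
    also have "\<dots> = x powr (- (al + be))" by (simp add: powr_add[symmetric] del: powr_minus)
    finally show ?thesis by (simp add: add_increasing2 del: powr_minus)
  next
    case False
    have "x powr (- al) * y powr (- be) \<le> y powr (- al) * y powr (- be)"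
      using False p assms by (intro mult_right_mono powr_mono2') auto
    also have "\<dots> = y powr (- (al + be))" by (simp add: powr_add[symmetric] del: powr_minus)
    finally show ?thesis by (simp add: add_increasing del: powr_minus)
  qed
qed auto

text \<open>After projection the integrand has singularities at \<open>t = 0\<close> and
  \<open>t = - d\<close>. Once they are separated, each has exponent at most
  \<open>1 + a + \<zeta> + \<eta>\<close> in absolute value, and this is below 1 precisely by the
  last hypothesis. The bound cannot degenerate as \<open>d\<close> tends to 0, since merged
  singularities have the same total exponent.\<close>

lemma nn_integral_singular_kernel_bounded:
  assumes a: "-1 < a" "0 \<le> \<eta>" "0 \<le> \<zeta>" "\<eta> + \<zeta> + a < 0"
  obtains C where "0 \<le> C"
    "\<forall>(\<nu>::'a::euclidean_space) d. norm \<nu> = 1 \<longrightarrow> 0 \<le> d \<longrightarrow> d \<le> 1 \<longrightarrow>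
      (\<integral>\<^sup>+z. ennreal (kern a z * (\<bar>d + z \<bullet> \<nu>\<bar> powr (- \<eta>) * \<bar>z \<bullet> \<nu>\<bar> powr (- \<zeta>))) * indicator (cball 0 1) z \<partial>lborel) \<le> ennreal C"
proof -
  let ?n = "real DIM('a)"
  obtain C where C: "0 \<le> C"
    "\<forall>g\<in>borel_measurable borel. \<forall>\<nu>::'a. norm \<nu> = 1 \<longrightarrow>
      (\<integral>\<^sup>+z. g (z \<bullet> \<nu>) * ennreal (kern a z) \<partial>lborel) \<le> ennreal C * (\<integral>\<^sup>+t. g t * ennreal (\<bar>t\<bar> powr (- 1 - a)) \<partial>lborel)"
    by (rule nn_integral_inner_kernel_le[where 'a='a, OF a(1)])
  define \<gamma> where "\<gamma> = 1 + a + \<zeta> + \<eta>"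
  define B where "B = 2 * (2 powr (1 - \<gamma>) / (1 - \<gamma>))"
  have \<gamma>: "0 < \<gamma>" "\<gamma> < 1" using a unfolding \<gamma>_def by auto
  have B: "0 \<le> B" unfolding B_def using \<gamma> by simp
  \<comment> \<open>The interval \<open>{-2..2}\<close> contains both \<open>t\<close> and
    \<open>d + t\<close> when \<open>\<bar>t\<bar> \<le> 1\<close> and
    \<open>0 \<le> d \<le> 1\<close>.\<close>
  have I2: "(\<integral>\<^sup>+t. ennreal (\<bar>t\<bar> powr (- \<gamma>)) * indicator {-2..2} t \<partial>lborel) \<le> ennreal B"
    unfolding B_def by (rule nn_integral_abs_powr_ball) (use \<gamma> in auto)
  show ?thesis
  proof (rule that[of "C * (B + B)"], use C B in simp, intro allI impI)
    fix \<nu> :: 'a and d :: real assume \<nu>: "norm \<nu> = 1" and d: "0 \<le> d" "d \<le> 1"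
    have inl: "\<bar>z \<bullet> \<nu>\<bar> \<le> norm z" for z using Cauchy_Schwarz_ineq2[of z \<nu>] \<nu> by simp
    let ?g = "\<lambda>t. ennreal (\<bar>d + t\<bar> powr (- \<eta>) * \<bar>t\<bar> powr (- \<zeta>)) * indicator {-1..1} t"
    have "(\<integral>\<^sup>+z. ennreal (kern a z * (\<bar>d + z \<bullet> \<nu>\<bar> powr (- \<eta>) * \<bar>z \<bullet> \<nu>\<bar> powr (- \<zeta>))) * indicator (cball 0 1) z \<partial>lborel)
      \<le> (\<integral>\<^sup>+z. ?g (z \<bullet> \<nu>) * ennreal (kern a z) \<partial>lborel)"
    proof (intro nn_integral_mono)
      fix z :: 'a
      show "ennreal (kern a z * (\<bar>d + z \<bullet> \<nu>\<bar> powr (- \<eta>) * \<bar>z \<bullet> \<nu>\<bar> powr (- \<zeta>))) * indicator (cball 0 1) z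
        \<le> ?g (z \<bullet> \<nu>) * ennreal (kern a z)"
        using inl[of z] by (auto simp: indicator_def ennreal_mult mult_ac)
    qed
    also have "\<dots> \<le> ennreal C * (\<integral>\<^sup>+t. ?g t * ennreal (\<bar>t\<bar> powr (- 1 - a)) \<partial>lborel)"
      by (rule C(2)[rule_format]) (use \<nu> in auto)
    also have "(\<integral>\<^sup>+t. ?g t * ennreal (\<bar>t\<bar> powr (- 1 - a)) \<partial>lborel)
      \<le> (\<integral>\<^sup>+t. ennreal (\<bar>t\<bar> powr (- \<gamma>)) * indicator {-2..2} t + ennreal (\<bar>d + t\<bar> powr (- \<gamma>)) * indicator {-2..2} (d + t) \<partial>lborel)"
    proof (intro nn_integral_mono)
      fix t :: real
      have "\<bar>t\<bar> powr (- \<zeta>) * \<bar>t\<bar> powr (- 1 - a) = \<bar>t\<bar> powr (- (1 + a + \<zeta>))"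
        by (simp add: powr_add[symmetric] algebra_simps del: powr_minus)
      then have "(\<bar>d + t\<bar> powr (- \<eta>) * \<bar>t\<bar> powr (- \<zeta>)) * \<bar>t\<bar> powr (- 1 - a)
         = \<bar>t\<bar> powr (- (1 + a + \<zeta>)) * \<bar>d + t\<bar> powr (- \<eta>)" by simp
      also have "\<dots> \<le> \<bar>t\<bar> powr (- \<gamma>) + \<bar>d + t\<bar> powr (- \<gamma>)"
        unfolding \<gamma>_def using a by (intro powr_neg_mult_le_sum) auto
      finally have "ennreal ((\<bar>d + t\<bar> powr (- \<eta>) * \<bar>t\<bar> powr (- \<zeta>)) * \<bar>t\<bar> powr (- 1 - a)) \<le> ennreal (\<bar>t\<bar> powr (- \<gamma>) + \<bar>d + t\<bar> powr (- \<gamma>))"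
        by (rule ennreal_leI)
      then show "?g t * ennreal (\<bar>t\<bar> powr (- 1 - a)) \<le> ennreal (\<bar>t\<bar> powr (- \<gamma>)) * indicator {-2..2} t + ennreal (\<bar>d + t\<bar> powr (- \<gamma>)) * indicator {-2..2} (d + t)"
        using d by (auto simp: indicator_def ennreal_mult'' ennreal_plus simp del: powr_minus)
    qed
    also have "\<dots> = (\<integral>\<^sup>+t. ennreal (\<bar>t\<bar> powr (- \<gamma>)) * indicator {-2..2} t \<partial>lborel) + (\<integral>\<^sup>+t. ennreal (\<bar>d + t\<bar> powr (- \<gamma>)) * indicator {-2..2} (d + t) \<partial>lborel)"
      by (rule nn_integral_add) auto
    also have "(\<integral>\<^sup>+t. ennreal (\<bar>d + t\<bar> powr (- \<gamma>)) * indicator {-2..2} (d + t) \<partial>lborel) = (\<integral>\<^sup>+t. ennreal (\<bar>t\<bar> powr (- \<gamma>)) * indicator {-2..2} t \<partial>lborel)"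
      by (rule nn_integral_lborel_translate) simp
    also have "(\<integral>\<^sup>+t. ennreal (\<bar>t\<bar> powr (- \<gamma>)) * indicator {-2..2} t \<partial>lborel) + (\<integral>\<^sup>+t. ennreal (\<bar>t\<bar> powr (- \<gamma>)) * indicator {-2..2} t \<partial>lborel) \<le> ennreal B + ennreal B"
      by (intro add_mono I2)
    also have "ennreal C * (ennreal B + ennreal B) = ennreal (C * (B + B))"
      using C(1) B by (subst ennreal_mult) (auto simp only: ennreal_plus add_nonneg_nonneg)
    finally show "(\<integral>\<^sup>+z. ennreal (kern a z * (\<bar>d + z \<bullet> \<nu>\<bar> powr (- \<eta>) * \<bar>z \<bullet> \<nu>\<bar> powr (- \<zeta>))) * indicator (cball 0 1) z \<partial>lborel) \<le> ennreal (C * (B + B))"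
      by (simp add: mult_left_mono)
  qed
qed

section \<open>Distance to the boundary of a \<open>C\<^sup>1\<^sup>,\<^sup>1\<close> domain\<close>

text \<open>Once the linear part at \<open>b\<close> is subtracted, the gradient along the segment
  is at most \<open>L * dist y b\<close>, and the mean value inequality supplies the second factor
  of the distance.\<close>

lemma lipschitz_gradient_remainder:
  fixes \<Phi> :: "'a::euclidean_space \<Rightarrow> real"
  assumes der: "\<And>x. (\<Phi> has_derivative (\<lambda>h. N x \<bullet> h)) (at x)"
    and lip: "\<And>x y. norm (N x - N y) \<le> L * dist x y"
  shows "\<bar>\<Phi> y - \<Phi> b - N b \<bullet> (y - b)\<bar> \<le> L * (norm (y - b))\<^sup>2"
proof -
  let ?g = "\<lambda>x. \<Phi> x - N b \<bullet> x"
  have L: "0 \<le> L * dist y b" using norm_ge_zero lip order_trans by blast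
  have "norm (?g (b + (y - b)) - ?g b) \<le> norm (y - b) * (L * dist y b)"
  proof (rule differentiable_bound_segment[where G = UNIV and f' = "\<lambda>x h. N x \<bullet> h - N b \<bullet> h"])
    fix x :: 'a
    show "(?g has_derivative (\<lambda>h. N x \<bullet> h - N b \<bullet> h)) (at x within UNIV)"
      using has_derivative_diff[OF der[of x] has_derivative_inner_right[OF has_derivative_ident]] by simp
  next
    fix t :: real assume t: "t \<in> {0..1}"
    have "norm (N (b + t *\<^sub>R (y - b)) - N b) \<le> L * dist (b + t *\<^sub>R (y - b)) b" by (rule lip)
    also have "\<dots> = t * (L * dist y b)" using t by (simp add: dist_norm)
    also have "\<dots> \<le> 1 * (L * dist y b)" using t L by (intro mult_right_mono) auto
    finally have n: "norm (N (b + t *\<^sub>R (y - b)) - N b) \<le> L * dist y b" by simp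
    show "onorm (\<lambda>h. N (b + t *\<^sub>R (y - b)) \<bullet> h - N b \<bullet> h) \<le> L * dist y b"
    proof (rule onorm_bound[OF L])
      fix h
      have "norm (N (b + t *\<^sub>R (y - b)) \<bullet> h - N b \<bullet> h) = \<bar>(N (b + t *\<^sub>R (y - b)) - N b) \<bullet> h\<bar>"
        by (simp add: inner_diff_left)
      also have "\<dots> \<le> norm (N (b + t *\<^sub>R (y - b)) - N b) * norm h" by (rule Cauchy_Schwarz_ineq2)
      also have "\<dots> \<le> L * dist y b * norm h" using n by (intro mult_right_mono) auto
      finally show "norm (N (b + t *\<^sub>R (y - b)) \<bullet> h - N b \<bullet> h) \<le> L * dist y b * norm h" .
    qed
  qed auto
  then show ?thesis by (simp add: inner_diff_right dist_norm power2_eq_square algebra_simps)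
qed

text \<open>Near \<open>b\<close> the domain is where \<open>\<Phi>\<close> is positive. In a ball
  of radius \<open>R\<close> tangent at \<open>b\<close>, the vector \<open>v = y - b\<close>
  satisfies \<open>norm v\<close> squared \<open>< 2 * R * (n \<bullet> v)\<close>, so for small
  \<open>R\<close> the linear term of \<open>\<Phi>\<close> beats its quadratic remainder and fixes
  the sign.\<close>

lemma C11_graph_touching_balls:
  fixes \<Omega> :: "'a::euclidean_space set" and \<gamma> :: "'a \<Rightarrow> real"
  assumes op: "open \<Omega>" and r: "0 < r" and \<nu>: "norm \<nu> = 1" and C11: "C11 \<gamma>"
    and inv: "\<And>x. \<gamma> x = \<gamma> (x - (x \<bullet> \<nu>) *\<^sub>R \<nu>)"
    and graph: "\<Omega> \<inter> ball x0 r = {x \<in> ball x0 r. x \<bullet> \<nu> > \<gamma> x}"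
  obtains R where "0 < R"
    "\<And>b. b \<in> frontier \<Omega> \<Longrightarrow> b \<in> ball x0 (r / 2) \<Longrightarrow>
       \<exists>n. norm n = 1 \<and> ball (b + R *\<^sub>R n) R \<subseteq> \<Omega> \<and> ball (b - R *\<^sub>R n) R \<inter> \<Omega> = {}"
proof -
  obtain D L0 where D: "\<And>x. (\<gamma> has_derivative (\<lambda>h. D x \<bullet> h)) (at x)"
    and L0: "\<And>x y. norm (D x - D y) \<le> L0 * dist x y"
    using C11 unfolding C11_def by blast
  define L where "L = max L0 1"
  have L: "norm (D x - D y) \<le> L * dist x y" for x y
    unfolding L_def by (rule order_trans[OF L0 mult_right_mono[OF max.cobounded1 zero_le_dist]])
  have L1: "1 \<le> L" unfolding L_def by simp
  define \<Phi> where "\<Phi> x = x \<bullet> \<nu> - \<gamma> x" for x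
  define N where "N x = \<nu> - D x" for x
  have \<nu>\<nu>: "\<nu> \<bullet> \<nu> = 1" using \<nu> by (simp add: norm_eq_1)
  have der: "(\<Phi> has_derivative (\<lambda>h. N x \<bullet> h)) (at x)" for x
    unfolding \<Phi>_def N_def by (rule derivative_eq_intros D refl)+ (simp add: inner_diff_left inner_commute[of \<nu>] fun_eq_iff)
  have lip: "norm (N x - N y) \<le> L * dist x y" for x y
    using L[of y x] unfolding N_def by (simp add: dist_commute)
  \<comment> \<open>The graph function is constant along \<open>\<nu>\<close>, so its gradient is
    orthogonal to \<open>\<nu>\<close>; hence \<open>N x\<close> has component 1 along
    \<open>\<nu>\<close> and its norm is at least 1.\<close>
  have D\<nu>: "D x \<bullet> \<nu> = 0" for x
  proof -
    have c: "\<gamma> (x + t *\<^sub>R \<nu>) = \<gamma> x" for t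
      using inv[of "x + t *\<^sub>R \<nu>"] inv[of x] \<nu>\<nu> by (simp add: inner_left_distrib algebra_simps)
    have "((\<lambda>t. \<gamma> (x + t *\<^sub>R \<nu>)) has_derivative (\<lambda>h. D (x + 0 *\<^sub>R \<nu>) \<bullet> (h *\<^sub>R \<nu>))) (at 0)"
      by (rule has_derivative_compose[OF _ D, of "\<lambda>t. x + t *\<^sub>R \<nu>"]) (auto intro!: derivative_eq_intros)
    moreover have "((\<lambda>t. \<gamma> (x + t *\<^sub>R \<nu>)) has_derivative (\<lambda>h. 0)) (at (0::real))"
      unfolding c by (rule has_derivative_const)
    ultimately have "(\<lambda>h. D (x + 0 *\<^sub>R \<nu>) \<bullet> (h *\<^sub>R \<nu>)) = (\<lambda>h. 0)" by (rule has_derivative_unique)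
    from fun_cong[OF this, of 1] show ?thesis by simp
  qed
  have N1: "1 \<le> norm (N x)" for x
  proof -
    have "N x \<bullet> \<nu> = 1" unfolding N_def by (simp add: inner_diff_left \<nu>\<nu> D\<nu>)
    then show ?thesis using Cauchy_Schwarz_ineq2[of "N x" \<nu>] \<nu> by simp
  qed
  \<comment> \<open>The first bound keeps points within \<open>2 * R\<close> of \<open>b\<close>
    inside the chart, the second gives \<open>L * (2 * R) \<le> 1\<close>, which absorbs the
    remainder.\<close>
  define R where "R = min (r / 4) (1 / (2 * L))"
  have R: "0 < R" "R \<le> r / 4" "L * (2 * R) \<le> 1"
    using r L1 unfolding R_def by (auto simp: min_def field_simps)
  show ?thesis
  proof (rule that[OF R(1)])
    fix b assume b: "b \<in> frontier \<Omega>" "b \<in> ball x0 (r / 2)"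
    have cont: "continuous_on UNIV \<Phi>"
      using der by (meson continuous_at_imp_continuous_on has_derivative_continuous)
    have bb: "b \<in> ball x0 r" using b r by auto
    have "b \<notin> \<Omega>" using b(1) op by (simp add: frontier_def interior_open)
    then have "b \<notin> {x \<in> ball x0 r. x \<bullet> \<nu> > \<gamma> x}" using graph by blast
    then have "\<Phi> b \<le> 0" using bb unfolding \<Phi>_def by auto
    moreover have "\<not> \<Phi> b < 0"
    proof
      assume neg: "\<Phi> b < 0"
      have "open ({x. \<Phi> x < 0} \<inter> ball x0 r)"
        using cont by (intro open_Int open_Collect_less) auto
      moreover have "b \<in> {x. \<Phi> x < 0} \<inter> ball x0 r" using neg bb by auto
      moreover have "b \<in> closure \<Omega>" using b(1) by (simp add: frontier_def)
      ultimately have "\<Omega> \<inter> ({x. \<Phi> x < 0} \<inter> ball x0 r) \<noteq> {}"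
        by (metis open_Int_closure_eq_empty inf_commute disjoint_iff)
      then obtain y where "y \<in> \<Omega> \<inter> ball x0 r" "\<Phi> y < 0" by blast
      then show False using graph unfolding \<Phi>_def by auto
    qed
    ultimately have \<Phi>b: "\<Phi> b = 0" by simp
    have rem: "\<bar>\<Phi> y - N b \<bullet> (y - b)\<bar> \<le> L * (norm (y - b))\<^sup>2" for y
      using lipschitz_gradient_remainder[of \<Phi> N, OF der lip, of y b] \<Phi>b by simp
    define n where "n = (1 / norm (N b)) *\<^sub>R N b"
    have Npos: "norm (N b) > 0" using N1[of b] by linarith
    have n: "norm n = 1" unfolding n_def using Npos by simp
    have Nn: "N b \<bullet> h = norm (N b) * (n \<bullet> h)" for h unfolding n_def using Npos by simp
    have nn: "n \<bullet> n = 1" using n by (simp add: norm_eq_1)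
    have near: "y \<in> ball x0 r" if "norm (y - b) < 2 * R" for y
    proof -
      have "dist x0 y \<le> dist x0 b + dist b y" by (rule dist_triangle)
      also have "\<dots> < r / 2 + 2 * R" using b(2) that by (intro add_strict_mono) (auto simp: dist_norm norm_minus_commute)
      also have "\<dots> \<le> r" using R by simp
      finally show ?thesis by simp
    qed
    \<comment> \<open>The sign \<open>e\<close> treats both balls at once: \<open>e = 1\<close> for
      the interior ball, \<open>e = -1\<close> for the exterior one.\<close>
    have key: "norm (y - b) < 2 * R \<and> L * (norm (y - b))\<^sup>2 < norm (N b) * (e * (n \<bullet> (y - b)))"
      if y: "y \<in> ball (b + (e * R) *\<^sub>R n) R" and e: "e = 1 \<or> e = -1" for y e
    proof -
      let ?v = "y - b"
      have nv: "norm (?v - (e * R) *\<^sub>R n) < R" using y by (simp add: dist_norm norm_minus_commute algebra_simps)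
      have e2: "e * e = 1" using e by auto
      have "norm ?v \<le> norm (?v - (e * R) *\<^sub>R n) + norm ((e * R) *\<^sub>R n)" by (metis diff_add_cancel norm_triangle_ineq)
      also have "norm ((e * R) *\<^sub>R n) = R" using n R e by (auto simp: abs_mult)
      finally have v2: "norm ?v < 2 * R" using nv by simp
      have "(norm (?v - (e * R) *\<^sub>R n))\<^sup>2 < R\<^sup>2" using nv R by (intro power_strict_mono) auto
      moreover have "(norm (?v - (e * R) *\<^sub>R n))\<^sup>2 = (norm ?v)\<^sup>2 - 2 * R * (e * (n \<bullet> ?v)) + R\<^sup>2"
      proof -
        have "(norm (?v - (e * R) *\<^sub>R n))\<^sup>2 = ?v \<bullet> ?v - 2 * ((e * R) * (n \<bullet> ?v)) + (e * R) * ((e * R) * (n \<bullet> n))"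
          unfolding power2_norm_eq_inner by (simp add: inner_diff_left inner_diff_right inner_commute)
        also have "(e * R) * ((e * R) * (n \<bullet> n)) = R\<^sup>2" using nn e2 by (simp add: power2_eq_square mult_ac)
        finally show ?thesis by (simp add: power2_norm_eq_inner mult_ac)
      qed
      ultimately have q: "(norm ?v)\<^sup>2 < 2 * R * (e * (n \<bullet> ?v))" by simp
      then have "0 < 2 * R * (e * (n \<bullet> ?v))" using zero_le_power2[of "norm ?v"] by (rule le_less_trans[rotated])
      then have pos: "0 < e * (n \<bullet> ?v)" by (rule zero_less_mult_pos) (use R in simp)
      have "L * (norm ?v)\<^sup>2 < L * (2 * R * (e * (n \<bullet> ?v)))" using q L1 by (intro mult_strict_left_mono) auto
      also have "\<dots> = (L * (2 * R)) * (e * (n \<bullet> ?v))" by simp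
      also have "\<dots> \<le> 1 * (e * (n \<bullet> ?v))" using R(3) pos by (intro mult_right_mono) auto
      also have "\<dots> \<le> norm (N b) * (e * (n \<bullet> ?v))" using N1[of b] pos by (intro mult_right_mono) auto
      finally show ?thesis using v2 by simp
    qed
    have "ball (b + R *\<^sub>R n) R \<subseteq> \<Omega>"
    proof
      fix y assume y: "y \<in> ball (b + R *\<^sub>R n) R"
      have k: "norm (y - b) < 2 * R" "L * (norm (y - b))\<^sup>2 < N b \<bullet> (y - b)" using key[of y 1] y Nn by auto
      then have "0 < \<Phi> y" using rem[of y] by (auto simp: abs_le_iff)
      then have "y \<in> {x \<in> ball x0 r. x \<bullet> \<nu> > \<gamma> x}" using near[OF k(1)] unfolding \<Phi>_def by auto
      then show "y \<in> \<Omega>" using graph by blast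
    qed
    moreover have "ball (b - R *\<^sub>R n) R \<inter> \<Omega> = {}"
    proof -
      have "y \<notin> \<Omega>" if y: "y \<in> ball (b - R *\<^sub>R n) R" for y
      proof -
        have k: "norm (y - b) < 2 * R" "L * (norm (y - b))\<^sup>2 < - (N b \<bullet> (y - b))" using key[of y "-1"] y Nn by auto
        then have "\<Phi> y < 0" using rem[of y] by (auto simp: abs_le_iff)
        then have "y \<notin> {x \<in> ball x0 r. x \<bullet> \<nu> > \<gamma> x}" unfolding \<Phi>_def by auto
        then show ?thesis using graph near[OF k(1)] by blast
      qed
      then show ?thesis by blast
    qed
    ultimately show "\<exists>n. norm n = 1 \<and> ball (b + R *\<^sub>R n) R \<subseteq> \<Omega> \<and> ball (b - R *\<^sub>R n) R \<inter> \<Omega> = {}"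
      using n by blast
  qed
qed

text \<open>The two balls are internally tangent at \<open>b\<close>: their centres are
  \<open>R' - R\<close> apart.\<close>

lemma touching_ball_mono:
  fixes b n :: "'a::euclidean_space"
  assumes "norm n = 1" "0 < R" "R \<le> R'"
  shows "ball (b + R *\<^sub>R n) R \<subseteq> ball (b + R' *\<^sub>R n) R'"
proof
  fix y assume y: "y \<in> ball (b + R *\<^sub>R n) R"
  have "dist (b + R' *\<^sub>R n) y \<le> dist (b + R' *\<^sub>R n) (b + R *\<^sub>R n) + dist (b + R *\<^sub>R n) y" by (rule dist_triangle)
  also have "dist (b + R' *\<^sub>R n) (b + R *\<^sub>R n) = R' - R"
    using assms by (simp add: dist_norm flip: scaleR_diff_left)
  finally show "y \<in> ball (b + R' *\<^sub>R n) R'" using y by simp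
qed

text \<open>The local radius is uniform on a smaller ball around each boundary point, and finitely
  many such balls cover the compact frontier. Touching balls may be shrunk, so the least radius
  works everywhere.\<close>

lemma C11_domain_touching_balls:
  fixes \<Omega> :: "'a::euclidean_space set"
  assumes dom: "C11_domain \<Omega>"
  obtains R where "0 < R" "R \<le> 1"
    "\<And>b. b \<in> frontier \<Omega> \<Longrightarrow>
       \<exists>n. norm n = 1 \<and> ball (b + R *\<^sub>R n) R \<subseteq> \<Omega> \<and> ball (b - R *\<^sub>R n) R \<inter> \<Omega> = {}"
proof -
  define P where "P R b \<longleftrightarrow> (\<exists>n. norm n = 1 \<and> ball (b + R *\<^sub>R n) R \<subseteq> \<Omega> \<and> ball (b - R *\<^sub>R n) R \<inter> \<Omega> = {})" for R b
  have mono: "P R b" if PR: "P R' b" and "0 < R" "R \<le> R'" for R R' b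
  proof -
    obtain n where n: "norm n = 1" "ball (b + R' *\<^sub>R n) R' \<subseteq> \<Omega>" "ball (b - R' *\<^sub>R n) R' \<inter> \<Omega> = {}"
      using PR unfolding P_def by blast
    have "ball (b + R *\<^sub>R n) R \<subseteq> ball (b + R' *\<^sub>R n) R'" "ball (b - R *\<^sub>R n) R \<subseteq> ball (b - R' *\<^sub>R n) R'"
      using touching_ball_mono[of n R R' b] touching_ball_mono[of "- n" R R' b] n(1) that by auto
    then show ?thesis unfolding P_def using n by blast
  qed
  have op: "open \<Omega>" and bd: "bounded \<Omega>" using dom unfolding C11_domain_def by auto
  have "\<exists>r R. 0 < r \<and> 0 < R \<and> (\<forall>b \<in> frontier \<Omega> \<inter> ball x0 r. P R b)" if "x0 \<in> frontier \<Omega>" for x0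
  proof -
    obtain r \<nu> \<gamma> where g: "r > 0" "norm \<nu> = 1" "C11 \<gamma>" "\<And>x. \<gamma> x = \<gamma> (x - (x \<bullet> \<nu>) *\<^sub>R \<nu>)"
        "\<Omega> \<inter> ball x0 r = {x \<in> ball x0 r. x \<bullet> \<nu> > \<gamma> x}"
      using dom \<open>x0 \<in> frontier \<Omega>\<close> unfolding C11_domain_def by blast
    obtain R where "0 < R" "\<And>b. b \<in> frontier \<Omega> \<Longrightarrow> b \<in> ball x0 (r / 2) \<Longrightarrow> P R b"
      using C11_graph_touching_balls[OF op g] unfolding P_def by metis
    then show ?thesis using g(1) by (intro exI[of _ "r / 2"] exI[of _ R]) auto
  qed
  then obtain r R where rR: "\<And>x0. x0 \<in> frontier \<Omega> \<Longrightarrow> 0 < r x0 \<and> 0 < R x0 \<and> (\<forall>b \<in> frontier \<Omega> \<inter> ball x0 (r x0). P (R x0) b)"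
    by metis
  have "compact (frontier \<Omega>)" using bd by (rule compact_frontier_bounded)
  then obtain F where F: "F \<subseteq> frontier \<Omega>" "finite F" "frontier \<Omega> \<subseteq> (\<Union>x\<in>F. ball x (r x))"
    by (rule compactE_image[where C = "frontier \<Omega>" and f = "\<lambda>x. ball x (r x)"]) (use rR in \<open>auto intro!: centre_in_ball[THEN iffD2]\<close>)
  \<comment> \<open>Inserting 1 secures \<open>R0 \<le> 1\<close> and keeps the minimum meaningful
    even for an empty cover.\<close>
  define R0 where "R0 = Min (insert 1 (R ` F))"
  have R0: "0 < R0" "R0 \<le> 1" "\<And>x. x \<in> F \<Longrightarrow> R0 \<le> R x"
    unfolding R0_def using F(1,2) rR by (auto simp: Min_gr_iff)
  show ?thesis
  proof (rule that[OF R0(1,2)])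
    fix b assume b: "b \<in> frontier \<Omega>"
    then obtain x where x: "x \<in> F" "b \<in> ball x (r x)" using F(3) by blast
    then have "P (R x) b" using rR F(1) b by blast
    then have "P R0 b" using mono R0(1,3) x(1) by blast
    then show "\<exists>n. norm n = 1 \<and> ball (b + R0 *\<^sub>R n) R0 \<subseteq> \<Omega> \<and> ball (b - R0 *\<^sub>R n) R0 \<inter> \<Omega> = {}"
      unfolding P_def .
  qed
qed

section \<open>Quadratic approximation of the distance by its tangent half-space\<close>

lemma infdist_le_outside_ball:
  fixes c :: "'a::euclidean_space"
  assumes "cball c R \<subseteq> A" "0 \<le> R"
  shows "infdist y A \<le> max 0 (dist y c - R)"
proof (cases "dist y c \<le> R")
  case True
  then have "y \<in> A" using assms(1) by (auto simp: dist_commute)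
  then show ?thesis by simp
next
  case False
  then have d: "0 < norm (y - c)" "R < norm (y - c)" using assms(2) by (auto simp: dist_norm)
  let ?a = "c + (R / norm (y - c)) *\<^sub>R (y - c)"
  have "?a \<in> A" using assms d by (intro subsetD[OF assms(1)]) (simp add: dist_norm)
  then have "infdist y A \<le> dist y ?a" by (rule infdist_le)
  also have "dist y ?a = norm ((1 - R / norm (y - c)) *\<^sub>R (y - c))"
    unfolding dist_norm by (rule arg_cong[of _ _ norm]) (simp add: algebra_simps)
  also have "\<dots> = (1 - R / norm (y - c)) * norm (y - c)" using d by simp
  also have "\<dots> = norm (y - c) - R" using d by (simp add: field_simps)
  finally show ?thesis by (simp add: dist_norm)
qed

lemma infdist_ge_inside_ball:
  fixes c :: "'a::euclidean_space"
  assumes "ball c R \<inter> A = {}" "A \<noteq> {}"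
  shows "R - dist y c \<le> infdist y A"
proof -
  have "R - dist y c \<le> dist y a" if "a \<in> A" for a
  proof -
    have "R \<le> dist c a" using assms(1) that by (force simp: not_less[symmetric])
    then show ?thesis using dist_triangle[of c a y] by (simp add: dist_commute)
  qed
  then show ?thesis using assms(2) by (simp add: infdist_def cINF_greatest)
qed

text \<open>With \<open>t = A + z \<bullet> n\<close> and \<open>m\<close> the quadratic error, the
  squared norm is at most \<open>t\<close> squared plus \<open>norm z\<close> squared; the condition
  \<open>R \<le> 2 * t\<close> lets the cross term \<open>2 * t * m\<close> absorb the
  latter.\<close>

lemma norm_le_paraboloid:
  fixes n z :: "'a::euclidean_space"
  assumes "norm n = 1" "0 < R" "R \<le> 2 * (A + z \<bullet> n)"
  shows "norm (A *\<^sub>R n + z) \<le> A + z \<bullet> n + (norm z)\<^sup>2 / R"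
proof -
  have nn: "n \<bullet> n = 1" using assms(1) by (simp add: norm_eq_1)
  let ?t = "A + z \<bullet> n" let ?m = "(norm z)\<^sup>2 / R"
  have m: "0 \<le> ?m" using assms by simp
  have "(norm (A *\<^sub>R n + z))\<^sup>2 = A\<^sup>2 + 2 * A * (z \<bullet> n) + (norm z)\<^sup>2"
    unfolding power2_norm_eq_inner using nn by (simp add: inner_left_distrib inner_right_distrib inner_commute power2_eq_square algebra_simps)
  also have "\<dots> \<le> ?t\<^sup>2 + (norm z)\<^sup>2" by (simp add: power2_sum)
  also have "?t\<^sup>2 + (norm z)\<^sup>2 \<le> ?t\<^sup>2 + (2 * ?t) * ?m"
  proof -
    have "R * ?m \<le> (2 * ?t) * ?m" using assms m by (intro mult_right_mono) auto
    then show ?thesis using assms by simp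
  qed
  also have "\<dots> \<le> (?t + ?m)\<^sup>2" by (simp add: power2_sum)
  finally have le: "(norm (A *\<^sub>R n + z))\<^sup>2 \<le> (?t + ?m)\<^sup>2" .
  have "0 \<le> 2 * ?t" using assms(2,3) by (meson less_imp_le order_trans)
  then have "0 \<le> ?t" by (simp only: zero_le_mult_iff) simp
  then show ?thesis using power2_le_imp_le[OF le] m by (simp del: divide_nonneg_nonneg)
qed

text \<open>At the boundary point nearest to \<open>x\<close>, the interior ball bounds the distance
  from below and the exterior ball bounds it from above. The small ball outside the domain is an
  exterior ball shrunk to the scale of \<open>x\<close>; it is recorded for the Hardy
  inequality.\<close>

lemma C11_domain_boundary_normal:
  fixes \<Omega> :: "'a::euclidean_space set"
  assumes dom: "C11_domain \<Omega>"
  obtains R where "0 < R" "R \<le> 1"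
    "\<And>x. x \<in> \<Omega> \<Longrightarrow> infdist x (- \<Omega>) \<le> R / 4 \<Longrightarrow>
       \<exists>n. norm n = 1 \<and> ball (x - (2 * infdist x (- \<Omega>)) *\<^sub>R n) (infdist x (- \<Omega>)) \<inter> \<Omega> = {} \<and>
         (\<forall>z. norm z \<le> R / 4 \<longrightarrow>
            infdist x (- \<Omega>) + z \<bullet> n - (norm z)\<^sup>2 / R \<le> infdist (x + z) (- \<Omega>) \<and>
            infdist (x + z) (- \<Omega>) \<le> max 0 (infdist x (- \<Omega>) + z \<bullet> n + (norm z)\<^sup>2 / R))"
proof -
  obtain R where R: "0 < R" "R \<le> 1"
    and balls: "\<And>b. b \<in> frontier \<Omega> \<Longrightarrow>
       \<exists>n. norm n = 1 \<and> ball (b + R *\<^sub>R n) R \<subseteq> \<Omega> \<and> ball (b - R *\<^sub>R n) R \<inter> \<Omega> = {}"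
    using C11_domain_touching_balls[OF dom] by metis
  have op: "open \<Omega>" and bd: "bounded \<Omega>" using dom unfolding C11_domain_def by auto
  have ne: "- \<Omega> \<noteq> {}" using bd not_bounded_UNIV[where 'a='a] by (metis Compl_empty_eq double_complement)
  have cl: "closed (- \<Omega>)" using op by auto
  show ?thesis
  proof (rule that[OF R])
    fix x assume x: "x \<in> \<Omega>" "infdist x (- \<Omega>) \<le> R / 4"
    define d where "d = infdist x (- \<Omega>)"
    obtain b where b: "b \<in> - \<Omega>" "d = dist x b" using infdist_attains_inf[OF cl ne] unfolding d_def by metis
    have d: "0 < d" "d \<le> R / 4" using b x unfolding d_def by auto
    have "b \<in> closure \<Omega>"
    proof -
      have "ball x d \<subseteq> \<Omega>"
      proof
        fix y assume "y \<in> ball x d"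
        then show "y \<in> \<Omega>" using infdist_le[of y "- \<Omega>" x] unfolding d_def by (force simp: not_le)
      qed
      then have "closure (ball x d) \<subseteq> closure \<Omega>" by (rule closure_mono)
      then show ?thesis using d b by (auto simp: closure_ball)
    qed
    then have "b \<in> frontier \<Omega>" using b(1) op by (simp add: frontier_def interior_open)
    then obtain n where n: "norm n = 1" "ball (b + R *\<^sub>R n) R \<subseteq> \<Omega>" "ball (b - R *\<^sub>R n) R \<inter> \<Omega> = {}"
      using balls by blast
    have ext: "cball (b - R *\<^sub>R n) R \<subseteq> - \<Omega>"
    proof -
      have "closure (ball (b - R *\<^sub>R n) R) \<subseteq> - \<Omega>" using n(3) cl by (intro closure_minimal) auto
      then show ?thesis using R by (simp add: closure_ball)
    qed
    have up: "infdist y (- \<Omega>) \<le> max 0 (dist y (b - R *\<^sub>R n) - R)" for y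
      using R by (intro infdist_le_outside_ball[OF ext]) auto
    have lo: "R - dist y (b + R *\<^sub>R n) \<le> infdist y (- \<Omega>)" for y
      using n(2) ne by (intro infdist_ge_inside_ball) auto
    have nn: "n \<bullet> n = 1" using n by (simp add: norm_eq_1)
    \<comment> \<open>The normal of the touching balls must point at \<open>x\<close>: the exterior
      ball forces distance at least \<open>R + d\<close> from its centre, while \<open>x\<close> is
      only \<open>d\<close> away from \<open>b\<close>. This is the equality case of the triangle
      inequality.\<close>
    have xb: "x = b + d *\<^sub>R n"
    proof -
      let ?v = "x - b"
      have "R + d \<le> norm (?v + R *\<^sub>R n)" using up[of x] d unfolding d_def by (simp add: dist_norm algebra_simps)
      then have "(R + d)\<^sup>2 \<le> (norm (?v + R *\<^sub>R n))\<^sup>2" using R d by (intro power_mono) auto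
      also have "\<dots> = (norm ?v)\<^sup>2 + 2 * R * (?v \<bullet> n) + R\<^sup>2"
        unfolding power2_norm_eq_inner using nn by (simp add: inner_left_distrib inner_right_distrib inner_commute power2_eq_square algebra_simps)
      also have "norm ?v = d" using b by (simp add: dist_norm)
      finally have "2 * R * d \<le> 2 * R * (?v \<bullet> n)" by (simp add: power2_sum)
      then have vn: "d \<le> ?v \<bullet> n" using R by simp
      have "(norm (?v - d *\<^sub>R n))\<^sup>2 = (norm ?v)\<^sup>2 - 2 * d * (?v \<bullet> n) + d\<^sup>2"
        unfolding power2_norm_eq_inner using nn by (simp add: inner_diff_left inner_diff_right inner_commute power2_eq_square algebra_simps)
      also have "norm ?v = d" using b by (simp add: dist_norm)
      also have "d\<^sup>2 - 2 * d * (?v \<bullet> n) + d\<^sup>2 \<le> 0" using mult_left_mono[OF vn, of "2 * d"] d by (simp add: power2_eq_square)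
      finally have "norm (?v - d *\<^sub>R n) = 0" by simp
      then show ?thesis by (simp add: algebra_simps)
    qed
    have inl: "\<bar>z \<bullet> n\<bar> \<le> norm z" for z using Cauchy_Schwarz_ineq2[of z n] n by simp
    have "ball (x - (2 * d) *\<^sub>R n) d \<inter> \<Omega> = {}"
    proof -
      have "ball (b + d *\<^sub>R (- n)) d \<subseteq> ball (b + R *\<^sub>R (- n)) R" using d R n by (intro touching_ball_mono) auto
      moreover have "x - (2 * d) *\<^sub>R n = b + d *\<^sub>R (- n)"
      proof -
        have "(2 * d) *\<^sub>R n = d *\<^sub>R n + d *\<^sub>R n" by (metis mult_2 scaleR_left_distrib)
        then show ?thesis unfolding xb by simp
      qed
      ultimately show ?thesis using n(3) by auto
    qed
    moreover have "d + z \<bullet> n - (norm z)\<^sup>2 / R \<le> infdist (x + z) (- \<Omega>) \<and>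
            infdist (x + z) (- \<Omega>) \<le> max 0 (d + z \<bullet> n + (norm z)\<^sup>2 / R)" if z: "norm z \<le> R / 4" for z
    proof
      \<comment> \<open>Since \<open>d\<close> and \<open>norm z\<close> are at most
        \<open>R / 4\<close>, the height \<open>(R - d) - z \<bullet> n\<close> is at least
        \<open>R / 2\<close>, as the paraboloid estimate demands.\<close>
      have "dist (x + z) (b + R *\<^sub>R n) = norm ((R - d) *\<^sub>R (- n) + z)" unfolding xb by (simp add: dist_norm algebra_simps)
      also have "\<dots> \<le> (R - d) + z \<bullet> (- n) + (norm z)\<^sup>2 / R"
        using inl[of z] z d R n by (intro norm_le_paraboloid) auto
      finally show "d + z \<bullet> n - (norm z)\<^sup>2 / R \<le> infdist (x + z) (- \<Omega>)" using lo[of "x + z"] by simp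
    next
      have "dist (x + z) (b - R *\<^sub>R n) = norm ((R + d) *\<^sub>R n + z)" unfolding xb by (simp add: dist_norm algebra_simps)
      also have "\<dots> \<le> (R + d) + z \<bullet> n + (norm z)\<^sup>2 / R"
        using inl[of z] z d R n by (intro norm_le_paraboloid) auto
      finally show "infdist (x + z) (- \<Omega>) \<le> max 0 (d + z \<bullet> n + (norm z)\<^sup>2 / R)" using up[of "x + z"] by linarith
    qed
    ultimately show "\<exists>n. norm n = 1 \<and> ball (x - (2 * infdist x (- \<Omega>)) *\<^sub>R n) (infdist x (- \<Omega>)) \<inter> \<Omega> = {} \<and>
         (\<forall>z. norm z \<le> R / 4 \<longrightarrow>
            infdist x (- \<Omega>) + z \<bullet> n - (norm z)\<^sup>2 / R \<le> infdist (x + z) (- \<Omega>) \<and>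
            infdist (x + z) (- \<Omega>) \<le> max 0 (infdist x (- \<Omega>) + z \<bullet> n + (norm z)\<^sup>2 / R))"
      unfolding d_def[symmetric] using n(1) by blast
  qed
qed

lemma infdist_complement_pos:
  fixes \<Omega> :: "'a::euclidean_space set"
  assumes "open \<Omega>" "bounded \<Omega>" "x \<in> \<Omega>"
  shows "0 < infdist x (- \<Omega>)"
proof -
  have ne: "- \<Omega> \<noteq> {}" using assms not_bounded_UNIV[where 'a='a] by (metis Compl_empty_eq double_complement)
  have cl: "closed (- \<Omega>)" using assms by auto
  show ?thesis using assms in_closed_iff_infdist_zero[OF cl ne, of x] infdist_nonneg[of x "- \<Omega>"] by force
qed

section \<open>The half-line\<close>

text \<open>The numerator of the operator for the half-line profile \<open>max 0 y powr s\<close>,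
  evaluated at the base point \<open>y = 1\<close>.\<close>

definition flat_diff :: "real \<Rightarrow> real \<Rightarrow> real \<Rightarrow> real" where
  "flat_diff s q t = spow (1 - max 0 (1 + t) powr s) q"

lemma flat_diff_measurable [measurable]: "flat_diff s q \<in> borel_measurable borel"
  unfolding flat_diff_def[abs_def] by measurable

lemma flat_diff_pos:
  assumes "0 < s" "0 < t"
  shows "flat_diff s q t = - (((1 + t) powr s - 1) powr q)"
proof -
  have "1 \<le> (1 + t) powr s" using assms by (intro ge_one_powr_ge_zero) auto
  then show ?thesis using assms spow_minus[of "(1 + t) powr s - 1" q] by (simp add: flat_diff_def spow_nonneg)
qed

lemma flat_diff_neg:
  assumes "0 < s" "0 \<le> t" "t \<le> 1"
  shows "flat_diff s q (- t) = (1 - (1 - t) powr s) powr q"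
proof -
  have "(1 - t) powr s \<le> 1" using assms by (intro powr_le1) auto
  then show ?thesis using assms by (simp add: flat_diff_def spow_nonneg)
qed

lemma flat_diff_neg_far:
  assumes "1 \<le> t"
  shows "flat_diff s q (- t) = 1"
  using assms by (simp add: flat_diff_def spow_nonneg)

locale exponents =
  fixes s p :: real
  assumes s: "0 < s" "s < 1" and p: "1 < p"
begin

text \<open>The principal value of the half-line problem vanishes because of an explicit antiderivative. In the variable
  \<open>v = t / (1 + t)\<close> on the side away from the boundary and \<open>v = t\<close> on the side towards it, the two contributions are \<open>prof v * (1 - v) powr (s - 1)\<close>
  and \<open>prof v\<close>, and their difference is the derivative of \<open>prim\<close>.\<close>

definition prof :: "real \<Rightarrow> real" where
  "prof v = (1 - (1 - v) powr s) powr (p - 1) * v powr (- 1 - p * s)"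

definition prim :: "real \<Rightarrow> real" where
  "prim v = (1 - (1 - v) powr s) powr p * v powr (- (p * s)) / (p * s)"

text \<open>The principal value integrand at the point 1, with \<open>1 + t\<close> paired with
  \<open>1 - t\<close>.\<close>

definition sym_flat :: "real \<Rightarrow> real" where
  "sym_flat t = (flat_diff s (p - 1) t + flat_diff s (p - 1) (- t)) * t powr (- 1 - p * s)"

lemma ps_pos: "0 < p * s"
  using s p by simp

lemma one_minus_powr_bounds:
  assumes "0 \<le> v" "v \<le> 1"
  shows "0 \<le> 1 - (1 - v) powr s" "1 - (1 - v) powr s \<le> v"
proof -
  show "0 \<le> 1 - (1 - v) powr s" using powr_le1[of s "1 - v"] s assms by simp
  have "(1 - v) powr 1 \<le> (1 - v) powr s" using s assms by (intro powr_mono') auto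
  then show "1 - (1 - v) powr s \<le> v" using assms by simp
qed

lemma prof_nonneg: "0 \<le> prof v"
  by (simp add: prof_def)

lemma continuous_on_prof: "0 < a \<Longrightarrow> continuous_on {a..1} prof"
  unfolding prof_def[abs_def] using s p one_minus_powr_bounds
  by (intro continuous_intros continuous_on_powr') auto

lemma continuous_on_prim: "0 < a \<Longrightarrow> continuous_on {a..1} prim"
  unfolding prim_def[abs_def] using s p ps_pos one_minus_powr_bounds
  by (intro continuous_intros continuous_on_powr') auto

lemma prim_deriv:
  assumes "0 < v" "v < 1"
  shows "(prim has_real_derivative prof v * ((1 - v) powr (s - 1) - 1)) (at v)"
proof -
  let ?h = "1 - (1 - v) powr s"
  have h: "0 < ?h" using assms s powr_less_mono2[of s "1 - v" 1] by simp
  have D: "(prim has_real_derivative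
      (p * ?h powr (p - 1) * (s * (1 - v) powr (s - 1)) * v powr (- (p * s))
       + ?h powr p * ((- (p * s)) * v powr (- (p * s) - 1))) / (p * s)) (at v)"
    unfolding prim_def[abs_def] using assms h s p
    by (auto intro!: derivative_eq_intros simp: field_simps)
  have e1: "?h powr p = ?h powr (p - 1) * ?h" using h by (simp add: powr_diff)
  have e2: "v powr (- (p * s)) = v powr (- 1 - p * s) * v"
    using assms by (simp add: powr_diff powr_minus field_simps)
  have e3: "(1 - v) powr s = (1 - v) powr (s - 1) * (1 - v)" using assms by (simp add: powr_diff)
  have e4: "v powr (- (p * s) - 1) = v powr (- 1 - p * s)" by (rule arg_cong[of _ _ "\<lambda>x. v powr x"]) simp
  have "(p * ?h powr (p - 1) * (s * (1 - v) powr (s - 1)) * v powr (- (p * s))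
       + ?h powr p * ((- (p * s)) * v powr (- (p * s) - 1))) / (p * s)
     = ?h powr (p - 1) * v powr (- 1 - p * s) * ((1 - v) powr (s - 1) * v - ?h)"
    unfolding e1 e2 e4 using s p by (simp add: field_simps)
  \<comment> \<open>Here the two terms of the derivative collapse: \<open>(1 - v) powr s\<close>
    splits off a factor \<open>1 - v\<close>, and the terms containing \<open>v\<close>
    cancel.\<close>
  also have "(1 - v) powr (s - 1) * v - ?h = (1 - v) powr (s - 1) - 1"
    unfolding e3 by (simp add: algebra_simps)
  finally show ?thesis using D unfolding prof_def by simp
qed

lemma prim_1: "prim 1 = 1 / (p * s)"
  by (simp add: prim_def)

text \<open>The weight is unbounded at \<open>v = 1\<close>, but \<open>prim\<close> is continuous
  up to 1, so the fundamental theorem with derivatives in the interior suffices.\<close>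

lemma has_integral_prof_weighted:
  assumes a: "0 < a" "a < 1"
  shows "((\<lambda>v. prof v * (1 - v) powr (s - 1)) has_integral (1 / (p * s) - prim a + integral {a..1} prof)) {a..1}"
proof -
  have "((\<lambda>v. prof v * ((1 - v) powr (s - 1) - 1)) has_integral (prim 1 - prim a)) {a..1}"
    using a by (intro fundamental_theorem_of_calculus_interior continuous_on_prim)
      (auto intro!: prim_deriv simp flip: has_real_derivative_iff_has_vector_derivative)
  moreover have "(prof has_integral (integral {a..1} prof)) {a..1}"
    using a by (intro integrable_integral integrable_continuous_real continuous_on_prof)
  ultimately have "((\<lambda>v. prof v * ((1 - v) powr (s - 1) - 1) + prof v) has_integral (prim 1 - prim a + integral {a..1} prof)) {a..1}"
    by (rule has_integral_add)
  then show ?thesis by (simp add: algebra_simps prim_1)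
qed

text \<open>For \<open>v = t / (1 + t)\<close> one has \<open>1 - v = 1 / (1 + t)\<close>. The
  Jacobian and the three other factors contribute powers of \<open>1 + t\<close> with exponents
  \<open>-2\<close>, \<open>- s * (p - 1)\<close>, \<open>1 + p * s\<close> and
  \<open>1 - s\<close>, which sum to 0. This cancellation is special to the profile with exponent
  \<open>s\<close>.\<close>

lemma flat_diff_substitution:
  assumes t: "0 < t"
  shows "\<bar>1 / (1 + t)\<^sup>2\<bar> * (prof (t / (1 + t)) * (1 - t / (1 + t)) powr (s - 1))
     = - flat_diff s (p - 1) t * t powr (- 1 - p * s)"
proof -
  let ?u = "1 + t"
  have u: "0 < ?u" using t by simp
  have e1: "1 - t / ?u = ?u powr (-1)" using u by (simp add: powr_minus field_simps)
  have "?u powr s \<ge> 1" using t s by (intro ge_one_powr_ge_zero) auto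
  then have h: "0 \<le> ?u powr s - 1" by simp
  have "1 - (?u powr (-1)) powr s = (?u powr s - 1) * ?u powr (- s)"
  proof -
    have "(?u powr (-1)) powr s = ?u powr (- s)" by (simp only: powr_powr) simp
    moreover have "?u powr s * ?u powr (- s) = 1" using u by (simp flip: powr_add)
    ultimately show ?thesis by (simp only: left_diff_distrib mult_1)
  qed
  then have e2: "(1 - (?u powr (-1)) powr s) powr (p - 1) = (?u powr s - 1) powr (p - 1) * ?u powr (- s * (p - 1))"
    using h by (simp add: powr_mult powr_powr)
  have e3: "(t / ?u) powr (- 1 - p * s) = t powr (- 1 - p * s) * ?u powr (1 + p * s)"
    using t u by (simp add: powr_divide powr_diff powr_minus powr_add field_simps)
  have e4: "(?u powr (-1)) powr (s - 1) = ?u powr (1 - s)" by (simp only: powr_powr) simp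
  have e5: "\<bar>1 / ?u\<^sup>2\<bar> = ?u powr (-2)" using u by (simp add: powr_minus powr_numeral divide_simps)
  have "?u powr (-2) * ?u powr (- s * (p - 1)) * ?u powr (1 + p * s) * ?u powr (1 - s) = ?u powr 0"
    unfolding powr_add[symmetric] by (rule arg_cong[of _ _ "\<lambda>x. ?u powr x"]) (simp add: algebra_simps)
  then have e6: "?u powr (-2) * ?u powr (- s * (p - 1)) * ?u powr (1 + p * s) * ?u powr (1 - s) = 1" using u by simp
  have "\<bar>1 / ?u\<^sup>2\<bar> * (prof (t / ?u) * (1 - t / ?u) powr (s - 1))
     = (?u powr s - 1) powr (p - 1) * t powr (- 1 - p * s) *
       (?u powr (-2) * ?u powr (- s * (p - 1)) * ?u powr (1 + p * s) * ?u powr (1 - s))"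
    unfolding prof_def e1 e2 e3 e4 e5 by (simp only: mult_ac)
  then show ?thesis unfolding e6 using flat_diff_pos[of s t "p - 1"] s t by simp
qed

lemma image_subst: "0 < \<epsilon> \<Longrightarrow> (\<lambda>t. t / (1 + t)) ` {\<epsilon><..} = {\<epsilon> / (1 + \<epsilon>)<..<(1::real)}"
proof (intro equalityI subsetI)
  fix v assume e: "0 < \<epsilon>" and v: "v \<in> {\<epsilon> / (1 + \<epsilon>)<..<(1::real)}"
  then have "v = (v / (1 - v)) / (1 + v / (1 - v))" by (simp add: divide_simps)
  moreover have "\<epsilon> < v / (1 - v)" using e v by (simp add: field_simps)
  ultimately show "v \<in> (\<lambda>t. t / (1 + t)) ` {\<epsilon><..}" by (intro image_eqI[of _ _ "v / (1 - v)"]) auto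
next
  fix v assume e: "0 < \<epsilon>" and "v \<in> (\<lambda>t. t / (1 + t)) ` {\<epsilon><..}"
  then obtain t where t: "v = t / (1 + t)" "\<epsilon> < t" by auto
  have "1 / (1 + t) < 1 / (1 + \<epsilon>)" using e t by (intro divide_strict_left_mono) auto
  moreover have "v = 1 - 1 / (1 + t)" "\<epsilon> / (1 + \<epsilon>) = 1 - 1 / (1 + \<epsilon>)" using e t by (auto simp: field_simps)
  moreover have "0 < 1 / (1 + t)" using e t by simp
  ultimately show "v \<in> {\<epsilon> / (1 + \<epsilon>)<..<1}" by simp
qed

text \<open>The integrand in the variable \<open>v\<close> is nonnegative, so its integrability is
  absolute, as the change of variables requires.\<close>

lemma flat_diff_abs_integrable_tail:
  assumes \<epsilon>: "0 < \<epsilon>"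
  defines "\<theta> \<equiv> \<epsilon> / (1 + \<epsilon>)"
  shows "(\<lambda>t. - flat_diff s (p - 1) t * t powr (- 1 - p * s)) absolutely_integrable_on {\<epsilon><..}"
    and "integral {\<epsilon><..} (\<lambda>t. - flat_diff s (p - 1) t * t powr (- 1 - p * s)) = 1 / (p * s) - prim \<theta> + integral {\<theta>..1} prof"
proof -
  let ?f = "\<lambda>v. prof v * (1 - v) powr (s - 1)"
  have \<theta>: "0 < \<theta>" "\<theta> < 1" using \<epsilon> unfolding \<theta>_def by (auto simp: field_simps)
  have I: "(?f has_integral (1 / (p * s) - prim \<theta> + integral {\<theta>..1} prof)) {\<theta><..<1}"
    using has_integral_prof_weighted[OF \<theta>] by (simp add: has_integral_Icc_iff_Ioo)
  then have "?f absolutely_integrable_on {\<theta><..<1}"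
    by (intro nonnegative_absolutely_integrable_1) (auto simp: prof_nonneg)
  with I have "?f absolutely_integrable_on (\<lambda>t. t / (1 + t)) ` {\<epsilon><..} \<and>
      integral ((\<lambda>t. t / (1 + t)) ` {\<epsilon><..}) ?f = 1 / (p * s) - prim \<theta> + integral {\<theta>..1} prof"
    unfolding image_subst[OF \<epsilon>] \<theta>_def by (auto simp: integral_unique)
  then have "(\<lambda>t. \<bar>1 / (1 + t)\<^sup>2\<bar> * ?f (t / (1 + t))) absolutely_integrable_on {\<epsilon><..} \<and>
      integral {\<epsilon><..} (\<lambda>t. \<bar>1 / (1 + t)\<^sup>2\<bar> * ?f (t / (1 + t))) = 1 / (p * s) - prim \<theta> + integral {\<theta>..1} prof"
  proof (subst has_absolute_integral_change_of_variables_1'[where f = ?f and g = "\<lambda>t. t / (1 + t)"])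
    show "((\<lambda>t. t / (1 + t)) has_real_derivative 1 / (1 + x)\<^sup>2) (at x within {\<epsilon><..})" if "x \<in> {\<epsilon><..}" for x
      using that \<epsilon> by (auto intro!: derivative_eq_intros simp: power2_eq_square)
    show "inj_on (\<lambda>t. t / (1 + t)) {\<epsilon><..}" using \<epsilon> by (auto intro!: inj_onI simp: field_simps)
  qed auto
  moreover have "\<bar>1 / (1 + t)\<^sup>2\<bar> * ?f (t / (1 + t)) = - flat_diff s (p - 1) t * t powr (- 1 - p * s)" if "t \<in> {\<epsilon><..}" for t
    using flat_diff_substitution[of t] that \<epsilon> by auto
  ultimately show "(\<lambda>t. - flat_diff s (p - 1) t * t powr (- 1 - p * s)) absolutely_integrable_on {\<epsilon><..}"
    and "integral {\<epsilon><..} (\<lambda>t. - flat_diff s (p - 1) t * t powr (- 1 - p * s)) = 1 / (p * s) - prim \<theta> + integral {\<theta>..1} prof"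
    using set_integrable_cong[OF refl refl, of "{\<epsilon><..}" "\<lambda>t. \<bar>1 / (1 + t)\<^sup>2\<bar> * ?f (t / (1 + t))" "\<lambda>t. - flat_diff s (p - 1) t * t powr (- 1 - p * s)" lebesgue]
      Henstock_Kurzweil_Integration.integral_cong[of "{\<epsilon><..}" "\<lambda>t. \<bar>1 / (1 + t)\<^sup>2\<bar> * ?f (t / (1 + t))"]
    by simp_all
qed

text \<open>For \<open>t \<ge> 1\<close> the point \<open>1 - t\<close> has left the half-line and
  the numerator is 1; this accounts for the term \<open>1 / (p * s)\<close>.\<close>

lemma flat_diff_neg_has_integral_tail:
  assumes \<epsilon>: "0 < \<epsilon>" "\<epsilon> \<le> 1"
  shows "((\<lambda>t. flat_diff s (p - 1) (- t) * t powr (- 1 - p * s)) has_integral (integral {\<epsilon>..1} prof + 1 / (p * s))) {\<epsilon><..}"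
proof -
  let ?f = "\<lambda>t. flat_diff s (p - 1) (- t) * t powr (- 1 - p * s)"
  have "(prof has_integral integral {\<epsilon>..1} prof) {\<epsilon>..1}"
    using \<epsilon> by (intro integrable_integral integrable_continuous_real continuous_on_prof)
  then have 1: "(?f has_integral integral {\<epsilon>..1} prof) {\<epsilon>..1}"
    using \<epsilon> s by (elim has_integral_eq[rotated]) (auto simp: prof_def flat_diff_neg)
  have "((\<lambda>t. t powr (- 1 - p * s)) has_integral - (1 powr (- 1 - p * s + 1)) / (- 1 - p * s + 1)) {1..}"
    using ps_pos by (intro has_integral_powr_to_inf) auto
  then have "((\<lambda>t. t powr (- 1 - p * s)) has_integral 1 / (p * s)) {1..}" by simp
  then have 2: "(?f has_integral 1 / (p * s)) {1..}"
    by (rule has_integral_eq[rotated]) (auto simp: flat_diff_neg_far)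
  have "(?f has_integral (integral {\<epsilon>..1} prof + 1 / (p * s))) ({\<epsilon>..1} \<union> {1..})"
  proof (rule has_integral_Un[OF 1 2])
    have "{\<epsilon>..1} \<inter> {1..} = {1}" using \<epsilon> by auto
    then show "negligible ({\<epsilon>..1} \<inter> {1..})" by simp
  qed
  then show ?thesis
    by (rule has_integral_spike_set_eq[THEN iffD1, rotated -1])
      (use \<epsilon> in \<open>auto intro: negligible_subset[of "{\<epsilon>}"]\<close>)
qed

text \<open>The integral of \<open>sym_flat\<close> over \<open>t > \<epsilon>\<close> for
  \<open>\<epsilon> \<le> 1\<close>. The terms \<open>1 / (p * s)\<close> of the two sides have
  cancelled; the two lower limits differ because only one side was substituted.\<close>

definition tail :: "real \<Rightarrow> real" where
  "tail \<epsilon> = prim (\<epsilon> / (1 + \<epsilon>)) + integral {\<epsilon>..1} prof - integral {\<epsilon> / (1 + \<epsilon>)..1} prof"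

lemma sym_flat_has_integral_tail:
  assumes \<epsilon>: "0 < \<epsilon>" "\<epsilon> \<le> 1"
  shows "(sym_flat has_integral tail \<epsilon>) {\<epsilon><..}"
proof -
  have "((\<lambda>t. - flat_diff s (p - 1) t * t powr (- 1 - p * s)) has_integral
     (1 / (p * s) - prim (\<epsilon> / (1 + \<epsilon>)) + integral {\<epsilon> / (1 + \<epsilon>)..1} prof)) {\<epsilon><..}"
    using flat_diff_abs_integrable_tail[OF \<epsilon>(1)] by (metis absolutely_integrable_on_def integrable_integral)
  from has_integral_diff[OF flat_diff_neg_has_integral_tail[OF \<epsilon>] this]
  show ?thesis unfolding tail_def sym_flat_def[abs_def] by (simp add: algebra_simps)
qed

text \<open>Concavity makes the loss towards the boundary at least the gain away from it. The sign
  near 0 is what permits monotone convergence there.\<close>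

lemma sym_flat_nonneg:
  assumes "0 < t" "t \<le> 1"
  shows "0 \<le> sym_flat t"
proof -
  have "(1 + t) powr s \<le> 1 + s * (1 + t - 1)" "(1 - t) powr s \<le> 1 + s * (1 - t - 1)"
    using bernoulli_powr_le[of s "1 + t"] bernoulli_powr_le[of s "1 - t"] assms s by auto
  then have le: "(1 + t) powr s - 1 \<le> 1 - (1 - t) powr s" by (simp add: algebra_simps)
  have "1 \<le> (1 + t) powr s" using assms s by (intro ge_one_powr_ge_zero) auto
  then have "((1 + t) powr s - 1) powr (p - 1) \<le> (1 - (1 - t) powr s) powr (p - 1)"
    using le p by (intro powr_mono2) auto
  then show ?thesis unfolding sym_flat_def using assms s flat_diff_pos[of s t] flat_diff_neg[of s t] by simp
qed

text \<open>The cutoffs \<open>\<epsilon>\<close> and \<open>\<epsilon> / (1 + \<epsilon>)\<close>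
  are at most \<open>\<epsilon>\<close> squared apart, and \<open>prof v\<close> is at most
  \<open>v powr (p - 2 - p * s)\<close>. Hence both remaining terms are of order
  \<open>\<epsilon> powr (p - p * s)\<close>, with positive exponent as
  \<open>s < 1\<close>.\<close>

lemma tail_tendsto_0: "(\<lambda>k. tail (1 / real (Suc k))) \<longlonglongrightarrow> 0"
proof -
  define e where "e = p - 2 - p * s"
  define a where "a = p - p * s"
  have a: "0 < a" unfolding a_def using s p by simp
  have bound: "\<bar>tail \<epsilon>\<bar> \<le> (1 / (p * s) + 1 + (1 / 2) powr e) * \<epsilon> powr a" if \<epsilon>: "0 < \<epsilon>" "\<epsilon> \<le> 1" for \<epsilon>
  proof -
    define \<theta> where "\<theta> = \<epsilon> / (1 + \<epsilon>)"
    have \<theta>: "0 < \<theta>" "\<theta> < 1" "\<theta> \<le> \<epsilon>" "\<epsilon> / 2 \<le> \<theta>" "\<epsilon> - \<theta> \<le> \<epsilon>\<^sup>2"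
      using \<epsilon> unfolding \<theta>_def by (auto simp: field_simps power2_eq_square)
    have prim: "0 \<le> prim \<theta>" "prim \<theta> \<le> 1 / (p * s) * \<epsilon> powr a"
    proof -
      show "0 \<le> prim \<theta>" unfolding prim_def using ps_pos by simp
      have "(1 - (1 - \<theta>) powr s) powr p \<le> \<theta> powr p"
        using one_minus_powr_bounds[of \<theta>] \<theta> p by (intro powr_mono2) auto
      then have "prim \<theta> \<le> \<theta> powr p * \<theta> powr (- (p * s)) / (p * s)"
        unfolding prim_def using ps_pos by (intro divide_right_mono mult_right_mono) auto
      also have "\<theta> powr p * \<theta> powr (- (p * s)) = \<theta> powr a" unfolding a_def by (simp flip: powr_add)
      also have "\<theta> powr a / (p * s) \<le> \<epsilon> powr a / (p * s)"
        using \<theta> a ps_pos by (intro divide_right_mono powr_mono2) auto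
      finally show "prim \<theta> \<le> 1 / (p * s) * \<epsilon> powr a" by simp
    qed
    have split: "integral {\<theta>..1} prof = integral {\<theta>..\<epsilon>} prof + integral {\<epsilon>..1} prof"
      using \<theta> \<epsilon> by (intro Henstock_Kurzweil_Integration.integral_combine[symmetric] integrable_continuous_real continuous_on_prof) auto
    have int: "prof integrable_on {\<theta>..\<epsilon>}"
      using \<theta> \<epsilon> by (intro integrable_continuous_real continuous_on_subset[OF continuous_on_prof[of \<theta>]]) auto
    \<comment> \<open>The sign of \<open>e\<close> depends on \<open>s\<close> and \<open>p\<close>,
      so \<open>M\<close> adds the values of \<open>v powr e\<close> at both ends of the interval
      from \<open>\<epsilon> / 2\<close> to \<open>\<epsilon>\<close>.\<close>
    define M where "M = \<epsilon> powr e + (\<epsilon> / 2) powr e"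
    have "prof v \<le> M" if v: "v \<in> {\<theta>..\<epsilon>}" for v
    proof -
      have v: "0 < v" "v \<le> 1" "v \<le> \<epsilon>" "\<epsilon> / 2 \<le> v" using v \<theta> \<epsilon> by auto
      have "(1 - (1 - v) powr s) powr (p - 1) \<le> v powr (p - 1)"
        using one_minus_powr_bounds[of v] v p by (intro powr_mono2) auto
      then have "prof v \<le> v powr (p - 1) * v powr (- 1 - p * s)"
        unfolding prof_def by (intro mult_right_mono) auto
      also have "\<dots> = v powr e" unfolding e_def powr_add[symmetric] by (simp add: algebra_simps)
      also have "\<dots> \<le> M"
      proof (cases "0 \<le> e")
        case True
        then have "v powr e \<le> \<epsilon> powr e" using v by (intro powr_mono2) auto
        then show ?thesis unfolding M_def using powr_ge_zero[of "\<epsilon> / 2" e] by linarith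
      next
        case False
        then have "v powr e \<le> (\<epsilon> / 2) powr e" using v \<epsilon> by (intro powr_mono2') auto
        then show ?thesis unfolding M_def using powr_ge_zero[of \<epsilon> e] by linarith
      qed
      finally show ?thesis .
    qed
    then have "integral {\<theta>..\<epsilon>} prof \<le> integral {\<theta>..\<epsilon>} (\<lambda>_. M)"
      by (intro integral_le int) auto
    also have "\<dots> = (\<epsilon> - \<theta>) * M" using \<theta> by simp
    also have "\<dots> \<le> \<epsilon>\<^sup>2 * M" using \<theta> unfolding M_def by (intro mult_right_mono) auto
    also have "\<epsilon>\<^sup>2 * M = (1 + (1 / 2) powr e) * (\<epsilon> powr 2 * \<epsilon> powr e)"
      unfolding M_def using \<epsilon> powr_mult[of "\<epsilon>" "1 / 2" e] by (simp add: powr_numeral algebra_simps)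
    also have "\<epsilon> powr 2 * \<epsilon> powr e = \<epsilon> powr a" unfolding e_def a_def powr_add[symmetric] by simp
    finally have i: "integral {\<theta>..\<epsilon>} prof \<le> (1 + (1 / 2) powr e) * \<epsilon> powr a" .
    have "0 \<le> integral {\<theta>..\<epsilon>} prof" by (intro integral_nonneg int) (auto simp: prof_nonneg)
    moreover have "tail \<epsilon> = prim \<theta> - integral {\<theta>..\<epsilon>} prof"
      unfolding tail_def \<theta>_def[symmetric] split by simp
    ultimately show ?thesis using prim i by (simp add: algebra_simps abs_le_iff)
  qed
  have "(\<lambda>k. (1 / real (Suc k)) powr a) \<longlonglongrightarrow> 0"
  proof -
    have "(\<lambda>k. (1 / real (Suc k)) powr a) \<longlonglongrightarrow> 0 powr a"
      using a by (intro tendsto_powr' LIMSEQ_Suc[OF lim_1_over_n] tendsto_const) auto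
    then show ?thesis by simp
  qed
  then have "(\<lambda>k. (1 / (p * s) + 1 + (1 / 2) powr e) * (1 / real (Suc k)) powr a) \<longlonglongrightarrow> 0"
    by (rule tendsto_mult_right_zero)
  then show ?thesis
    by (rule Lim_null_comparison[rotated]) (auto intro!: always_eventually bound[THEN order_trans])
qed

text \<open>On \<open>{0<..1}\<close> the integrand is nonnegative, so convergence of the truncated
  integrals already gives absolute integrability; on \<open>{1<..}\<close> each side is absolutely
  integrable by itself. The paired principal value is thus a Lebesgue integral, and its value is the
  limit of \<open>tail\<close>.\<close>

theorem sym_flat_integral:
  "integrable lborel (\<lambda>t. sym_flat t * indicator {0<..} t)"
  "(LBINT t. sym_flat t * indicator {0<..} t) = 0"
proof -
  let ?f = "\<lambda>k t. if 1 / real (Suc k) < t then sym_flat t else 0"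
  have A: "(sym_flat has_integral (tail (1 / real (Suc k)) - tail 1)) {1 / real (Suc k)<..1}" for k
  proof -
    have "(sym_flat has_integral (tail (1 / real (Suc k)) - tail 1)) ({1 / real (Suc k)<..} - {1<..})"
      by (intro has_integral_setdiff sym_flat_has_integral_tail negligible_subset[OF negligible_empty]) auto
    moreover have "{1 / real (Suc k)<..} - {1<..} = {1 / real (Suc k)<..1}" by auto
    ultimately show ?thesis by simp
  qed
  have Ak: "(?f k has_integral (tail (1 / real (Suc k)) - tail 1)) {0<..1}" for k
  proof -
    have "0 < 1 / real (Suc k)" by simp
    then have "{1 / real (Suc k)<..1} \<subseteq> {0<..1}"
      by (meson greaterThanAtMost_iff subsetI order_less_trans)
    then have "((\<lambda>t. if t \<in> {1 / real (Suc k)<..1} then sym_flat t else 0) has_integral (tail (1 / real (Suc k)) - tail 1)) {0<..1}"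
      using A by (subst has_integral_restrict)
    then show ?thesis by (rule has_integral_eq[rotated]) auto
  qed
  have lim: "(\<lambda>k. tail (1 / real (Suc k)) - tail 1) \<longlonglongrightarrow> 0 - tail 1"
    by (intro tendsto_diff tail_tendsto_0 tendsto_const)
  have mc: "sym_flat integrable_on {0<..1} \<and> (\<lambda>k. integral {0<..1} (?f k)) \<longlonglongrightarrow> integral {0<..1} sym_flat"
  proof (rule monotone_convergence_increasing)
    show "?f k integrable_on {0<..1}" for k using Ak by blast
    show "?f k x \<le> ?f (Suc k) x" if "x \<in> {0<..1}" for k x
    proof -
      have "1 / real (Suc (Suc k)) \<le> 1 / real (Suc k)" by (intro divide_left_mono) auto
      then show ?thesis using sym_flat_nonneg[of x] that by auto
    qed
    show "(\<lambda>k. ?f k x) \<longlonglongrightarrow> sym_flat x" if "x \<in> {0<..1}" for x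
    proof (rule tendsto_eventually)
      have "\<forall>\<^sub>F k in sequentially. 1 / real (Suc k) < x"
        using LIMSEQ_Suc[OF lim_1_over_n] that by (intro order_tendstoD(2)) auto
      then show "\<forall>\<^sub>F k in sequentially. ?f k x = sym_flat x" by (elim eventually_mono) auto
    qed
    have "(\<lambda>k. integral {0<..1} (?f k)) = (\<lambda>k. tail (1 / real (Suc k)) - tail 1)"
      using Ak by (intro ext integral_unique)
    then show "bounded (range (\<lambda>k. integral {0<..1} (?f k)))"
      using lim by (simp add: convergent_imp_bounded)
  qed
  have "(\<lambda>k. integral {0<..1} (?f k)) = (\<lambda>k. tail (1 / real (Suc k)) - tail 1)"
    using Ak by (intro ext integral_unique)
  then have "integral {0<..1} sym_flat = - tail 1" using mc lim LIMSEQ_unique by fastforce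
  then have I1: "(sym_flat has_integral (- tail 1)) {0<..1}" using mc by (metis integrable_integral)
  have I2: "(sym_flat has_integral tail 1) {1<..}" by (rule sym_flat_has_integral_tail) auto
  have un: "{0<..1} \<union> {1<..} = {0::real<..}" by auto
  have "(sym_flat has_integral (- tail 1 + tail 1)) ({0<..1} \<union> {1<..})"
    by (rule has_integral_Un[OF I1 I2], rule negligible_subset[OF negligible_empty]) auto
  then have I: "(sym_flat has_integral 0) {0<..}" unfolding un by simp
  have "sym_flat absolutely_integrable_on {0<..1}"
    using I1 sym_flat_nonneg by (intro nonnegative_absolutely_integrable_1) auto
  moreover have "sym_flat absolutely_integrable_on {1<..}"
  proof -
    let ?g = "\<lambda>t. flat_diff s (p - 1) (- t) * t powr (- 1 - p * s)"
    have "?g absolutely_integrable_on {1<..}"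
      using flat_diff_neg_has_integral_tail[of 1] by (intro nonnegative_absolutely_integrable_1) (auto simp: flat_diff_neg_far)
    from set_integral_diff(1)[OF this flat_diff_abs_integrable_tail(1)[OF zero_less_one]]
    show ?thesis unfolding sym_flat_def[abs_def] by (simp add: algebra_simps)
  qed
  ultimately have abs: "sym_flat absolutely_integrable_on {0<..}"
    unfolding un[symmetric] by (intro set_integrable_Un) auto
  have m: "(\<lambda>t. sym_flat t * indicator {0<..} t) \<in> borel_measurable lborel"
    unfolding sym_flat_def by measurable
  have intl: "integrable lebesgue (\<lambda>t. sym_flat t * indicator {0<..} t)"
    using abs unfolding set_integrable_def by (simp add: mult.commute)
  then show int: "integrable lborel (\<lambda>t. sym_flat t * indicator {0<..} t)"
    using integrable_completion[OF m] by simp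
  have "(LBINT t. sym_flat t * indicator {0<..} t) = integral\<^sup>L lebesgue (\<lambda>t. sym_flat t * indicator {0<..} t)"
    using integral_completion[OF m] by simp
  also have "\<dots> = integral {0<..} sym_flat"
    using set_lebesgue_integral_eq_integral(2)[OF abs] unfolding set_lebesgue_integral_def by (simp add: mult.commute)
  also have "\<dots> = 0" using I by (rule integral_unique)
  finally show "(LBINT t. sym_flat t * indicator {0<..} t) = 0" .
qed

end

section \<open>The half-space\<close>

lemma lborel_distr_uminus_euclidean: "distr lborel borel uminus = (lborel :: 'a::euclidean_space measure)"
proof -
  have "lborel = density (distr lborel borel (\<lambda>x::'a. 0 + (- 1) *\<^sub>R x)) (\<lambda>_. \<bar>- 1 :: real\<bar> ^ DIM('a))"
    by (rule lborel_affine) simp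
  moreover have "(\<lambda>x::'a. 0 + (- 1) *\<^sub>R x) = uminus" by (simp add: fun_eq_iff)
  ultimately show ?thesis by (simp add: density_1)
qed

lemma integrable_lborel_uminus:
  fixes f :: "'a::euclidean_space \<Rightarrow> real"
  assumes "integrable lborel f"
  shows "integrable lborel (\<lambda>x. f (- x))"
proof -
  have [measurable]: "f \<in> borel_measurable borel" using assms by (simp add: integrable_iff_bounded)
  have "integrable (distr lborel borel uminus) f" using assms unfolding lborel_distr_uminus_euclidean .
  then show ?thesis by (simp add: integrable_distr_eq)
qed

lemma integral_lborel_uminus:
  fixes f :: "'a::euclidean_space \<Rightarrow> real"
  assumes [measurable]: "f \<in> borel_measurable borel"
  shows "(\<integral>x. f (- x) \<partial>lborel) = (\<integral>x. f x \<partial>lborel)"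
  by (subst (2) lborel_distr_uminus_euclidean[symmetric]) (simp add: integral_distr)

lemma integrableI_kernel_bound:
  fixes f :: "'a::euclidean_space \<Rightarrow> real"
  assumes [measurable]: "f \<in> borel_measurable borel"
    and a: "0 < a" and r: "0 < r"
    and bound: "\<And>z. r \<le> norm z \<Longrightarrow> \<bar>f z\<bar> \<le> B * kern a z"
    and zero: "\<And>z. norm z < r \<Longrightarrow> f z = 0" and B: "0 \<le> B"
  shows "integrable lborel f"
proof -
  obtain C where C: "0 \<le> C" "\<forall>r>0. (\<integral>\<^sup>+z. ennreal (kern a z) * indicator {z. r \<le> norm z} (z::'a) \<partial>lborel) \<le> ennreal (C * r powr (- a))"
    by (rule nn_integral_norm_powr_outside[where 'a='a, OF a])
  have "(\<integral>\<^sup>+z. ennreal (norm (f z)) \<partial>lborel) \<le> (\<integral>\<^sup>+z. ennreal B * (ennreal (kern a z) * indicator {z. r \<le> norm z} (z::'a)) \<partial>lborel)"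
  proof (intro nn_integral_mono)
    fix z :: 'a
    show "ennreal (norm (f z)) \<le> ennreal B * (ennreal (kern a z) * indicator {z. r \<le> norm z} z)"
    proof (cases "r \<le> norm z")
      case True
      then have "ennreal (norm (f z)) \<le> ennreal (B * kern a z)"
        using bound[of z] by (intro ennreal_leI) simp
      then show ?thesis using True B by (simp add: ennreal_mult)
    qed (simp add: zero)
  qed
  also have "\<dots> = ennreal B * (\<integral>\<^sup>+z. (ennreal (kern a z) * indicator {z. r \<le> norm z} (z::'a)) \<partial>lborel)"
    by (rule nn_integral_cmult) measurable
  also have "\<dots> \<le> ennreal B * ennreal (C * r powr (- a))" using C(2) r by (intro mult_left_mono) auto
  also have "\<dots> < \<infinity>" by (simp add: ennreal_mult_less_top)
  finally show ?thesis by (simp add: integrable_iff_bounded)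
qed

definition flat_scaled :: "real \<Rightarrow> real \<Rightarrow> real \<Rightarrow> real \<Rightarrow> real" where
  "flat_scaled s q d t = spow (d powr s - max 0 (d + t) powr s) q"

lemma flat_scaled_measurable [measurable]: "flat_scaled s q d \<in> borel_measurable borel"
  unfolding flat_scaled_def[abs_def] by measurable

lemma flat_scaled_0 [simp]: "0 < d \<Longrightarrow> flat_scaled s q d 0 = 0"
  by (simp add: flat_scaled_def)

lemma flat_scaled_eq:
  assumes "0 < d"
  shows "flat_scaled s q d t = d powr (s * q) * flat_diff s q (t / d)"
proof -
  have "max 0 (d + t) = d * max 0 (1 + t / d)" using assms by (simp add: max_def field_simps)
  then have "d powr s - max 0 (d + t) powr s = d powr s * (1 - max 0 (1 + t / d) powr s)"
    using assms by (simp add: powr_mult algebra_simps)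
  then show ?thesis unfolding flat_scaled_def flat_diff_def using assms
    by (simp add: spow_mult powr_powr)
qed

lemma flat_scaled_bound:
  assumes "0 \<le> s" "s \<le> 1" "0 < d" "0 \<le> q"
  shows "\<bar>flat_scaled s q d t\<bar> \<le> \<bar>t\<bar> powr (s * q)"
proof -
  have "\<bar>d powr s - max 0 (d + t) powr s\<bar> \<le> \<bar>d - max 0 (d + t)\<bar> powr s"
    using assms by (intro abs_powr_diff_le_holder) auto
  also have "\<dots> \<le> \<bar>t\<bar> powr s" using assms by (intro powr_mono2) auto
  finally have "\<bar>d powr s - max 0 (d + t) powr s\<bar> powr q \<le> (\<bar>t\<bar> powr s) powr q"
    using assms by (intro powr_mono2) auto
  then show ?thesis unfolding flat_scaled_def abs_spow by (simp add: powr_powr)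
qed

context exponents
begin

lemma sym_flat_scaled:
  assumes d: "0 < d"
  shows "(flat_scaled s (p - 1) d t + flat_scaled s (p - 1) d (- t)) * (t powr (- 1 - p * s) * indicator {0<..} t)
     = d powr (- s - 1) * (sym_flat (t / d) * indicator {0<..} (t / d))"
proof (cases "0 < t")
  case True
  have e1: "t powr (- 1 - p * s) = (t / d) powr (- 1 - p * s) * d powr (- 1 - p * s)"
    using True d by (simp add: powr_divide)
  have e2: "d powr (s * (p - 1)) * d powr (- 1 - p * s) = d powr (- s - 1)"
    unfolding powr_add[symmetric] by (rule arg_cong[of _ _ "\<lambda>x. d powr x"]) (simp add: algebra_simps)
  have "(flat_scaled s (p - 1) d t + flat_scaled s (p - 1) d (- t)) * t powr (- 1 - p * s)
     = (d powr (s * (p - 1)) * d powr (- 1 - p * s)) * sym_flat (t / d)"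
    unfolding sym_flat_def flat_scaled_eq[OF d] e1 by (simp only: distrib_left distrib_right minus_divide_left mult_ac)
  then have "(flat_scaled s (p - 1) d t + flat_scaled s (p - 1) d (- t)) * t powr (- 1 - p * s)
     = d powr (- s - 1) * sym_flat (t / d)" unfolding e2 .
  then show ?thesis using True d by simp
qed (use d in \<open>simp add: zero_less_divide_iff\<close>)

text \<open>Homogeneity gives the factor \<open>d powr (- s - 1)\<close>, and the substitution
  \<open>t / d\<close> contributes another \<open>d\<close>.\<close>

lemma sym_flat_scaled_integral:
  assumes d: "0 < d"
  defines "h \<equiv> \<lambda>t. (flat_scaled s (p - 1) d t + flat_scaled s (p - 1) d (- t)) * (t powr (- 1 - p * s) * indicator {0<..} t)"
  shows "integrable lborel h" "(\<integral>t. h t \<partial>lborel) = 0"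
    "(\<integral>t. \<bar>h t\<bar> \<partial>lborel) = d powr (- s) * (\<integral>t. \<bar>sym_flat t * indicator {0<..} t\<bar> \<partial>lborel)"
proof -
  let ?g = "\<lambda>t. sym_flat t * indicator {0<..} t"
  have h: "h t = d powr (- s - 1) * ?g (0 + (1 / d) * t)" for t
    unfolding h_def using sym_flat_scaled[OF d, of t] by simp
  have i: "integrable lborel (\<lambda>t. ?g (0 + (1 / d) * t))"
    by (rule lborel_integrable_real_affine[OF sym_flat_integral(1)]) (use d in simp)
  show "integrable lborel h" unfolding h[abs_def] by (rule integrable_mult_right[OF i])
  have "(\<integral>t. ?g t \<partial>lborel) = \<bar>1 / d\<bar> *\<^sub>R (\<integral>t. ?g (0 + (1 / d) * t) \<partial>lborel)"
    by (rule lborel_integral_real_affine) (use d in simp)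
  then have "(\<integral>t. ?g (0 + (1 / d) * t) \<partial>lborel) = 0" using sym_flat_integral(2) d by simp
  then show "(\<integral>t. h t \<partial>lborel) = 0" unfolding h by simp
  have "(\<integral>t. \<bar>?g t\<bar> \<partial>lborel) = \<bar>1 / d\<bar> *\<^sub>R (\<integral>t. \<bar>?g (0 + (1 / d) * t)\<bar> \<partial>lborel)"
    by (rule lborel_integral_real_affine) (use d in simp)
  then have "(\<integral>t. \<bar>?g (0 + (1 / d) * t)\<bar> \<partial>lborel) = d * (\<integral>t. \<bar>?g t\<bar> \<partial>lborel)"
    using d by simp
  moreover have "d powr (- s - 1) * d = d powr (- s)" using d by (simp add: powr_diff)
  moreover have "\<bar>h t\<bar> = d powr (- s - 1) * \<bar>?g (0 + (1 / d) * t)\<bar>" for t unfolding h by (simp add: abs_mult)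
  ultimately show "(\<integral>t. \<bar>h t\<bar> \<partial>lborel) = d powr (- s) * (\<integral>t. \<bar>?g t\<bar> \<partial>lborel)"
    by (simp only: integral_mult_right_zero mult.assoc[symmetric])
qed

text \<open>On the half-space \<open>0 < z \<bullet> \<nu>\<close> the paired integrand is a
  function of \<open>z \<bullet> \<nu>\<close> times the kernel, so pushing forward along
  \<open>\<nu>\<close> leaves the half-line integral. The bound by \<open>kernel_const\<close> makes
  the third estimate independent of \<open>\<nu>\<close>.\<close>

lemma half_space_integral:
  fixes \<nu> :: "'a::euclidean_space"
  assumes d: "0 < d" and \<nu>: "norm \<nu> = 1"
  defines "F \<equiv> \<lambda>z. (flat_scaled s (p - 1) d (z \<bullet> \<nu>) + flat_scaled s (p - 1) d (- (z \<bullet> \<nu>))) * (kern (p * s) z * indicator {z. 0 < z \<bullet> \<nu>} z)"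
  shows "integrable lborel F" "(\<integral>z. F z \<partial>lborel) = 0"
    "(\<integral>z. \<bar>F z\<bar> \<partial>lborel) \<le> kernel_const TYPE('a) (p * s) * (\<integral>t. \<bar>sym_flat t * indicator {0<..} t\<bar> \<partial>lborel) * d powr (- s)"
proof -
  let ?w = "\<lambda>z::'a. kern (p * s) z * indicator {z. 0 < z \<bullet> \<nu>} z"
  have inl: "z \<bullet> \<nu> \<le> norm z" for z using Cauchy_Schwarz_ineq2[of z \<nu>] \<nu> by simp
  obtain C where C: "0 \<le> C" "C \<le> kernel_const TYPE('a) (p * s)"
      "distr (density lborel (\<lambda>z. ennreal (kern (p * s) z) * indicator {z. 0 < z \<bullet> \<nu>} z)) borel (\<lambda>z. z \<bullet> \<nu>)
        = density lborel (\<lambda>t. ennreal (C * t powr (- 1 - p * s)) * indicator {0<..} t)"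
    by (rule homogeneous_pushforward[of "\<lambda>z. z \<bullet> \<nu>", OF _ _ _ ps_pos]) (use inl in auto)
  have d1: "(\<lambda>z. ennreal (kern (p * s) z) * indicator {z. 0 < z \<bullet> \<nu>} z) = (\<lambda>z. ennreal (?w z))"
    by (auto simp: indicator_def)
  have d2: "(\<lambda>t. ennreal (C * t powr (- 1 - p * s)) * indicator {0<..} t) = (\<lambda>t. ennreal (C * t powr (- 1 - p * s) * indicator {0<..} t))"
    by (auto simp: indicator_def)
  have push: "distr (density lborel (\<lambda>z. ennreal (?w z))) borel (\<lambda>z. z \<bullet> \<nu>) = density lborel (\<lambda>t. ennreal (C * t powr (- 1 - p * s) * indicator {0<..} t))"
    using C(3) unfolding d1 d2 .
  have trI: "integrable lborel (\<lambda>z. ?w z * g (z \<bullet> \<nu>)) \<longleftrightarrow> integrable lborel (\<lambda>t. C * t powr (- 1 - p * s) * indicator {0<..} t * g t)"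
    and trE: "(\<integral>z. ?w z * g (z \<bullet> \<nu>) \<partial>lborel) = (\<integral>t. C * t powr (- 1 - p * s) * indicator {0<..} t * g t \<partial>lborel)"
    if [measurable]: "g \<in> borel_measurable borel" for g :: "real \<Rightarrow> real"
  proof -
    have "integrable lborel (\<lambda>z. ?w z * g (z \<bullet> \<nu>)) \<longleftrightarrow> integrable (density lborel (\<lambda>z. ennreal (?w z))) (\<lambda>z. g (z \<bullet> \<nu>))"
      by (subst integrable_density) auto
    also have "\<dots> \<longleftrightarrow> integrable (distr (density lborel (\<lambda>z. ennreal (?w z))) borel (\<lambda>z. z \<bullet> \<nu>)) g"
      by (subst integrable_distr_eq) auto
    also have "\<dots> \<longleftrightarrow> integrable lborel (\<lambda>t. C * t powr (- 1 - p * s) * indicator {0<..} t * g t)"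
      unfolding push using C(1) by (subst integrable_density) auto
    finally show "integrable lborel (\<lambda>z. ?w z * g (z \<bullet> \<nu>)) \<longleftrightarrow> integrable lborel (\<lambda>t. C * t powr (- 1 - p * s) * indicator {0<..} t * g t)" .
    have "(\<integral>z. ?w z * g (z \<bullet> \<nu>) \<partial>lborel) = (\<integral>z. g (z \<bullet> \<nu>) \<partial>density lborel (\<lambda>z. ennreal (?w z)))"
      by (subst integral_density) auto
    also have "\<dots> = (\<integral>t. g t \<partial>distr (density lborel (\<lambda>z. ennreal (?w z))) borel (\<lambda>z. z \<bullet> \<nu>))"
      by (subst integral_distr) auto
    also have "\<dots> = (\<integral>t. C * t powr (- 1 - p * s) * indicator {0<..} t * g t \<partial>lborel)"
      unfolding push using C(1) by (subst integral_density) auto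
    finally show "(\<integral>z. ?w z * g (z \<bullet> \<nu>) \<partial>lborel) = (\<integral>t. C * t powr (- 1 - p * s) * indicator {0<..} t * g t \<partial>lborel)" .
  qed
  define H where "H t = flat_scaled s (p - 1) d t + flat_scaled s (p - 1) d (- t)" for t
  have [measurable]: "H \<in> borel_measurable borel" unfolding H_def[abs_def] by measurable
  have F: "F z = ?w z * H (z \<bullet> \<nu>)" for z unfolding F_def H_def by simp
  have aF: "\<bar>F z\<bar> = ?w z * \<bar>H (z \<bullet> \<nu>)\<bar>" for z unfolding F by (simp add: abs_mult)
  note sf = sym_flat_scaled_integral[OF d, folded H_def]
  have e1: "C * t powr (- 1 - p * s) * indicator {0<..} t * H t = C * (H t * (t powr (- 1 - p * s) * indicator {0<..} t))" for t
    by (simp only: mult_ac)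
  have e2: "C * t powr (- 1 - p * s) * indicator {0<..} t * \<bar>H t\<bar> = C * \<bar>H t * (t powr (- 1 - p * s) * indicator {0<..} t)\<bar>" for t
    by (simp add: abs_mult mult_ac)
  show "integrable lborel F" unfolding F[abs_def] using trI[of H] sf(1) unfolding e1 by simp
  show "(\<integral>z. F z \<partial>lborel) = 0" unfolding F using trE[of H] sf(2) unfolding e1 by simp
  have "(\<integral>z. \<bar>F z\<bar> \<partial>lborel) = C * (d powr (- s) * (\<integral>t. \<bar>sym_flat t * indicator {0<..} t\<bar> \<partial>lborel))"
    unfolding aF using trE[of "\<lambda>t. \<bar>H t\<bar>"] sf(3) unfolding e2 by simp
  also have "\<dots> \<le> kernel_const TYPE('a) (p * s) * (d powr (- s) * (\<integral>t. \<bar>sym_flat t * indicator {0<..} t\<bar> \<partial>lborel))"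
    using C by (intro mult_right_mono mult_nonneg_nonneg integral_nonneg) auto
  finally show "(\<integral>z. \<bar>F z\<bar> \<partial>lborel) \<le> kernel_const TYPE('a) (p * s) * (\<integral>t. \<bar>sym_flat t * indicator {0<..} t\<bar> \<partial>lborel) * d powr (- s)"
    by (simp only: mult_ac)
qed

text \<open>The numerator grows at most like \<open>norm z powr (s * (p - 1))\<close>, so the
  product decays like \<open>kern s z\<close>, integrable away from the origin.\<close>

lemma flat_truncated_integrable:
  fixes \<nu> :: "'a::euclidean_space"
  assumes d: "0 < d" and \<nu>: "norm \<nu> = 1" and \<epsilon>: "0 < \<epsilon>"
  shows "integrable lborel (\<lambda>z. indicator {z. \<epsilon> < norm z} z * (flat_scaled s (p - 1) d (z \<bullet> \<nu>) * kern (p * s) z))"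
proof (rule integrableI_kernel_bound[where B = 1 and a = s and r = \<epsilon>])
  fix z :: 'a assume z: "\<epsilon> \<le> norm z"
  have inl: "\<bar>z \<bullet> \<nu>\<bar> \<le> norm z" for z using Cauchy_Schwarz_ineq2[of z \<nu>] \<nu> by simp
  have "\<bar>flat_scaled s (p - 1) d (z \<bullet> \<nu>)\<bar> \<le> \<bar>z \<bullet> \<nu>\<bar> powr (s * (p - 1))"
    using s p d by (intro flat_scaled_bound) auto
  also have "\<dots> \<le> norm z powr (s * (p - 1))" using inl[of z] s p by (intro powr_mono2) auto
  finally have "\<bar>flat_scaled s (p - 1) d (z \<bullet> \<nu>)\<bar> * kern (p * s) z \<le> norm z powr (s * (p - 1)) * kern (p * s) z"
    by (intro mult_right_mono) auto
  also have "\<dots> = kern s z" unfolding powr_add[symmetric] by (simp add: algebra_simps)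
  finally show "\<bar>indicator {z. \<epsilon> < norm z} z * (flat_scaled s (p - 1) d (z \<bullet> \<nu>) * kern (p * s) z)\<bar> \<le> 1 * kern s z"
    by (auto simp: indicator_def abs_mult)
qed (use s \<epsilon> in auto)

text \<open>The cutoff is invariant under \<open>z\<close> to \<open>- z\<close>, so the part with
  \<open>z \<bullet> \<nu> < 0\<close> reflects onto the other one. Pairing is done after
  truncation, when each part is integrable on its own.\<close>

lemma flat_truncated_integral_eq:
  fixes \<nu> :: "'a::euclidean_space"
  assumes d: "0 < d" and \<nu>: "norm \<nu> = 1" and \<epsilon>: "0 < \<epsilon>"
  shows "(\<integral>z. indicator {z. \<epsilon> < norm z} z * (flat_scaled s (p - 1) d (z \<bullet> \<nu>) * kern (p * s) z) \<partial>lborel)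
   = (\<integral>z. indicator {z. \<epsilon> < norm z} z * ((flat_scaled s (p - 1) d (z \<bullet> \<nu>) + flat_scaled s (p - 1) d (- (z \<bullet> \<nu>))) * (kern (p * s) z * indicator {z. 0 < z \<bullet> \<nu>} z)) \<partial>lborel)"
proof -
  let ?T = "\<lambda>z. indicator {z. \<epsilon> < norm z} z * (flat_scaled s (p - 1) d (z \<bullet> \<nu>) * kern (p * s) z)"
  let ?X = "\<lambda>z. ?T z * indicator {z. 0 < z \<bullet> \<nu>} z"
  let ?Y = "\<lambda>z. ?T z * indicator {z. z \<bullet> \<nu> < 0} z"
  note iT = flat_truncated_integrable[OF assms]
  have iX: "integrable lborel ?X" by (rule integrable_real_mult_indicator[OF _ iT]) simp
  have iY: "integrable lborel ?Y" by (rule integrable_real_mult_indicator[OF _ iT]) simp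
  have "(\<integral>z. ?T z \<partial>lborel) = (\<integral>z. ?X z + ?Y z \<partial>lborel)"
  proof (rule Bochner_Integration.integral_cong[OF refl])
    fix z
    show "?T z = ?X z + ?Y z" using d by (cases "z \<bullet> \<nu> = 0") (auto simp: indicator_def)
  qed
  also have "\<dots> = (\<integral>z. ?X z \<partial>lborel) + (\<integral>z. ?Y z \<partial>lborel)" by (rule Bochner_Integration.integral_add[OF iX iY])
  also have "(\<integral>z. ?Y z \<partial>lborel) = (\<integral>z. ?Y (- z) \<partial>lborel)" by (rule integral_lborel_uminus[symmetric]) measurable
  also have "(\<integral>z. ?X z \<partial>lborel) + (\<integral>z. ?Y (- z) \<partial>lborel) = (\<integral>z. ?X z + ?Y (- z) \<partial>lborel)"
    by (rule Bochner_Integration.integral_add[OF iX integrable_lborel_uminus[OF iY], symmetric])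
  also have "\<dots> = (\<integral>z. indicator {z. \<epsilon> < norm z} z * ((flat_scaled s (p - 1) d (z \<bullet> \<nu>) + flat_scaled s (p - 1) d (- (z \<bullet> \<nu>))) * (kern (p * s) z * indicator {z. 0 < z \<bullet> \<nu>} z)) \<partial>lborel)"
    by (rule Bochner_Integration.integral_cong[OF refl]) (auto simp: indicator_def algebra_simps)
  finally show ?thesis .
qed

text \<open>After pairing, truncation merely restricts an absolutely integrable function, so its
  full norm bounds the integral for every cutoff.\<close>

lemma flat_truncated_bound:
  obtains C where "0 \<le> C"
    "\<forall>(\<nu>::'a::euclidean_space) d \<epsilon>. norm \<nu> = 1 \<longrightarrow> 0 < d \<longrightarrow> 0 < \<epsilon> \<longrightarrow>
      \<bar>\<integral>z. indicator {z. \<epsilon> < norm z} z * (flat_scaled s (p - 1) d (z \<bullet> \<nu>) * kern (p * s) z) \<partial>lborel\<bar> \<le> C * d powr (- s)"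
proof (rule that[of "kernel_const TYPE('a) (p * s) * (\<integral>t. \<bar>sym_flat t * indicator {0<..} t\<bar> \<partial>lborel)"])
  show "0 \<le> kernel_const TYPE('a) (p * s) * (\<integral>t. \<bar>sym_flat t * indicator {0<..} t\<bar> \<partial>lborel)"
    unfolding kernel_const_def using s p by (intro mult_nonneg_nonneg integral_nonneg) auto
  show "\<forall>(\<nu>::'a) d \<epsilon>. norm \<nu> = 1 \<longrightarrow> 0 < d \<longrightarrow> 0 < \<epsilon> \<longrightarrow>
      \<bar>\<integral>z. indicator {z. \<epsilon> < norm z} z * (flat_scaled s (p - 1) d (z \<bullet> \<nu>) * kern (p * s) z) \<partial>lborel\<bar>
      \<le> kernel_const TYPE('a) (p * s) * (\<integral>t. \<bar>sym_flat t * indicator {0<..} t\<bar> \<partial>lborel) * d powr (- s)"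
  proof (intro allI impI)
    fix \<nu> :: 'a and d \<epsilon> :: real assume a: "norm \<nu> = 1" "0 < d" "0 < \<epsilon>"
    note hs = half_space_integral[OF a(2,1)]
    let ?F = "\<lambda>z. (flat_scaled s (p - 1) d (z \<bullet> \<nu>) + flat_scaled s (p - 1) d (- (z \<bullet> \<nu>))) * (kern (p * s) z * indicator {z. 0 < z \<bullet> \<nu>} z)"
    have "\<bar>\<integral>z. indicator {z. \<epsilon> < norm z} z * ?F z \<partial>lborel\<bar> \<le> (\<integral>z. \<bar>indicator {z. \<epsilon> < norm z} z * ?F z\<bar> \<partial>lborel)"
      by (rule integral_abs_bound)
    also have "\<dots> \<le> (\<integral>z. \<bar>?F z\<bar> \<partial>lborel)"
      by (rule integral_mono') (use hs(1) in \<open>auto simp: indicator_def intro: integrable_abs\<close>)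
    also note hs(3)
    finally show "\<bar>\<integral>z. indicator {z. \<epsilon> < norm z} z * (flat_scaled s (p - 1) d (z \<bullet> \<nu>) * kern (p * s) z) \<partial>lborel\<bar>
      \<le> kernel_const TYPE('a) (p * s) * (\<integral>t. \<bar>sym_flat t * indicator {0<..} t\<bar> \<partial>lborel) * d powr (- s)"
      unfolding flat_truncated_integral_eq[OF a(2,1,3)] .
  qed
qed

lemma indicator_outside_tendsto_1:
  fixes z :: "'a::euclidean_space"
  assumes "z \<noteq> 0"
  shows "(\<lambda>k. indicator {z. 1 / real (Suc k) < norm z} z) \<longlonglongrightarrow> (1::real)"
proof (rule tendsto_eventually)
  have "\<forall>\<^sub>F k in sequentially. 1 / real (Suc k) < norm z"
    using LIMSEQ_Suc[OF lim_1_over_n] assms by (intro order_tendstoD(2)) auto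
  then show "\<forall>\<^sub>F k in sequentially. indicator {z. 1 / real (Suc k) < norm z} z = (1::real)"
    by (elim eventually_mono) simp
qed

lemma truncated_integral_tendsto:
  fixes F :: "'a::euclidean_space \<Rightarrow> real"
  assumes F: "integrable lborel F"
  shows "(\<lambda>k. \<integral>z. indicator {z. 1 / real (Suc k) < norm z} z * F z \<partial>lborel) \<longlonglongrightarrow> (\<integral>z. F z \<partial>lborel)"
proof (rule integral_dominated_convergence[where w = "\<lambda>z. \<bar>F z\<bar>"])
  have [measurable]: "F \<in> borel_measurable borel" using F by (simp add: integrable_iff_bounded)
  show "F \<in> borel_measurable lborel" by simp
  show "(\<lambda>z. indicator {z. 1 / real (Suc k) < norm z} z * F z) \<in> borel_measurable lborel" for k by measurable
  show "AE z in lborel. (\<lambda>k. indicator {z. 1 / real (Suc k) < norm z} z * F z) \<longlonglongrightarrow> F z"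
    using AE_lborel_singleton[of "0::'a"]
  proof eventually_elim
    fix z :: 'a assume "z \<noteq> 0"
    from tendsto_mult[OF indicator_outside_tendsto_1[OF this] tendsto_const[of "F z"]]
    show "(\<lambda>k. indicator {z. 1 / real (Suc k) < norm z} z * F z) \<longlonglongrightarrow> F z" by simp
  qed
qed (use F in \<open>auto simp: indicator_def\<close>)

lemma flat_truncated_tendsto_0:
  fixes \<nu> :: "'a::euclidean_space"
  assumes d: "0 < d" and \<nu>: "norm \<nu> = 1"
  shows "(\<lambda>k. \<integral>z. indicator {z. 1 / real (Suc k) < norm z} z * (flat_scaled s (p - 1) d (z \<bullet> \<nu>) * kern (p * s) z) \<partial>lborel) \<longlonglongrightarrow> 0"
proof -
  have "0 < 1 / real (Suc k)" for k by simp
  note eq = flat_truncated_integral_eq[OF d \<nu> this]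
  show ?thesis unfolding eq
    using truncated_integral_tendsto[OF half_space_integral(1)[OF d \<nu>]] unfolding half_space_integral(2)[OF d \<nu>] .
qed

end

section \<open>Comparison with the half-space\<close>

lemma AE_inner_neq:
  fixes \<nu> :: "'a::euclidean_space"
  assumes "\<nu> \<noteq> 0"
  shows "AE z in lborel. z \<bullet> \<nu> \<noteq> c"
proof -
  have "negligible {z. \<nu> \<bullet> z = c}" using assms by (intro negligible_hyperplane) auto
  moreover have "{z. \<nu> \<bullet> z = c} \<in> sets lborel" by simp
  ultimately have "{z. \<nu> \<bullet> z = c} \<in> null_sets lborel"
    by (simp add: negligible_iff_null_sets null_sets_def)
  then show ?thesis by (rule AE_I') (auto simp: inner_commute)
qed

text \<open>For \<open>t > 0\<close> this is the tangent estimate at \<open>t\<close>. For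
  \<open>t < 0\<close> the half-space profile is 0, and \<open>D > 0\<close> forces both
  \<open>D\<close> and \<open>\<bar>t\<bar>\<close> below \<open>M = m\<^sup>2 / R\<close>; then
  \<open>M powr s = M * M powr (s - 1)\<close> is at most
  \<open>M * \<bar>t\<bar> powr (s - 1)\<close>.\<close>

lemma powr_diff_paraboloid:
  fixes d D R t m :: real
  assumes s: "0 < s" "s < 1" and R: "0 < R" and D: "0 \<le> D"
    and lo: "t - m\<^sup>2 / R \<le> D" and up: "D \<le> max 0 (t + m\<^sup>2 / R)" and t: "t \<noteq> 0"
  shows "\<bar>D powr s - max 0 t powr s\<bar> \<le> m\<^sup>2 / R * \<bar>t\<bar> powr (s - 1)"
proof (cases "0 < t")
  case True
  have "\<bar>D powr s - t powr s\<bar> \<le> \<bar>D - t\<bar> * t powr (s - 1)"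
    using s D True by (intro abs_powr_diff_le_tangent) auto
  also have "\<dots> \<le> m\<^sup>2 / R * t powr (s - 1)"
  proof (intro mult_right_mono)
    have "0 \<le> m\<^sup>2 / R" using R by simp
    then have "max 0 (t + m\<^sup>2 / R) = t + m\<^sup>2 / R" using True by (intro max_absorb2) linarith
    then show "\<bar>D - t\<bar> \<le> m\<^sup>2 / R" using lo up by linarith
  qed simp
  finally show ?thesis using True by simp
next
  case False
  then have tn: "t < 0" using t by simp
  show ?thesis
  proof (cases "D = 0")
    case True
    then show ?thesis using tn R by simp
  next
    case False
    then have D0: "0 < D" using D by simp
    let ?M = "m\<^sup>2 / R"
    have "0 < t + ?M" using up D0 by (auto simp: max_def split: if_splits)
    then have M: "\<bar>t\<bar> \<le> ?M" "D \<le> ?M" "0 < ?M" using up tn by (auto simp: max_def split: if_splits)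
    have "D powr s \<le> ?M powr s" using s D M by (intro powr_mono2) auto
    also have "\<dots> = ?M * ?M powr (s - 1)"
    proof -
      have "x powr s = x * x powr (s - 1)" if "0 < x" for x using that by (simp add: powr_diff)
      from this[OF M(3)] show ?thesis .
    qed
    also have "\<dots> \<le> ?M * \<bar>t\<bar> powr (s - 1)" using M s tn by (intro mult_left_mono powr_mono2') auto
    finally show ?thesis using tn by simp
  qed
qed

text \<open>Exactly the exponent conditions of \<open>nn_integral_singular_kernel_bounded\<close>:
  \<open>\<eta>\<close> is the strength on the tangent hyperplane, \<open>\<zeta>\<close> the
  strength on the parallel hyperplane through the point.\<close>

definition admissible :: "real \<times> real \<times> real \<Rightarrow> bool" where
  "admissible = (\<lambda>(a, \<eta>, \<zeta>). -1 < a \<and> 0 \<le> \<eta> \<and> 0 \<le> \<zeta> \<and> \<eta> + \<zeta> + a < 0)"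

definition singular_term :: "real \<Rightarrow> real \<Rightarrow> real \<Rightarrow> real \<times> real \<times> real \<Rightarrow> real" where
  "singular_term m t \<tau> = (\<lambda>(a, \<eta>, \<zeta>). m powr (- a) * (\<bar>t\<bar> powr (- \<eta>) * \<bar>\<tau>\<bar> powr (- \<zeta>)))"

lemma singular_term_nonneg: "0 \<le> singular_term m t \<tau> x"
  by (auto simp: singular_term_def split: prod.split)

context exponents
begin

text \<open>A point at distance \<open>m\<close>, whose height above the tangent plane is \<open>t = d + \<tau>\<close> and whose
  distance \<open>D\<close> to the complement is within \<open>m\<^sup>2 / R\<close> of it.\<close>

definition near_config :: "real \<Rightarrow> real \<Rightarrow> real \<Rightarrow> real \<Rightarrow> real \<Rightarrow> bool" where
  "near_config R d D \<tau> m \<longleftrightarrow> 0 < d \<and> 0 \<le> D \<and> 0 < m \<and> m \<le> 1 \<and> \<bar>\<tau>\<bar> \<le> m \<and> \<bar>D - d\<bar> \<le> m \<and>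
     d + \<tau> - m\<^sup>2 / R \<le> D \<and> D \<le> max 0 (d + \<tau> + m\<^sup>2 / R) \<and> \<tau> \<noteq> 0 \<and> d + \<tau> \<noteq> 0"

definition flat_error :: "real \<Rightarrow> real \<Rightarrow> real \<Rightarrow> real" where
  "flat_error d D \<tau> = \<bar>spow (d powr s - D powr s) (p - 1) - flat_scaled s (p - 1) d \<tau>\<bar>"

text \<open>The signed power with exponent \<open>p - 1 \<ge> 1\<close> is Lipschitz on the range of
  the two differences, both at most \<open>m powr s\<close>. The powers of \<open>m\<close> add up
  to \<open>2 + s * (p - 2) - p * s = 2 - 2 * s\<close>.\<close>

lemma flat_error_bound_ge2:
  assumes p2: "2 \<le> p" and R: "0 < R" and cfg: "near_config R d D \<tau> m"
  shows "flat_error d D \<tau> * m powr (- (p * s)) \<le> (p - 1) / R * singular_term m (d + \<tau>) \<tau> (max (2 * s - 2) ((s - 2) / 2), 1 - s, 0)"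
proof -
  \<comment> \<open>The estimate yields order \<open>2 * s - 2\<close>, which may fall below -1. As
    \<open>m \<le> 1\<close> the order can be raised; the alternative is the midpoint of
    \<open>-1\<close> and the upper limit \<open>s - 1\<close> imposed by
    \<open>\<eta> = 1 - s\<close>.\<close>
  let ?a = "max (2 * s - 2) ((s - 2) / 2)"
  let ?t = "d + \<tau>"
  have c: "0 < d" "0 \<le> D" "0 < m" "m \<le> 1" "\<bar>\<tau>\<bar> \<le> m" "\<bar>D - d\<bar> \<le> m"
     "?t - m\<^sup>2 / R \<le> D" "D \<le> max 0 (?t + m\<^sup>2 / R)" "\<tau> \<noteq> 0" "?t \<noteq> 0"
    using cfg unfolding near_config_def by auto
  have A: "\<bar>d powr s - D powr s\<bar> \<le> m powr s"
    using abs_powr_diff_le_holder[of s d D] powr_mono2[of s "\<bar>d - D\<bar>" m] s c by (simp add: abs_minus_commute)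
  have B: "\<bar>d powr s - max 0 ?t powr s\<bar> \<le> m powr s"
    using abs_powr_diff_le_holder[of s d "max 0 ?t"] powr_mono2[of s "\<bar>d - max 0 ?t\<bar>" m] s c by force
  have AB: "\<bar>(d powr s - D powr s) - (d powr s - max 0 ?t powr s)\<bar> \<le> m\<^sup>2 / R * \<bar>?t\<bar> powr (s - 1)"
    using powr_diff_paraboloid[OF s R c(2,7,8,10)] by (simp add: abs_minus_commute)
  have "flat_error d D \<tau> \<le> (p - 1) * (\<bar>(d powr s - D powr s) - (d powr s - max 0 ?t powr s)\<bar> * (m powr s) powr (p - 1 - 1))"
    unfolding flat_error_def flat_scaled_def using p2 A B by (intro spow_diff_le_ge1) auto
  also have "\<dots> \<le> (p - 1) * ((m\<^sup>2 / R * \<bar>?t\<bar> powr (s - 1)) * (m powr s) powr (p - 1 - 1))"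
    using AB p by (intro mult_left_mono mult_right_mono) auto
  finally have "flat_error d D \<tau> * m powr (- (p * s)) \<le> (p - 1) * ((m\<^sup>2 / R * \<bar>?t\<bar> powr (s - 1)) * (m powr s) powr (p - 1 - 1)) * m powr (- (p * s))"
    by (intro mult_right_mono) auto
  also have "\<dots> = (p - 1) / R * ((m powr 2 * (m powr s) powr (p - 1 - 1) * m powr (- (p * s))) * \<bar>?t\<bar> powr (s - 1))"
    using c by (simp add: powr_numeral)
  also have "m powr 2 * (m powr s) powr (p - 1 - 1) * m powr (- (p * s)) = m powr (2 - 2 * s)"
    unfolding powr_powr powr_add[symmetric] by (rule arg_cong[of _ _ "\<lambda>x. m powr x"]) (simp add: algebra_simps)
  also have "(p - 1) / R * (m powr (2 - 2 * s) * \<bar>?t\<bar> powr (s - 1)) \<le> (p - 1) / R * (m powr (- ?a) * \<bar>?t\<bar> powr (s - 1))"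
    using p R c by (intro mult_left_mono mult_right_mono powr_mono') auto
  also have "m powr (- ?a) * \<bar>?t\<bar> powr (s - 1) = singular_term m ?t \<tau> (?a, 1 - s, 0)"
    unfolding singular_term_def using c by simp
  finally show ?thesis .
qed

text \<open>The signed power is linearised at the half-space difference, whose lower bound turns the
  slope into \<open>\<bar>\<tau>\<bar> powr (p - 2) * max d t powr e\<close>. Since
  \<open>max d t \<le> t + \<bar>\<tau>\<bar>\<close>, subadditivity splits this into two terms.
  Both triples have \<open>\<eta> + \<zeta> = 1 - s * (p - 1)\<close>, and the second entry of
  \<open>a\<close> is the midpoint of \<open>-1\<close> and \<open>s * (p - 1) - 1\<close>.\<close>

lemma flat_error_bound_lt2_above:
  assumes p2: "p < 2" and R: "0 < R" and cfg: "near_config R d D \<tau> m" and above: "0 < d + \<tau>"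
  defines "e \<equiv> (1 - s) * (2 - p)" and "a \<equiv> max (p * s - 2) (s * (p - 1) / 2 - 1)"
  shows "flat_error d D \<tau> * m powr (- (p * s)) \<le> 2 * s powr (p - 2) / R *
     (singular_term m (d + \<tau>) \<tau> (a, 1 - s - e, 2 - p) + singular_term m (d + \<tau>) \<tau> (a, 1 - s, 2 - p - e))"
proof -
  let ?t = "d + \<tau>"
  have c: "0 < d" "0 \<le> D" "0 < m" "m \<le> 1" "\<bar>\<tau>\<bar> \<le> m" "\<bar>D - d\<bar> \<le> m"
     "?t - m\<^sup>2 / R \<le> D" "D \<le> max 0 (?t + m\<^sup>2 / R)" "\<tau> \<noteq> 0" "?t \<noteq> 0"
    using cfg unfolding near_config_def by auto
  have e: "0 \<le> e" "e \<le> 1" unfolding e_def using s p p2 by (auto intro: mult_le_one)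
  let ?A = "d powr s - D powr s" let ?B = "d powr s - max 0 ?t powr s"
  have AB: "\<bar>?A - ?B\<bar> \<le> m\<^sup>2 / R * ?t powr (s - 1)"
    using powr_diff_paraboloid[OF s R c(2,7,8,10)] above by (simp add: abs_minus_commute)
  have low: "s * \<bar>\<tau>\<bar> * (max d ?t) powr (s - 1) \<le> \<bar>?B\<bar>"
    using abs_powr_diff_ge[of s d ?t] s c above by simp
  have pos: "0 < s * \<bar>\<tau>\<bar> * (max d ?t) powr (s - 1)" using s c by simp
  have "\<bar>?B\<bar> powr (p - 1 - 1) \<le> (s * \<bar>\<tau>\<bar> * (max d ?t) powr (s - 1)) powr (p - 1 - 1)"
    using low pos p2 by (intro powr_mono2') auto
  also have "\<dots> = s powr (p - 2) * \<bar>\<tau>\<bar> powr (p - 2) * (max d ?t) powr e"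
    using s c by (simp add: powr_mult powr_powr e_def algebra_simps)
  also have "\<dots> \<le> s powr (p - 2) * \<bar>\<tau>\<bar> powr (p - 2) * (?t powr e + \<bar>\<tau>\<bar> powr e)"
  proof (intro mult_left_mono)
    have "(max d ?t) powr e \<le> (?t + \<bar>\<tau>\<bar>) powr e" using c e by (intro powr_mono2) auto
    also have "\<dots> \<le> ?t powr e + \<bar>\<tau>\<bar> powr e" using e above by (intro powr_subadditive) auto
    finally show "(max d ?t) powr e \<le> ?t powr e + \<bar>\<tau>\<bar> powr e" .
  qed auto
  finally have Bq: "\<bar>?B\<bar> powr (p - 1 - 1) \<le> s powr (p - 2) * \<bar>\<tau>\<bar> powr (p - 2) * (?t powr e + \<bar>\<tau>\<bar> powr e)" .
  have "flat_error d D \<tau> \<le> 2 * (\<bar>?A - ?B\<bar> * \<bar>?B\<bar> powr (p - 1 - 1))"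
    unfolding flat_error_def flat_scaled_def using p p2 low pos by (intro spow_diff_le_tangent) auto
  also have "\<dots> \<le> 2 * ((m\<^sup>2 / R * ?t powr (s - 1)) * (s powr (p - 2) * \<bar>\<tau>\<bar> powr (p - 2) * (?t powr e + \<bar>\<tau>\<bar> powr e)))"
    using AB Bq R by (intro mult_left_mono mult_mono) auto
  finally have "flat_error d D \<tau> * m powr (- (p * s)) \<le> 2 * ((m\<^sup>2 / R * ?t powr (s - 1)) * (s powr (p - 2) * \<bar>\<tau>\<bar> powr (p - 2) * (?t powr e + \<bar>\<tau>\<bar> powr e))) * m powr (- (p * s))"
    by (intro mult_right_mono) auto
  also have "\<dots> = 2 * s powr (p - 2) / R * ((m powr 2 * m powr (- (p * s))) * (?t powr (s - 1) * \<bar>\<tau>\<bar> powr (p - 2) * (?t powr e + \<bar>\<tau>\<bar> powr e)))"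
    using c by (simp add: powr_numeral)
  also have "m powr 2 * m powr (- (p * s)) = m powr (2 - p * s)"
    unfolding powr_add[symmetric] by simp
  also have "2 * s powr (p - 2) / R * (m powr (2 - p * s) * (?t powr (s - 1) * \<bar>\<tau>\<bar> powr (p - 2) * (?t powr e + \<bar>\<tau>\<bar> powr e)))
    \<le> 2 * s powr (p - 2) / R * (m powr (- a) * (?t powr (s - 1) * \<bar>\<tau>\<bar> powr (p - 2) * (?t powr e + \<bar>\<tau>\<bar> powr e)))"
    using R c unfolding a_def by (intro mult_left_mono mult_right_mono powr_mono') auto
  also have "m powr (- a) * (?t powr (s - 1) * \<bar>\<tau>\<bar> powr (p - 2) * (?t powr e + \<bar>\<tau>\<bar> powr e))
     = m powr (- a) * ((?t powr (s - 1) * ?t powr e) * \<bar>\<tau>\<bar> powr (p - 2)) + m powr (- a) * (?t powr (s - 1) * (\<bar>\<tau>\<bar> powr (p - 2) * \<bar>\<tau>\<bar> powr e))"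
    by (simp only: distrib_left mult_ac)
  also have "\<dots> = singular_term m ?t \<tau> (a, 1 - s - e, 2 - p) + singular_term m ?t \<tau> (a, 1 - s, 2 - p - e)"
    unfolding singular_term_def powr_add[symmetric] using above by (simp add: algebra_simps)
  finally show ?thesis .
qed

text \<open>Below the tangent plane the half-space difference is just \<open>d powr s\<close>, with
  no lower bound in terms of \<open>\<tau>\<close>, so linearisation would lose uniformity in
  \<open>d\<close>. The Hoelder estimate is used instead, and part of the smallness of
  \<open>D\<close> is traded for a negative power of \<open>\<bar>t\<bar>\<close>.\<close>

lemma flat_error_bound_lt2_below:
  assumes p2: "p < 2" and R: "0 < R" and cfg: "near_config R d D \<tau> m" and below: "d + \<tau> < 0"
  defines "w \<equiv> s * (2 - p)"
  shows "flat_error d D \<tau> * m powr (- (p * s)) \<le> 2 * R powr (- (s * (p - 1) + (1 + 3 * w) / 4)) *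
     singular_term m (d + \<tau>) \<tau> (- (1 + w) / 2, (1 + 3 * w) / 4, 0)"
proof -
  let ?t = "d + \<tau>"
  \<comment> \<open>Trading the exponent \<open>\<eta>\<close> leads to order
    \<open>w - 2 * \<eta>\<close>, which is admissible when \<open>\<eta>\<close> lies strictly
    between \<open>w\<close> and \<open>(1 + w) / 2\<close>. The midpoint is chosen.\<close>
  define \<eta> where "\<eta> = (1 + 3 * w) / 4"
  have c: "0 < d" "0 \<le> D" "0 < m" "m \<le> 1" "\<bar>\<tau>\<bar> \<le> m" "\<bar>D - d\<bar> \<le> m"
     "?t - m\<^sup>2 / R \<le> D" "D \<le> max 0 (?t + m\<^sup>2 / R)" "\<tau> \<noteq> 0" "?t \<noteq> 0"
    using cfg unfolding near_config_def by auto
  have w: "0 \<le> w" unfolding w_def using s p2 by simp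
  have \<eta>: "0 < \<eta>" unfolding \<eta>_def using w by simp
  let ?M = "m\<^sup>2 / R"
  have le: "flat_error d D \<tau> \<le> 2 * (?M powr (s * (p - 1) + \<eta>) * \<bar>?t\<bar> powr (- \<eta>))"
  proof (cases "D = 0")
    case True
    then have "flat_error d D \<tau> = 0" unfolding flat_error_def flat_scaled_def using below by simp
    then show ?thesis by simp
  next
    case False
    then have D0: "0 < D" using c by simp
    have "0 < ?t + ?M" using c(8) D0 by (auto simp: max_def split: if_splits)
    then have M: "\<bar>?t\<bar> \<le> ?M" "D \<le> ?M" "0 < ?M" using c(8) below by (auto simp: max_def split: if_splits)
    have "flat_error d D \<tau> \<le> 2 * \<bar>(d powr s - D powr s) - (d powr s - max 0 ?t powr s)\<bar> powr (p - 1)"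
      unfolding flat_error_def flat_scaled_def using p p2 by (intro spow_diff_le_holder) auto
    also have "\<bar>(d powr s - D powr s) - (d powr s - max 0 ?t powr s)\<bar> powr (p - 1) = D powr (s * (p - 1))"
      using below by (simp add: powr_powr)
    also have "\<dots> \<le> ?M powr (s * (p - 1))" using M D0 s p by (intro powr_mono2) auto
    also have "\<dots> = ?M powr (s * (p - 1) + \<eta>) * ?M powr (- \<eta>)" by (simp add: powr_add[symmetric])
    also have "\<dots> \<le> ?M powr (s * (p - 1) + \<eta>) * \<bar>?t\<bar> powr (- \<eta>)"
      using M \<eta> below by (intro mult_left_mono powr_mono2') auto
    finally show ?thesis by simp
  qed
  have "flat_error d D \<tau> * m powr (- (p * s)) \<le> 2 * (?M powr (s * (p - 1) + \<eta>) * \<bar>?t\<bar> powr (- \<eta>)) * m powr (- (p * s))"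
    using le by (intro mult_right_mono) auto
  also have "?M powr (s * (p - 1) + \<eta>) = (m powr 2) powr (s * (p - 1) + \<eta>) * R powr (- (s * (p - 1) + \<eta>))"
  proof -
    have "(m\<^sup>2 / R) powr y = (m powr 2) powr y * R powr (- y)" for y
      using c R by (simp add: powr_divide powr_minus_divide powr_numeral)
    then show ?thesis .
  qed
  also have "2 * ((m powr 2) powr (s * (p - 1) + \<eta>) * R powr (- (s * (p - 1) + \<eta>)) * \<bar>?t\<bar> powr (- \<eta>)) * m powr (- (p * s))
     = 2 * R powr (- (s * (p - 1) + \<eta>)) * (((m powr 2) powr (s * (p - 1) + \<eta>) * m powr (- (p * s))) * \<bar>?t\<bar> powr (- \<eta>))"
    by (simp only: mult_ac)
  also have "(m powr 2) powr (s * (p - 1) + \<eta>) * m powr (- (p * s)) = m powr (- (- (1 + w) / 2))"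
    unfolding powr_powr powr_add[symmetric] \<eta>_def w_def
    by (rule arg_cong[of _ _ "\<lambda>x. m powr x"]) (simp add: field_simps)
  also have "m powr (- (- (1 + w) / 2)) * \<bar>?t\<bar> powr (- \<eta>) = singular_term m ?t \<tau> (- (1 + w) / 2, \<eta>, 0)"
    unfolding singular_term_def using c by simp
  finally show ?thesis unfolding \<eta>_def .
qed

lemma flat_error_bound:
  assumes R: "0 < R"
  obtains T K where "finite T" "\<forall>x\<in>T. admissible x" "0 \<le> K"
    "\<forall>d D \<tau> m. near_config R d D \<tau> m \<longrightarrow> flat_error d D \<tau> * m powr (- (p * s)) \<le> K * (\<Sum>x\<in>T. singular_term m (d + \<tau>) \<tau> x)"
proof (cases "2 \<le> p")
  case True
  let ?x = "(max (2 * s - 2) ((s - 2) / 2), 1 - s, 0::real)"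
  show ?thesis
  proof (rule that[of "{?x}" "(p - 1) / R"])
    show "\<forall>x\<in>{?x}. admissible x" unfolding admissible_def using s by (auto simp: max_def field_simps)
    show "\<forall>d D \<tau> m. near_config R d D \<tau> m \<longrightarrow> flat_error d D \<tau> * m powr (- (p * s)) \<le> (p - 1) / R * (\<Sum>x\<in>{?x}. singular_term m (d + \<tau>) \<tau> x)"
      using flat_error_bound_ge2[OF True R] by simp
  qed (use p R in auto)
next
  case False
  then have p2: "p < 2" by simp
  define e where "e = (1 - s) * (2 - p)"
  define a where "a = max (p * s - 2) (s * (p - 1) / 2 - 1)"
  define w where "w = s * (2 - p)"
  define x1 where "x1 = (a, 1 - s - e, 2 - p)"
  define x2 where "x2 = (a, 1 - s, 2 - p - e)"
  define x3 where "x3 = (- (1 + w) / 2, (1 + 3 * w) / 4, 0::real)"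
  define K where "K = 4 * s powr (p - 2) / R + 2 * R powr (- (s * (p - 1) + (1 + 3 * w) / 4))"
  have w: "0 \<le> w" "w < 1"
  proof -
    show "0 \<le> w" unfolding w_def using s p2 by simp
    have "s * (2 - p) < 1 * 1" using s p p2 by (intro mult_strict_mono) auto
    then show "w < 1" unfolding w_def by simp
  qed
  have e1: "1 - s - e = (1 - s) * (p - 1)" unfolding e_def by (simp add: algebra_simps)
  have e2: "2 - p - e = s * (2 - p)" unfolding e_def by (simp add: algebra_simps)
  have e0: "0 \<le> (1 - s) * (p - 1)" using s p by simp
  have sp: "0 < s * (p - 1)" using s p by simp
  \<comment> \<open>This is the condition \<open>s < 1\<close>: the order produced by the curvature
    lies below the limit of integrability.\<close>
  have "p * s - 2 < s * (p - 1) - 1" using s by (simp add: algebra_simps)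
  moreover have "s * (p - 1) / 2 - 1 < s * (p - 1) - 1" "- 1 < s * (p - 1) / 2 - 1" using sp by linarith+
  ultimately have amax: "-1 < a" "a < s * (p - 1) - 1"
    unfolding a_def by (simp_all only: less_max_iff_disj max_less_iff_conj simp_thms)
  have adm1: "admissible x1"
    unfolding admissible_def x1_def e1 using amax e0 p2 by (auto simp: algebra_simps)
  have adm2: "admissible x2"
    unfolding admissible_def x2_def e2 using amax w s p2 unfolding w_def by (auto simp: algebra_simps)
  have adm3: "admissible x3"
    unfolding admissible_def x3_def using w by (auto simp: field_simps)
  let ?T = "{x1, x2, x3}"
  show ?thesis
  proof (rule that[of ?T K])
    show "\<forall>x\<in>?T. admissible x" using adm1 adm2 adm3 by simp
    show K: "0 \<le> K" unfolding K_def using R by simp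
    show "\<forall>d D \<tau> m. near_config R d D \<tau> m \<longrightarrow> flat_error d D \<tau> * m powr (- (p * s)) \<le> K * (\<Sum>x\<in>?T. singular_term m (d + \<tau>) \<tau> x)"
    proof (intro allI impI)
      fix d D \<tau> m assume cfg: "near_config R d D \<tau> m"
      let ?S = "\<Sum>x\<in>?T. singular_term m (d + \<tau>) \<tau> x"
      \<comment> \<open>Each term is bounded by the whole sum; two such bounds are added above the
        tangent plane, which doubles the constant in \<open>K\<close>.\<close>
      have mem: "singular_term m (d + \<tau>) \<tau> x \<le> ?S" if "x \<in> ?T" for x
        using that by (intro member_le_sum) (auto simp: singular_term_nonneg)
      have S0: "0 \<le> ?S" by (intro sum_nonneg singular_term_nonneg)
      consider "0 < d + \<tau>" | "d + \<tau> < 0" using cfg unfolding near_config_def by linarith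
      then show "flat_error d D \<tau> * m powr (- (p * s)) \<le> K * ?S"
      proof cases
        case 1
        have "flat_error d D \<tau> * m powr (- (p * s)) \<le> 2 * s powr (p - 2) / R * (singular_term m (d + \<tau>) \<tau> x1 + singular_term m (d + \<tau>) \<tau> x2)"
          using flat_error_bound_lt2_above[OF p2 R cfg 1] unfolding x1_def x2_def a_def e_def .
        also have "\<dots> \<le> 2 * s powr (p - 2) / R * (?S + ?S)"
          using mem[of x1] mem[of x2] R by (intro mult_left_mono add_mono) auto
        also have "\<dots> = 4 * s powr (p - 2) / R * ?S" by simp
        also have "\<dots> \<le> K * ?S" unfolding K_def using S0 by (intro mult_right_mono) auto
        finally show ?thesis .
      next
        case 2
        have "flat_error d D \<tau> * m powr (- (p * s)) \<le> 2 * R powr (- (s * (p - 1) + (1 + 3 * w) / 4)) * singular_term m (d + \<tau>) \<tau> x3"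
          using flat_error_bound_lt2_below[OF p2 R cfg 2] unfolding x3_def w_def .
        also have "\<dots> \<le> 2 * R powr (- (s * (p - 1) + (1 + 3 * w) / 4)) * ?S"
          using mem[of x3] by (intro mult_left_mono) auto
        also have "\<dots> \<le> K * ?S" unfolding K_def using S0 R s by (intro mult_right_mono) auto
        finally show ?thesis .
      qed
    qed
  qed simp
qed

end

section \<open>The principal value of the curved problem\<close>

context exponents
begin

text \<open>The finitely many singular terms are integrated one by one after the kernel's factor
  \<open>norm z powr (- ?n)\<close> is restored; the two excluded hyperplanes are null sets. The
  distance enters only through \<open>near_config\<close>, so the constant depends neither on the
  point nor on its normal.\<close>

lemma near_error_integral:
  assumes R: "0 < R"
  obtains C where "0 \<le> C"
    "\<forall>(\<nu>::'a::euclidean_space) d D. norm \<nu> = 1 \<longrightarrow> 0 < d \<longrightarrow> d \<le> 1 \<longrightarrow>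
      (\<forall>z. norm z \<le> R / 4 \<longrightarrow> z \<bullet> \<nu> \<noteq> 0 \<longrightarrow> d + z \<bullet> \<nu> \<noteq> 0 \<longrightarrow> near_config R d (D z) (z \<bullet> \<nu>) (norm z)) \<longrightarrow>
      (\<integral>\<^sup>+z. ennreal (flat_error d (D z) (z \<bullet> \<nu>) * kern (p * s) z) * indicator (cball 0 (R / 4)) z \<partial>lborel) \<le> ennreal C"
proof -
  let ?n = "real DIM('a)"
  obtain T K where T: "finite T" "\<forall>x\<in>T. admissible x" and K: "0 \<le> K"
    and bound: "\<forall>d D \<tau> m. near_config R d D \<tau> m \<longrightarrow> flat_error d D \<tau> * m powr (- (p * s)) \<le> K * (\<Sum>x\<in>T. singular_term m (d + \<tau>) \<tau> x)"
    by (rule flat_error_bound[OF R])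
  have "\<forall>x\<in>T. \<exists>C\<ge>0. \<forall>(\<nu>::'a) d. norm \<nu> = 1 \<longrightarrow> 0 \<le> d \<longrightarrow> d \<le> 1 \<longrightarrow>
      (\<integral>\<^sup>+z. ennreal (norm z powr (- ?n) * singular_term (norm z) (d + z \<bullet> \<nu>) (z \<bullet> \<nu>) x) * indicator (cball 0 1) z \<partial>lborel) \<le> ennreal C"
  proof
    fix x assume x: "x \<in> T"
    obtain a \<eta> \<zeta> where xe: "x = (a, \<eta>, \<zeta>)" by (cases x) auto
    have adm: "-1 < a" "0 \<le> \<eta>" "0 \<le> \<zeta>" "\<eta> + \<zeta> + a < 0" using T(2) x unfolding xe admissible_def by auto
    obtain C where C: "0 \<le> C" "\<forall>(\<nu>::'a) d. norm \<nu> = 1 \<longrightarrow> 0 \<le> d \<longrightarrow> d \<le> 1 \<longrightarrow>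
      (\<integral>\<^sup>+z. ennreal (kern a z * (\<bar>d + z \<bullet> \<nu>\<bar> powr (- \<eta>) * \<bar>z \<bullet> \<nu>\<bar> powr (- \<zeta>))) * indicator (cball 0 1) z \<partial>lborel) \<le> ennreal C"
      by (rule nn_integral_singular_kernel_bounded[where 'a='a, OF adm])
    have "norm z powr (- ?n) * singular_term (norm z) (d + z \<bullet> \<nu>) (z \<bullet> \<nu>) x
       = kern a z * (\<bar>d + z \<bullet> \<nu>\<bar> powr (- \<eta>) * \<bar>z \<bullet> \<nu>\<bar> powr (- \<zeta>))" for z \<nu> :: 'a and d
    proof -
      have "norm z powr (- ?n) * norm z powr (- a) = kern a z"
        unfolding powr_add[symmetric] by simp
      then show ?thesis unfolding xe singular_term_def by (simp only: prod.case mult.assoc[symmetric])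
    qed
    with C show "\<exists>C\<ge>0. \<forall>(\<nu>::'a) d. norm \<nu> = 1 \<longrightarrow> 0 \<le> d \<longrightarrow> d \<le> 1 \<longrightarrow>
      (\<integral>\<^sup>+z. ennreal (norm z powr (- ?n) * singular_term (norm z) (d + z \<bullet> \<nu>) (z \<bullet> \<nu>) x) * indicator (cball 0 1) z \<partial>lborel) \<le> ennreal C"
      by (intro exI[of _ C]) simp
  qed
  then obtain c where c: "\<forall>x\<in>T. 0 \<le> c x \<and> (\<forall>(\<nu>::'a) d. norm \<nu> = 1 \<longrightarrow> 0 \<le> d \<longrightarrow> d \<le> 1 \<longrightarrow>
      (\<integral>\<^sup>+z. ennreal (norm z powr (- ?n) * singular_term (norm z) (d + z \<bullet> \<nu>) (z \<bullet> \<nu>) x) * indicator (cball 0 1) z \<partial>lborel) \<le> ennreal (c x))"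
    by (rule bchoice[THEN exE]) blast
  show ?thesis
  proof (rule that[of "K * (\<Sum>x\<in>T. c x)"])
    show "0 \<le> K * (\<Sum>x\<in>T. c x)" using K c by (intro mult_nonneg_nonneg sum_nonneg) auto
    show "\<forall>(\<nu>::'a) d D. norm \<nu> = 1 \<longrightarrow> 0 < d \<longrightarrow> d \<le> 1 \<longrightarrow>
      (\<forall>z. norm z \<le> R / 4 \<longrightarrow> z \<bullet> \<nu> \<noteq> 0 \<longrightarrow> d + z \<bullet> \<nu> \<noteq> 0 \<longrightarrow> near_config R d (D z) (z \<bullet> \<nu>) (norm z)) \<longrightarrow>
      (\<integral>\<^sup>+z. ennreal (flat_error d (D z) (z \<bullet> \<nu>) * kern (p * s) z) * indicator (cball 0 (R / 4)) z \<partial>lborel) \<le> ennreal (K * (\<Sum>x\<in>T. c x))"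
    proof (intro allI impI)
      fix \<nu> :: 'a and d :: real and D :: "'a \<Rightarrow> real"
      assume \<nu>: "norm \<nu> = 1" and d: "0 < d" "d \<le> 1"
        and cfg: "\<forall>z. norm z \<le> R / 4 \<longrightarrow> z \<bullet> \<nu> \<noteq> 0 \<longrightarrow> d + z \<bullet> \<nu> \<noteq> 0 \<longrightarrow> near_config R d (D z) (z \<bullet> \<nu>) (norm z)"
      let ?s = "\<lambda>x z. ennreal (norm z powr (- ?n) * singular_term (norm z) (d + z \<bullet> \<nu>) (z \<bullet> \<nu>) x) * indicator (cball 0 1) z"
      have ms: "?s x \<in> borel_measurable lborel" for x
      proof -
        have [measurable]: "cball (0::'a) 1 \<in> sets borel" by simp
        show ?thesis unfolding singular_term_def by (cases x) (simp, measurable)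
      qed
      have \<nu>0: "\<nu> \<noteq> 0" using \<nu> by auto
      have "(\<integral>\<^sup>+z. ennreal (flat_error d (D z) (z \<bullet> \<nu>) * kern (p * s) z) * indicator (cball 0 (R / 4)) z \<partial>lborel)
         \<le> (\<integral>\<^sup>+z. ennreal K * (\<Sum>x\<in>T. ?s x z) \<partial>lborel)"
      proof (rule nn_integral_mono_AE)
        show "AE z in lborel. ennreal (flat_error d (D z) (z \<bullet> \<nu>) * kern (p * s) z) * indicator (cball 0 (R / 4)) z \<le> ennreal K * (\<Sum>x\<in>T. ?s x z)"
          using AE_inner_neq[OF \<nu>0, of 0] AE_inner_neq[OF \<nu>0, of "- d"]
        proof eventually_elim
          fix z assume z: "z \<bullet> \<nu> \<noteq> 0" "z \<bullet> \<nu> \<noteq> - d"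
          show "ennreal (flat_error d (D z) (z \<bullet> \<nu>) * kern (p * s) z) * indicator (cball 0 (R / 4)) z \<le> ennreal K * (\<Sum>x\<in>T. ?s x z)"
          proof (cases "norm z \<le> R / 4")
            case True
            have "d + z \<bullet> \<nu> \<noteq> 0" using z(2) by (metis add.commute eq_neg_iff_add_eq_0)
            then have nc: "near_config R d (D z) (z \<bullet> \<nu>) (norm z)" using cfg True z(1) by blast
            then have n1: "norm z \<le> 1" unfolding near_config_def by blast
            have "kern (p * s) z = norm z powr (- (p * s)) * norm z powr (- ?n)"
              unfolding powr_add[symmetric] by (rule arg_cong[of _ _ "\<lambda>y. norm z powr y"]) simp
            then have "flat_error d (D z) (z \<bullet> \<nu>) * kern (p * s) z
               = (flat_error d (D z) (z \<bullet> \<nu>) * norm z powr (- (p * s))) * norm z powr (- ?n)" by (simp only: mult.assoc)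
            also have "\<dots> \<le> (K * (\<Sum>x\<in>T. singular_term (norm z) (d + z \<bullet> \<nu>) (z \<bullet> \<nu>) x)) * norm z powr (- ?n)"
              using bound nc by (intro mult_right_mono) auto
            also have "\<dots> = K * (\<Sum>x\<in>T. norm z powr (- ?n) * singular_term (norm z) (d + z \<bullet> \<nu>) (z \<bullet> \<nu>) x)"
              by (simp only: sum_distrib_left mult_ac)
            finally have "ennreal (flat_error d (D z) (z \<bullet> \<nu>) * kern (p * s) z) \<le> ennreal (K * (\<Sum>x\<in>T. norm z powr (- ?n) * singular_term (norm z) (d + z \<bullet> \<nu>) (z \<bullet> \<nu>) x))"
              by (rule ennreal_leI)
            also have "\<dots> = ennreal K * (\<Sum>x\<in>T. ennreal (norm z powr (- ?n) * singular_term (norm z) (d + z \<bullet> \<nu>) (z \<bullet> \<nu>) x))"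
              using K by (subst ennreal_mult) (auto intro!: sum_nonneg mult_nonneg_nonneg simp: singular_term_nonneg sum_ennreal)
            also have "\<dots> = ennreal K * (\<Sum>x\<in>T. ?s x z)" using n1 by simp
            finally show ?thesis using True by simp
          qed simp
        qed
      qed
      also have "\<dots> = ennreal K * (\<integral>\<^sup>+z. (\<Sum>x\<in>T. ?s x z) \<partial>lborel)"
        by (rule nn_integral_cmult) (rule borel_measurable_sum[OF ms])
      also have "(\<integral>\<^sup>+z. (\<Sum>x\<in>T. ?s x z) \<partial>lborel) = (\<Sum>x\<in>T. \<integral>\<^sup>+z. ?s x z \<partial>lborel)"
        by (rule nn_integral_sum[OF ms])
      also have "ennreal K * (\<Sum>x\<in>T. \<integral>\<^sup>+z. ?s x z \<partial>lborel) \<le> ennreal K * (\<Sum>x\<in>T. ennreal (c x))"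
        using c \<nu> d by (intro mult_left_mono sum_mono) auto
      also have "\<dots> = ennreal (K * (\<Sum>x\<in>T. c x))"
        using K c by (subst sum_ennreal) (auto simp: ennreal_mult sum_nonneg)
      finally show "(\<integral>\<^sup>+z. ennreal (flat_error d (D z) (z \<bullet> \<nu>) * kern (p * s) z) * indicator (cball 0 (R / 4)) z \<partial>lborel) \<le> ennreal (K * (\<Sum>x\<in>T. c x))" .
    qed
  qed
qed

lemma infdist_powr_holder:
  "\<bar>infdist x A powr s - infdist (y::'a::euclidean_space) A powr s\<bar> \<le> dist x y powr s"
proof -
  have "\<bar>infdist x A powr s - infdist y A powr s\<bar> \<le> \<bar>infdist x A - infdist y A\<bar> powr s"
    using s by (intro abs_powr_diff_le_holder) (auto simp: infdist_nonneg)
  also have "\<dots> \<le> dist x y powr s" using s by (intro powr_mono2) (auto simp: infdist_triangle_abs)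
  finally show ?thesis .
qed

lemma spow_infdist_bound:
  "\<bar>spow (infdist x A powr s - infdist (y::'a::euclidean_space) A powr s) (p - 1)\<bar> \<le> dist x y powr (s * (p - 1))"
proof -
  have "\<bar>infdist x A powr s - infdist y A powr s\<bar> powr (p - 1) \<le> (dist x y powr s) powr (p - 1)"
    using infdist_powr_holder p by (intro powr_mono2) auto
  then show ?thesis by (simp add: abs_spow powr_powr)
qed

text \<open>Beyond radius \<open>R / 4\<close> no comparison is made: Hoelder continuity bounds both
  numerators by \<open>norm z powr (s * (p - 1))\<close>, leaving twice the integrable kernel
  \<open>kern s\<close>.\<close>

lemma curved_error_integral:
  fixes \<Omega> :: "'a::euclidean_space set"
  assumes dom: "C11_domain \<Omega>"
  obtains R C where "0 < R" "R \<le> 1" "0 \<le> C"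
    "\<forall>x\<in>\<Omega>. infdist x (- \<Omega>) \<le> R / 4 \<longrightarrow>
       (\<exists>n. norm n = 1 \<and> ball (x - (2 * infdist x (- \<Omega>)) *\<^sub>R n) (infdist x (- \<Omega>)) \<inter> \<Omega> = {} \<and>
        (\<integral>\<^sup>+z. ennreal (flat_error (infdist x (- \<Omega>)) (infdist (x + z) (- \<Omega>)) (z \<bullet> n) * kern (p * s) z) \<partial>lborel) \<le> ennreal C)"
proof -
  let ?n = "real DIM('a)" let ?\<delta> = "\<lambda>x. infdist x (- \<Omega>)"
  obtain R where R: "0 < R" "R \<le> 1" and normal: "\<And>x. x \<in> \<Omega> \<Longrightarrow> ?\<delta> x \<le> R / 4 \<Longrightarrow>
       \<exists>n. norm n = 1 \<and> ball (x - (2 * ?\<delta> x) *\<^sub>R n) (?\<delta> x) \<inter> \<Omega> = {} \<and>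
         (\<forall>z. norm z \<le> R / 4 \<longrightarrow>
            ?\<delta> x + z \<bullet> n - (norm z)\<^sup>2 / R \<le> ?\<delta> (x + z) \<and>
            ?\<delta> (x + z) \<le> max 0 (?\<delta> x + z \<bullet> n + (norm z)\<^sup>2 / R))"
    using C11_domain_boundary_normal[OF dom] by blast
  obtain C1 where C1: "0 \<le> C1" "\<forall>(\<nu>::'a) d D. norm \<nu> = 1 \<longrightarrow> 0 < d \<longrightarrow> d \<le> 1 \<longrightarrow>
      (\<forall>z. norm z \<le> R / 4 \<longrightarrow> z \<bullet> \<nu> \<noteq> 0 \<longrightarrow> d + z \<bullet> \<nu> \<noteq> 0 \<longrightarrow> near_config R d (D z) (z \<bullet> \<nu>) (norm z)) \<longrightarrow>
      (\<integral>\<^sup>+z. ennreal (flat_error d (D z) (z \<bullet> \<nu>) * kern (p * s) z) * indicator (cball 0 (R / 4)) z \<partial>lborel) \<le> ennreal C1"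
    by (rule near_error_integral[where 'a='a, OF R(1)])
  obtain C2 where C2: "0 \<le> C2" "\<forall>r>0. (\<integral>\<^sup>+z. ennreal (kern s z) * indicator {z. r \<le> norm z} (z::'a) \<partial>lborel) \<le> ennreal (C2 * r powr (- s))"
    by (rule nn_integral_norm_powr_outside[where 'a='a, OF s(1)])
  have op: "open \<Omega>" and bd: "bounded \<Omega>" using dom unfolding C11_domain_def by auto
  have \<delta>pos: "0 < ?\<delta> x" if "x \<in> \<Omega>" for x by (rule infdist_complement_pos[OF op bd that])
  let ?E = "\<lambda>x n z. flat_error (?\<delta> x) (?\<delta> (x + z)) (z \<bullet> n) * kern (p * s) z"
  have [measurable]: "(\<lambda>z. ?\<delta> (x + z)) \<in> borel_measurable borel" for x
    by (intro borel_measurable_continuous_onI continuous_intros)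
  have mE: "?E x n \<in> borel_measurable borel" for x n unfolding flat_error_def by measurable
  show ?thesis
  proof (rule that[OF R, of "C1 + 2 * (C2 * (R / 4) powr (- s))"])
    show "0 \<le> C1 + 2 * (C2 * (R / 4) powr (- s))" using C1 C2 by simp
    show "\<forall>x\<in>\<Omega>. ?\<delta> x \<le> R / 4 \<longrightarrow>
       (\<exists>n. norm n = 1 \<and> ball (x - (2 * ?\<delta> x) *\<^sub>R n) (?\<delta> x) \<inter> \<Omega> = {} \<and>
        (\<integral>\<^sup>+z. ennreal (?E x n z) \<partial>lborel) \<le> ennreal (C1 + 2 * (C2 * (R / 4) powr (- s))))"
    proof (intro ballI impI)
      fix x assume x: "x \<in> \<Omega>" "?\<delta> x \<le> R / 4"
      obtain n where n: "norm n = 1" "ball (x - (2 * ?\<delta> x) *\<^sub>R n) (?\<delta> x) \<inter> \<Omega> = {}"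
        and para: "\<forall>z. norm z \<le> R / 4 \<longrightarrow>
            ?\<delta> x + z \<bullet> n - (norm z)\<^sup>2 / R \<le> ?\<delta> (x + z) \<and>
            ?\<delta> (x + z) \<le> max 0 (?\<delta> x + z \<bullet> n + (norm z)\<^sup>2 / R)"
        using normal[OF x] by blast
      have inl: "\<bar>z \<bullet> n\<bar> \<le> norm z" for z using Cauchy_Schwarz_ineq2[of z n] n by simp
      have cfg: "near_config R (?\<delta> x) (?\<delta> (x + z)) (z \<bullet> n) (norm z)"
        if z: "norm z \<le> R / 4" "z \<bullet> n \<noteq> 0" "?\<delta> x + z \<bullet> n \<noteq> 0" for z
        unfolding near_config_def
      proof (intro conjI)
        show "0 < norm z" using z(2) by auto
        show "norm z \<le> 1" using z(1) R by simp
        show "\<bar>?\<delta> (x + z) - ?\<delta> x\<bar> \<le> norm z" using infdist_triangle_abs[of "x + z" "- \<Omega>" x] by (simp add: dist_norm)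
      qed (use z para inl \<delta>pos[OF x(1)] in \<open>auto simp: infdist_nonneg\<close>)
      have "(\<integral>\<^sup>+z. ennreal (?E x n z) \<partial>lborel)
         \<le> (\<integral>\<^sup>+z. ennreal (?E x n z) * indicator (cball 0 (R / 4)) z + 2 * (ennreal (kern s z) * indicator {z. R / 4 \<le> norm z} z) \<partial>lborel)"
      proof (rule nn_integral_mono)
        fix z :: 'a
        show "ennreal (?E x n z) \<le> ennreal (?E x n z) * indicator (cball 0 (R / 4)) z + 2 * (ennreal (kern s z) * indicator {z. R / 4 \<le> norm z} z)"
        proof (cases "norm z \<le> R / 4")
          case False
          have "\<bar>flat_scaled s (p - 1) (?\<delta> x) (z \<bullet> n)\<bar> \<le> \<bar>z \<bullet> n\<bar> powr (s * (p - 1))"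
            using s p \<delta>pos[OF x(1)] by (intro flat_scaled_bound) auto
          also have "\<dots> \<le> norm z powr (s * (p - 1))" using inl[of z] s p by (intro powr_mono2) auto
          finally have 1: "\<bar>flat_scaled s (p - 1) (?\<delta> x) (z \<bullet> n)\<bar> \<le> norm z powr (s * (p - 1))" .
          have 2: "\<bar>spow (?\<delta> x powr s - ?\<delta> (x + z) powr s) (p - 1)\<bar> \<le> norm z powr (s * (p - 1))"
            using spow_infdist_bound[of x "- \<Omega>" "x + z"] by (simp add: dist_norm)
          have "flat_error (?\<delta> x) (?\<delta> (x + z)) (z \<bullet> n) \<le> 2 * norm z powr (s * (p - 1))"
            unfolding flat_error_def using 1 2 by linarith
          then have "?E x n z \<le> 2 * norm z powr (s * (p - 1)) * kern (p * s) z"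
            by (intro mult_right_mono) auto
          also have "\<dots> = 2 * kern s z"
          proof -
            have "norm z powr (s * (p - 1)) * kern (p * s) z = kern s z"
              unfolding powr_add[symmetric] by (rule arg_cong[of _ _ "\<lambda>y. norm z powr y"]) (simp add: algebra_simps)
            then show ?thesis by (simp only: mult.assoc)
          qed
          finally have "ennreal (?E x n z) \<le> ennreal (2 * kern s z)" by (rule ennreal_leI)
          also have "\<dots> = 2 * ennreal (kern s z)" by (subst ennreal_mult) auto
          finally show ?thesis using False by simp
        qed simp
      qed
      also have "\<dots> = (\<integral>\<^sup>+z. ennreal (?E x n z) * indicator (cball 0 (R / 4)) z \<partial>lborel) + (\<integral>\<^sup>+z. 2 * (ennreal (kern s z) * indicator {z. R / 4 \<le> norm z} (z::'a)) \<partial>lborel)"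
      proof (rule nn_integral_add)
        show "(\<lambda>z. ennreal (?E x n z) * indicator (cball 0 (R / 4)) z) \<in> borel_measurable lborel"
          using mE[of x n] by (intro borel_measurable_times_ennreal measurable_compose[OF _ measurable_ennreal] borel_measurable_indicator) auto
      qed measurable
      also have "(\<integral>\<^sup>+z. 2 * (ennreal (kern s z) * indicator {z. R / 4 \<le> norm z} (z::'a)) \<partial>lborel)
         = 2 * (\<integral>\<^sup>+z. ennreal (kern s z) * indicator {z. R / 4 \<le> norm z} (z::'a) \<partial>lborel)"
        by (rule nn_integral_cmult) measurable
      also have "(\<integral>\<^sup>+z. ennreal (?E x n z) * indicator (cball 0 (R / 4)) z \<partial>lborel) + 2 * (\<integral>\<^sup>+z. ennreal (kern s z) * indicator {z. R / 4 \<le> norm z} (z::'a) \<partial>lborel)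
         \<le> ennreal C1 + 2 * ennreal (C2 * (R / 4) powr (- s))"
      proof (intro add_mono mult_left_mono)
        show "(\<integral>\<^sup>+z. ennreal (?E x n z) * indicator (cball 0 (R / 4)) z \<partial>lborel) \<le> ennreal C1"
          by (rule C1(2)[rule_format]) (use n \<delta>pos[OF x(1)] x R cfg in auto)
        show "(\<integral>\<^sup>+z. ennreal (kern s z) * indicator {z. R / 4 \<le> norm z} (z::'a) \<partial>lborel) \<le> ennreal (C2 * (R / 4) powr (- s))"
          by (rule C2(2)[rule_format]) (use R in simp)
      qed auto
      also have "\<dots> = ennreal (C1 + 2 * (C2 * (R / 4) powr (- s)))"
      proof -
        have "2 * ennreal y = ennreal (2 * y)" if "0 \<le> y" for y using that by (subst ennreal_mult) auto
        then show ?thesis using C1(1) C2(1) by (simp add: ennreal_plus[symmetric] del: ennreal_plus)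
      qed
      finally show "\<exists>n. norm n = 1 \<and> ball (x - (2 * ?\<delta> x) *\<^sub>R n) (?\<delta> x) \<inter> \<Omega> = {} \<and>
        (\<integral>\<^sup>+z. ennreal (?E x n z) \<partial>lborel) \<le> ennreal (C1 + 2 * (C2 * (R / 4) powr (- s)))"
        using n by blast
    qed
  qed
qed

text \<open>Half of the truncated fractional p-Laplacian of the s-th power of the distance, in the
  variable \<open>z = y - x\<close>; the factor 2 comes back from symmetrising the weak
  form.\<close>

definition truncated_op :: "'a::euclidean_space set \<Rightarrow> real \<Rightarrow> 'a \<Rightarrow> real" where
  "truncated_op \<Omega> \<epsilon> x = (\<integral>z. indicator {z. \<epsilon> < norm z} z *
     (spow (infdist x (- \<Omega>) powr s - infdist (x + z) (- \<Omega>) powr s) (p - 1) * kern (p * s) z) \<partial>lborel)"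

text \<open>The half-space part disappears in the limit, which is therefore the integral of the
  error alone and bounded. Before the limit that part costs
  \<open>infdist x (- \<Omega>) powr (- s)\<close>; the constant error bound is absorbed because the
  distance is at most 1.\<close>

theorem truncated_op_bounds:
  fixes \<Omega> :: "'a::euclidean_space set"
  assumes dom: "C11_domain \<Omega>"
  obtains R C where "0 < R" "R \<le> 1" "0 \<le> C"
    "\<forall>x\<in>\<Omega>. infdist x (- \<Omega>) \<le> R / 4 \<longrightarrow>
       (\<exists>n. norm n = 1 \<and> ball (x - (2 * infdist x (- \<Omega>)) *\<^sub>R n) (infdist x (- \<Omega>)) \<inter> \<Omega> = {}) \<and>
       (\<exists>l. (\<lambda>k. truncated_op \<Omega> (1 / real (Suc k)) x) \<longlonglongrightarrow> l \<and> \<bar>l\<bar> \<le> C) \<and>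
       (\<forall>\<epsilon>>0. \<bar>truncated_op \<Omega> \<epsilon> x\<bar> \<le> C * infdist x (- \<Omega>) powr (- s))"
proof -
  let ?n = "real DIM('a)" let ?\<delta> = "\<lambda>x. infdist x (- \<Omega>)"
  obtain R C1 where R: "0 < R" "R \<le> 1" and C1: "0 \<le> C1"
    "\<forall>x\<in>\<Omega>. ?\<delta> x \<le> R / 4 \<longrightarrow>
       (\<exists>n. norm n = 1 \<and> ball (x - (2 * ?\<delta> x) *\<^sub>R n) (?\<delta> x) \<inter> \<Omega> = {} \<and>
        (\<integral>\<^sup>+z. ennreal (flat_error (?\<delta> x) (?\<delta> (x + z)) (z \<bullet> n) * kern (p * s) z) \<partial>lborel) \<le> ennreal C1)"
    by (rule curved_error_integral[OF dom])
  obtain C2 where C2: "0 \<le> C2"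
    "\<forall>(\<nu>::'a) d \<epsilon>. norm \<nu> = 1 \<longrightarrow> 0 < d \<longrightarrow> 0 < \<epsilon> \<longrightarrow>
      \<bar>\<integral>z. indicator {z. \<epsilon> < norm z} z * (flat_scaled s (p - 1) d (z \<bullet> \<nu>) * kern (p * s) z) \<partial>lborel\<bar> \<le> C2 * d powr (- s)"
    by (rule flat_truncated_bound[where 'a='a])
  have op: "open \<Omega>" and bd: "bounded \<Omega>" using dom unfolding C11_domain_def by auto
  have \<delta>pos: "0 < ?\<delta> x" if "x \<in> \<Omega>" for x by (rule infdist_complement_pos[OF op bd that])
  have [measurable]: "(\<lambda>z. ?\<delta> (x + z)) \<in> borel_measurable borel" for x
    by (intro borel_measurable_continuous_onI continuous_intros)
  show ?thesis
  proof (rule that[OF R, of "C1 + C2"])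
    show "0 \<le> C1 + C2" using C1 C2 by simp
    show "\<forall>x\<in>\<Omega>. ?\<delta> x \<le> R / 4 \<longrightarrow>
       (\<exists>n. norm n = 1 \<and> ball (x - (2 * ?\<delta> x) *\<^sub>R n) (?\<delta> x) \<inter> \<Omega> = {}) \<and>
       (\<exists>l. (\<lambda>k. truncated_op \<Omega> (1 / real (Suc k)) x) \<longlonglongrightarrow> l \<and> \<bar>l\<bar> \<le> C1 + C2) \<and>
       (\<forall>\<epsilon>>0. \<bar>truncated_op \<Omega> \<epsilon> x\<bar> \<le> (C1 + C2) * ?\<delta> x powr (- s))"
    proof (intro ballI impI)
      fix x assume x: "x \<in> \<Omega>" "?\<delta> x \<le> R / 4"
      obtain n where n: "norm n = 1" "ball (x - (2 * ?\<delta> x) *\<^sub>R n) (?\<delta> x) \<inter> \<Omega> = {}"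
        and err: "(\<integral>\<^sup>+z. ennreal (flat_error (?\<delta> x) (?\<delta> (x + z)) (z \<bullet> n) * kern (p * s) z) \<partial>lborel) \<le> ennreal C1"
        using C1(2) x by blast
      have d: "0 < ?\<delta> x" "?\<delta> x \<le> 1" using \<delta>pos x R by auto
      define w where "w z = kern (p * s) z" for z :: 'a
      have [measurable]: "w \<in> borel_measurable borel" unfolding w_def[abs_def] by measurable
      define E where "E z = (spow (?\<delta> x powr s - ?\<delta> (x + z) powr s) (p - 1) - flat_scaled s (p - 1) (?\<delta> x) (z \<bullet> n)) * w z" for z
      have mE [measurable]: "E \<in> borel_measurable borel" unfolding E_def[abs_def] by measurable
      have absE: "\<bar>E z\<bar> = flat_error (?\<delta> x) (?\<delta> (x + z)) (z \<bullet> n) * kern (p * s) z" for z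
        unfolding E_def flat_error_def w_def by (simp add: abs_mult)
      have nnE: "(\<integral>\<^sup>+z. ennreal \<bar>E z\<bar> \<partial>lborel) \<le> ennreal C1" unfolding absE by (rule err)
      have iE: "integrable lborel E"
        using nnE by (auto simp: integrable_iff_bounded intro: order_le_less_trans)
      have aE: "(\<integral>z. \<bar>E z\<bar> \<partial>lborel) \<le> C1"
        using nnE iE C1(1) by (subst integral_eq_nn_integral) (auto intro!: enn2real_leI)
      let ?G = "\<lambda>\<epsilon>. \<integral>z. indicator {z. \<epsilon> < norm z} z * (flat_scaled s (p - 1) (?\<delta> x) (z \<bullet> n) * kern (p * s) z) \<partial>lborel"
      let ?H = "\<lambda>\<epsilon>. \<integral>z. indicator {z. \<epsilon> < norm z} z * E z \<partial>lborel"
      have split: "truncated_op \<Omega> \<epsilon> x = ?H \<epsilon> + ?G \<epsilon>" if "0 < \<epsilon>" for \<epsilon>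
      proof -
        have iH: "integrable lborel (\<lambda>z. indicator {z. \<epsilon> < norm z} z * E z)"
          using integrable_real_mult_indicator[OF _ iE, of "{z. \<epsilon> < norm z}"] by (simp add: mult.commute)
        have "truncated_op \<Omega> \<epsilon> x = (\<integral>z. indicator {z. \<epsilon> < norm z} z * E z + indicator {z. \<epsilon> < norm z} z * (flat_scaled s (p - 1) (?\<delta> x) (z \<bullet> n) * kern (p * s) z) \<partial>lborel)"
          unfolding truncated_op_def E_def w_def by (intro Bochner_Integration.integral_cong refl) (simp add: algebra_simps)
        also have "\<dots> = ?H \<epsilon> + ?G \<epsilon>"
          by (rule Bochner_Integration.integral_add[OF iH flat_truncated_integrable[OF d(1) n(1) that]])
        finally show ?thesis .
      qed
      have "(\<lambda>k. ?H (1 / real (Suc k)) + ?G (1 / real (Suc k))) \<longlonglongrightarrow> (\<integral>z. E z \<partial>lborel) + 0"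
        by (intro tendsto_add truncated_integral_tendsto[OF iE] flat_truncated_tendsto_0[OF d(1) n(1)])
      moreover have "(\<lambda>k. truncated_op \<Omega> (1 / real (Suc k)) x) = (\<lambda>k. ?H (1 / real (Suc k)) + ?G (1 / real (Suc k)))"
        by (intro ext split) simp
      ultimately have lim: "(\<lambda>k. truncated_op \<Omega> (1 / real (Suc k)) x) \<longlonglongrightarrow> (\<integral>z. E z \<partial>lborel)" by (simp only: add_0_right)
      have "\<bar>\<integral>z. E z \<partial>lborel\<bar> \<le> C1" using integral_abs_bound[of lborel E] aE by linarith
      then have l: "\<bar>\<integral>z. E z \<partial>lborel\<bar> \<le> C1 + C2" using C2 by linarith
      have bnd: "\<bar>truncated_op \<Omega> \<epsilon> x\<bar> \<le> (C1 + C2) * ?\<delta> x powr (- s)" if \<epsilon>: "0 < \<epsilon>" for \<epsilon>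
      proof -
        have "\<bar>?H \<epsilon>\<bar> \<le> (\<integral>z. \<bar>indicator {z. \<epsilon> < norm z} z * E z\<bar> \<partial>lborel)" by (rule integral_abs_bound)
        also have "\<dots> \<le> (\<integral>z. \<bar>E z\<bar> \<partial>lborel)"
          by (rule integral_mono') (use iE in \<open>auto simp: indicator_def intro: integrable_abs\<close>)
        also note aE
        also have "C1 \<le> C1 * ?\<delta> x powr (- s)"
        proof -
          have "1 \<le> ?\<delta> x powr (- s)" using powr_mono2'[of "- s" "?\<delta> x" 1] d s by simp
          then show ?thesis using C1(1) mult_left_mono[of 1 "?\<delta> x powr (- s)" C1] by simp
        qed
        finally have H: "\<bar>?H \<epsilon>\<bar> \<le> C1 * ?\<delta> x powr (- s)" .
        have G: "\<bar>?G \<epsilon>\<bar> \<le> C2 * ?\<delta> x powr (- s)" using C2(2) n d \<epsilon> by blast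
        show ?thesis unfolding split[OF \<epsilon>] distrib_right using H G by linarith
      qed
      show "(\<exists>n. norm n = 1 \<and> ball (x - (2 * ?\<delta> x) *\<^sub>R n) (?\<delta> x) \<inter> \<Omega> = {}) \<and>
       (\<exists>l. (\<lambda>k. truncated_op \<Omega> (1 / real (Suc k)) x) \<longlonglongrightarrow> l \<and> \<bar>l\<bar> \<le> C1 + C2) \<and>
       (\<forall>\<epsilon>>0. \<bar>truncated_op \<Omega> \<epsilon> x\<bar> \<le> (C1 + C2) * ?\<delta> x powr (- s))"
        using n lim l bnd by blast
    qed
  qed
qed

end

section \<open>The weak formulation\<close>

context exponents
begin

lemma truncated_op_meas: "truncated_op \<Omega> \<epsilon> \<in> borel_measurable (borel :: 'a::euclidean_space measure)"
proof -
  have [measurable]: "(\<lambda>x. infdist x (- \<Omega>)) \<in> borel_measurable borel"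
    by (intro borel_measurable_continuous_onI continuous_intros)
  show ?thesis unfolding truncated_op_def[abs_def] indicator_def by measurable
qed

text \<open>At points of divergence \<open>lim\<close> takes one unspecified fixed value, so the
  function is Borel on the whole space.\<close>

lemma truncated_op_lim_meas:
  "(\<lambda>x. lim (\<lambda>k. truncated_op \<Omega> (1 / real (Suc k)) x)) \<in> borel_measurable (borel :: 'a::euclidean_space measure)"
  by (rule borel_measurable_lim_metric) (rule truncated_op_meas)

end

text \<open>The geometry enters only through exterior balls, convergence and the weighted bound. The
  test function is a Borel representative that vanishes at every point off the strip, not merely
  almost everywhere.\<close>

locale test_function = exponents +
  fixes \<Omega> :: "'a::euclidean_space set" and \<rho> C :: real and \<psi> :: "'a \<Rightarrow> real"
  assumes op: "open \<Omega>" and bd: "bounded \<Omega>" and C: "0 \<le> C"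
    and ext: "\<forall>x\<in>\<Omega>. infdist x (- \<Omega>) < \<rho> \<longrightarrow> (\<exists>n. norm n = 1 \<and> ball (x - (2 * infdist x (- \<Omega>)) *\<^sub>R n) (infdist x (- \<Omega>)) \<inter> \<Omega> = {})"
    and lim: "\<forall>x\<in>\<Omega>. infdist x (- \<Omega>) < \<rho> \<longrightarrow> (\<exists>l. (\<lambda>k. truncated_op \<Omega> (1 / real (Suc k)) x) \<longlonglongrightarrow> l)"
    and bounds: "\<forall>x\<in>\<Omega>. infdist x (- \<Omega>) < \<rho> \<longrightarrow> (\<forall>\<epsilon>>0. \<bar>truncated_op \<Omega> \<epsilon> x\<bar> \<le> C * infdist x (- \<Omega>) powr (- s))"
    and \<psi>_meas [measurable]: "\<psi> \<in> borel_measurable borel"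
    and supp: "\<And>x. \<psi> x \<noteq> 0 \<Longrightarrow> x \<in> \<Omega> \<and> infdist x (- \<Omega>) < \<rho>"
    and Lp: "(\<integral>\<^sup>+x. ennreal (\<bar>\<psi> x\<bar> powr p) \<partial>lborel) < \<infinity>"
    and seminorm: "(\<integral>\<^sup>+x. \<integral>\<^sup>+y. ennreal (\<bar>\<psi> x - \<psi> y\<bar> powr p * kern (p * s) (y - x)) \<partial>lborel \<partial>lborel) < \<infinity>"
begin

definition dl :: "'a \<Rightarrow> real" where "dl x = infdist x (- \<Omega>)"

lemma dl_meas [measurable]: "dl \<in> borel_measurable borel"
  unfolding dl_def[abs_def] by (intro borel_measurable_continuous_onI continuous_intros)

lemma dl_nonneg: "0 \<le> dl x"
  by (simp add: dl_def infdist_nonneg)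

lemma dl_pos: "x \<in> \<Omega> \<Longrightarrow> 0 < dl x"
  unfolding dl_def by (rule infdist_complement_pos[OF op bd])

lemma dl_outside: "x \<notin> \<Omega> \<Longrightarrow> dl x = 0"
  by (simp add: dl_def)

lemma dl_lipschitz: "\<bar>dl x - dl y\<bar> \<le> norm (y - x)"
  using infdist_triangle_abs[of x "- \<Omega>" y] by (simp add: dl_def dist_norm norm_minus_commute)

lemma domain_finite: "emeasure lborel \<Omega> < \<infinity>"
  using emeasure_bounded_finite[OF bd] .

lemma domain_sets [measurable]: "\<Omega> \<in> sets borel"
  using op by simp

lemma supp_pos: "\<psi> x \<noteq> 0 \<Longrightarrow> 0 < dl x"
  using supp dl_pos by blast

lemma le_one_plus_powr: "0 \<le> (t::real) \<Longrightarrow> t \<le> 1 + t powr p"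
proof (cases "t \<le> 1")
  case False
  then have "t powr 1 \<le> t powr p" using p by (intro powr_mono) auto
  then show ?thesis using False by simp
qed (simp add: add_increasing2)

lemma integrable_test: "integrable lborel \<psi>"
proof -
  have "(\<integral>\<^sup>+x. ennreal (norm (\<psi> x)) \<partial>lborel) \<le> (\<integral>\<^sup>+x. indicator \<Omega> x + ennreal (\<bar>\<psi> x\<bar> powr p) \<partial>lborel)"
  proof (rule nn_integral_mono)
    fix x
    show "ennreal (norm (\<psi> x)) \<le> indicator \<Omega> x + ennreal (\<bar>\<psi> x\<bar> powr p)"
    proof (cases "\<psi> x = 0")
      case False
      have "ennreal \<bar>\<psi> x\<bar> \<le> ennreal (1 + \<bar>\<psi> x\<bar> powr p)" by (intro ennreal_leI le_one_plus_powr) simp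
      then show ?thesis using supp[OF False] by simp
    qed simp
  qed
  also have "\<dots> = emeasure lborel \<Omega> + (\<integral>\<^sup>+x. ennreal (\<bar>\<psi> x\<bar> powr p) \<partial>lborel)"
    by (subst nn_integral_add) auto
  also have "\<dots> < \<infinity>" using domain_finite Lp by simp
  finally show ?thesis by (simp add: integrable_iff_bounded)
qed

text \<open>The exterior ball provides, at scale \<open>dl x\<close>, a set of points of measure comparable to \<open>dl x ^ n\<close> on which the
  test function vanishes.\<close>

lemma hardy: "(\<integral>\<^sup>+x. ennreal (\<bar>\<psi> x\<bar> powr p * dl x powr (- (p * s))) \<partial>lborel) < \<infinity>"
proof -
  let ?n = "real DIM('a)" let ?e = "- (real DIM('a) + p * s)"
  \<comment> \<open>All points of the exterior ball are within \<open>3 * dl x\<close> of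
    \<open>x\<close>; \<open>c\<close> is the unit ball volume times the matching power of
    3.\<close>
  define c where "c = unit_ball_vol ?n * 3 powr ?e"
  have c: "0 < c" unfolding c_def by simp
  have pt: "ennreal c * ennreal (\<bar>\<psi> x\<bar> powr p * dl x powr (- (p * s)))
     \<le> (\<integral>\<^sup>+y. ennreal (\<bar>\<psi> x - \<psi> y\<bar> powr p * norm (y - x) powr ?e) \<partial>lborel)" for x
  proof (cases "\<psi> x = 0")
    case False
    have x: "x \<in> \<Omega>" "dl x < \<rho>" "0 < dl x" using supp[OF False] supp_pos[OF False] by (auto simp: dl_def)
    obtain n where n: "norm n = 1" "ball (x - (2 * dl x) *\<^sub>R n) (dl x) \<inter> \<Omega> = {}"
      using ext x unfolding dl_def by blast
    let ?B = "ball (x - (2 * dl x) *\<^sub>R n) (dl x)"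
    have le: "ennreal (\<bar>\<psi> x\<bar> powr p * (3 * dl x) powr ?e) * indicator ?B y
        \<le> ennreal (\<bar>\<psi> x - \<psi> y\<bar> powr p * norm (y - x) powr ?e)" for y
    proof (cases "y \<in> ?B")
      case True
      have "y \<notin> \<Omega>" using True n by blast
      then have \<psi>y: "\<psi> y = 0" using supp[of y] by blast
      have yx: "y \<noteq> x" using \<open>y \<notin> \<Omega>\<close> x by blast
      have "norm (y - x) \<le> norm (y - (x - (2 * dl x) *\<^sub>R n)) + norm ((x - (2 * dl x) *\<^sub>R n) - x)"
        by (metis diff_add_cancel add_diff_eq norm_triangle_ineq)
      also have "\<dots> \<le> dl x + 2 * dl x"
        using True n x by (intro add_mono) (auto simp: dist_norm norm_minus_commute)
      finally have "norm (y - x) \<le> 3 * dl x" by simp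
      then have "(3 * dl x) powr ?e \<le> norm (y - x) powr ?e"
        using yx ps_pos by (intro powr_mono2') auto
      then have "\<bar>\<psi> x\<bar> powr p * (3 * dl x) powr ?e \<le> \<bar>\<psi> x - \<psi> y\<bar> powr p * norm (y - x) powr ?e"
        unfolding \<psi>y diff_zero by (intro mult_left_mono) auto
      then show ?thesis using True by (simp add: ennreal_leI)
    qed simp
    have "dl x powr ?n * (3 * dl x) powr ?e = 3 powr ?e * dl x powr (- (p * s))"
    proof -
      have "dl x powr ?n * dl x powr ?e = dl x powr (- (p * s))" unfolding powr_add[symmetric] by simp
      then show ?thesis using x by (simp add: powr_mult)
    qed
    then have "ennreal c * ennreal (\<bar>\<psi> x\<bar> powr p * dl x powr (- (p * s)))
      = ennreal (\<bar>\<psi> x\<bar> powr p * (3 * dl x) powr ?e * (unit_ball_vol ?n * dl x powr ?n))"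
      using c unfolding c_def by (subst ennreal_mult[symmetric]) (auto simp: mult_ac)
    also have "\<dots> = ennreal (\<bar>\<psi> x\<bar> powr p * (3 * dl x) powr ?e) * emeasure lborel ?B"
      using x by (subst emeasure_ball) (auto simp: ennreal_mult powr_realpow)
    also have "\<dots> = (\<integral>\<^sup>+y. ennreal (\<bar>\<psi> x\<bar> powr p * (3 * dl x) powr ?e) * indicator ?B y \<partial>lborel)"
      by (subst nn_integral_cmult_indicator) auto
    also have "\<dots> \<le> (\<integral>\<^sup>+y. ennreal (\<bar>\<psi> x - \<psi> y\<bar> powr p * norm (y - x) powr ?e) \<partial>lborel)"
      by (rule nn_integral_mono) (rule le)
    finally show ?thesis .
  qed (use p in simp)
  have "ennreal c * (\<integral>\<^sup>+x. ennreal (\<bar>\<psi> x\<bar> powr p * dl x powr (- (p * s))) \<partial>lborel)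
     = (\<integral>\<^sup>+x. ennreal c * ennreal (\<bar>\<psi> x\<bar> powr p * dl x powr (- (p * s))) \<partial>lborel)"
    by (rule nn_integral_cmult[symmetric]) measurable
  also have "\<dots> \<le> (\<integral>\<^sup>+x. \<integral>\<^sup>+y. ennreal (\<bar>\<psi> x - \<psi> y\<bar> powr p * norm (y - x) powr ?e) \<partial>lborel \<partial>lborel)"
    by (rule nn_integral_mono) (rule pt)
  also have "\<dots> < \<infinity>" by (rule seminorm)
  finally show ?thesis using c by (auto simp: ennreal_mult_less_top)
qed

text \<open>The inequality \<open>t \<le> 1 + t powr p\<close> passes from the p-th power to the
  first one, at the cost of the finite measure of \<open>\<Omega>\<close>.\<close>

lemma hardy_L1: "integrable lborel (\<lambda>x. \<psi> x * dl x powr (- s))"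
proof -
  have "(\<integral>\<^sup>+x. ennreal (norm (\<psi> x * dl x powr (- s))) \<partial>lborel)
    \<le> (\<integral>\<^sup>+x. indicator \<Omega> x + ennreal (\<bar>\<psi> x\<bar> powr p * dl x powr (- (p * s))) \<partial>lborel)"
  proof (rule nn_integral_mono)
    fix x
    show "ennreal (norm (\<psi> x * dl x powr (- s))) \<le> indicator \<Omega> x + ennreal (\<bar>\<psi> x\<bar> powr p * dl x powr (- (p * s)))"
    proof (cases "\<psi> x = 0")
      case False
      have "\<bar>\<psi> x * dl x powr (- s)\<bar> powr p = \<bar>\<psi> x\<bar> powr p * dl x powr (- (p * s))"
        by (simp add: abs_mult powr_mult powr_powr mult.commute)
      then have "ennreal \<bar>\<psi> x * dl x powr (- s)\<bar> \<le> ennreal (1 + \<bar>\<psi> x\<bar> powr p * dl x powr (- (p * s)))"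
        using le_one_plus_powr[of "\<bar>\<psi> x * dl x powr (- s)\<bar>"] by (intro ennreal_leI) simp
      then show ?thesis using supp[OF False] by simp
    qed simp
  qed
  also have "\<dots> = emeasure lborel \<Omega> + (\<integral>\<^sup>+x. ennreal (\<bar>\<psi> x\<bar> powr p * dl x powr (- (p * s))) \<partial>lborel)"
    by (subst nn_integral_add) auto
  also have "\<dots> < \<infinity>" using domain_finite hardy by simp
  finally show ?thesis by (simp add: integrable_iff_bounded)
qed

section \<open>Absolute integrability of the bilinear form\<close>

definition jump :: "'a \<Rightarrow> 'a \<Rightarrow> real" where
  "jump x y = spow (dl x powr s - dl y powr s) (p - 1)"

definition ker :: "'a \<Rightarrow> 'a \<Rightarrow> real" where
  "ker x y = kern (p * s) (y - x)"

definition form :: "'a \<times> 'a \<Rightarrow> real" where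
  "form = (\<lambda>(x, y). jump x y * (\<psi> x - \<psi> y) * ker x y)"

lemma jump_meas [measurable]:
  "f \<in> borel_measurable M \<Longrightarrow> g \<in> borel_measurable M \<Longrightarrow> (\<lambda>x. jump (f x) (g x)) \<in> borel_measurable M"
proof -
  assume f: "f \<in> borel_measurable M" and g: "g \<in> borel_measurable M"
  have [measurable]: "(\<lambda>x. dl (f x)) \<in> borel_measurable M" "(\<lambda>x. dl (g x)) \<in> borel_measurable M"
    using measurable_compose[OF f dl_meas] measurable_compose[OF g dl_meas] .
  show ?thesis unfolding jump_def by measurable
qed

lemma ker_meas [measurable]:
  "f \<in> borel_measurable M \<Longrightarrow> g \<in> borel_measurable M \<Longrightarrow> (\<lambda>x. ker (f x) (g x)) \<in> borel_measurable M"
  unfolding ker_def by measurable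

lemma form_meas [measurable]: "form \<in> borel_measurable (lborel \<Otimes>\<^sub>M lborel)"
  unfolding form_def split_beta' by measurable

lemma ker_nonneg: "0 \<le> ker x y"
  by (simp add: ker_def)

lemma ker_sym: "ker x y = ker y x"
  by (simp add: ker_def norm_minus_commute)

lemma jump_antisym: "jump y x = - jump x y"
  unfolding jump_def using spow_minus[of "dl x powr s - dl y powr s" "p - 1"] by simp

lemma abs_jump_le: "\<bar>jump x y\<bar> \<le> norm (y - x) powr (s * (p - 1))"
  using spow_infdist_bound[of x "- \<Omega>" y] unfolding jump_def dl_def by (simp add: dist_norm norm_minus_commute)

lemma jump_ker_le: "\<bar>jump x y\<bar> * ker x y \<le> kern s (y - x)"
proof -
  have "\<bar>jump x y\<bar> * ker x y \<le> norm (y - x) powr (s * (p - 1)) * ker x y"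
    by (intro mult_right_mono abs_jump_le ker_nonneg)
  also have "\<dots> = kern s (y - x)"
    unfolding ker_def powr_add[symmetric] by (rule arg_cong[of _ _ "\<lambda>e. norm (y - x) powr e"]) (simp add: algebra_simps)
  finally show ?thesis .
qed

lemma abs_jump_eq: "\<bar>jump x y\<bar> = \<bar>dl x powr s - dl y powr s\<bar> powr (p - 1)"
  by (simp add: jump_def abs_spow)

text \<open>What the tangent estimate leaves of the p-th power of the difference times
  \<open>ker\<close>, on the ball where the slope at \<open>x\<close> is of order
  \<open>dl x powr (s - 1)\<close>.\<close>

definition inner_part :: "'a \<Rightarrow> 'a \<Rightarrow> real" where
  "inner_part x y = indicator {w. norm (w - x) < dl x} y * (dl x powr ((s - 1) * p) * norm (y - x) powr ((p - p * s) - real DIM('a)))"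

text \<open>The share of \<open>\<psi> x\<close> away from that ball, after Hoelder continuity has
  replaced \<open>jump\<close> times \<open>ker\<close> by \<open>kern s\<close>.\<close>

definition outer_part :: "'a \<Rightarrow> 'a \<Rightarrow> real" where
  "outer_part x y = \<bar>\<psi> x\<bar> * (indicator {w. dl x \<le> norm (w - x)} y * kern s (y - x))"

lemma parts_nonneg: "0 \<le> inner_part x y" "0 \<le> outer_part x y"
  by (simp_all add: inner_part_def outer_part_def)

lemma parts_meas:
  "(\<lambda>(x, y). inner_part x y) \<in> borel_measurable (lborel \<Otimes>\<^sub>M lborel)"
  "(\<lambda>(x, y). outer_part x y) \<in> borel_measurable (lborel \<Otimes>\<^sub>M lborel)"
  unfolding inner_part_def outer_part_def split_beta' indicator_def by measurable

lemma powr_diff_le_inner_part: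
  assumes "norm (y - x) < dl x"
  shows "\<bar>dl x powr s - dl y powr s\<bar> powr p * ker x y \<le> inner_part x y"
proof -
  have d: "0 < dl x" using assms norm_ge_zero[of "y - x"] by linarith
  have "\<bar>dl x powr s - dl y powr s\<bar> \<le> \<bar>dl y - dl x\<bar> * dl x powr (s - 1)"
    using abs_powr_diff_le_tangent[of s "dl y" "dl x"] s d dl_nonneg[of y] by (simp add: abs_minus_commute)
  also have "\<dots> \<le> norm (y - x) * dl x powr (s - 1)"
    using dl_lipschitz[of y x] by (intro mult_right_mono) (auto simp: norm_minus_commute)
  finally have "\<bar>dl x powr s - dl y powr s\<bar> powr p \<le> (norm (y - x) * dl x powr (s - 1)) powr p"
    using p by (intro powr_mono2) auto
  also have "\<dots> = dl x powr ((s - 1) * p) * norm (y - x) powr p"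
    by (simp add: powr_mult powr_powr mult.commute)
  finally have "\<bar>dl x powr s - dl y powr s\<bar> powr p * ker x y \<le> dl x powr ((s - 1) * p) * norm (y - x) powr p * ker x y"
    by (intro mult_right_mono ker_nonneg)
  also have "\<dots> = dl x powr ((s - 1) * p) * (norm (y - x) powr p * ker x y)" by (rule mult.assoc)
  also have "norm (y - x) powr p * ker x y = norm (y - x) powr ((p - p * s) - real DIM('a))"
    unfolding ker_def powr_add[symmetric] by (rule arg_cong[of _ _ "\<lambda>e. norm (y - x) powr e"]) simp
  finally show ?thesis using assms unfolding inner_part_def by simp
qed

lemma young_powr:
  fixes a b :: real
  assumes "0 \<le> a" "0 \<le> b"
  shows "a powr (p - 1) * b \<le> a powr p + b powr p"
proof -
  have pw: "t powr p = t powr (p - 1) * t" if "0 \<le> t" for t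
    using that by (cases "t = 0") (auto simp: powr_diff)
  show ?thesis
  proof (cases "b \<le> a")
    case True
    then have "a powr (p - 1) * b \<le> a powr p" unfolding pw[OF assms(1)] by (intro mult_left_mono) auto
    then show ?thesis by (simp add: add_increasing2)
  next
    case False
    then have "a powr (p - 1) * b \<le> b powr p" unfolding pw[OF assms(2)]
      using assms p by (intro mult_right_mono powr_mono2) auto
    then show ?thesis by (simp add: add_increasing)
  qed
qed

text \<open>Close to the diagonal, relative to the distance to the boundary, Young's inequality suffices. Elsewhere the
  difference of the test function is split and each half is controlled by the Hardy inequality.\<close>

lemma form_bound:
  "\<bar>form (x, y)\<bar> \<le> \<bar>\<psi> x - \<psi> y\<bar> powr p * ker x y + inner_part x y + inner_part y x + outer_part x y + outer_part y x"
proof -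
  have f: "\<bar>form (x, y)\<bar> = \<bar>jump x y\<bar> * \<bar>\<psi> x - \<psi> y\<bar> * ker x y"
    unfolding form_def by (simp add: abs_mult ker_nonneg)
  have nn: "0 \<le> \<bar>\<psi> x - \<psi> y\<bar> powr p * ker x y" by (simp add: ker_nonneg)
  show ?thesis
  proof (cases "norm (y - x) < dl x \<or> norm (y - x) < dl y")
    case True
    have "\<bar>jump x y\<bar> * \<bar>\<psi> x - \<psi> y\<bar> \<le> \<bar>dl x powr s - dl y powr s\<bar> powr p + \<bar>\<psi> x - \<psi> y\<bar> powr p"
      unfolding abs_jump_eq by (intro young_powr) auto
    then have "\<bar>form (x, y)\<bar> \<le> (\<bar>dl x powr s - dl y powr s\<bar> powr p + \<bar>\<psi> x - \<psi> y\<bar> powr p) * ker x y"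
      unfolding f by (intro mult_right_mono ker_nonneg)
    also have "\<dots> = \<bar>dl x powr s - dl y powr s\<bar> powr p * ker x y + \<bar>\<psi> x - \<psi> y\<bar> powr p * ker x y"
      by (rule distrib_right)
    also have "\<bar>dl x powr s - dl y powr s\<bar> powr p * ker x y \<le> inner_part x y + inner_part y x"
      using True
    proof
      assume "norm (y - x) < dl x"
      from powr_diff_le_inner_part[OF this] show ?thesis using parts_nonneg(1)[of y x] by linarith
    next
      assume "norm (y - x) < dl y"
      then have "norm (x - y) < dl y" by (simp add: norm_minus_commute)
      from powr_diff_le_inner_part[OF this] have "\<bar>dl x powr s - dl y powr s\<bar> powr p * ker x y \<le> inner_part y x"
        by (simp add: ker_sym[of y x] abs_minus_commute)
      then show ?thesis using parts_nonneg(1)[of x y] by linarith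
    qed
    finally show ?thesis using parts_nonneg(2)[of x y] parts_nonneg(2)[of y x] by linarith
  next
    case False
    have "\<bar>form (x, y)\<bar> = \<bar>\<psi> x - \<psi> y\<bar> * (\<bar>jump x y\<bar> * ker x y)" unfolding f by simp
    also have "\<dots> \<le> (\<bar>\<psi> x\<bar> + \<bar>\<psi> y\<bar>) * kern s (y - x)"
      by (intro mult_mono jump_ker_le) (auto simp: ker_nonneg)
    also have "\<dots> = outer_part x y + outer_part y x"
      using False unfolding outer_part_def by (simp add: distrib_right norm_minus_commute not_less)
    finally show ?thesis using parts_nonneg(1)[of x y] parts_nonneg(1)[of y x] nn by linarith
  qed
qed

text \<open>The integral over the ball of radius \<open>dl x\<close> is scale invariant: the
  exponents \<open>(s - 1) * p\<close> and \<open>p - p * s\<close> of \<open>dl x\<close> cancel. A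
  constant remains, integrated over a set of finite measure.\<close>

lemma inner_part_finite: "(\<integral>\<^sup>+x. \<integral>\<^sup>+y. ennreal (inner_part x y) \<partial>lborel \<partial>lborel) < \<infinity>"
proof -
  have b: "0 < p - p * s" using s p by simp
  obtain K where K: "0 \<le> K" "\<forall>r>0. (\<integral>\<^sup>+z. ennreal (norm z powr ((p - p * s) - real DIM('a))) * indicator {z. norm z < r} (z::'a) \<partial>lborel) \<le> ennreal (K * r powr (p - p * s))"
    by (rule nn_integral_norm_powr_inside[where 'a='a, OF b])
  have "(\<integral>\<^sup>+x. \<integral>\<^sup>+y. ennreal (inner_part x y) \<partial>lborel \<partial>lborel) \<le> (\<integral>\<^sup>+x. ennreal K * indicator \<Omega> x \<partial>lborel)"
  proof (rule nn_integral_mono)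
    fix x
    show "(\<integral>\<^sup>+y. ennreal (inner_part x y) \<partial>lborel) \<le> ennreal K * indicator \<Omega> x"
    proof (cases "x \<in> \<Omega>")
      case True
      note d = dl_pos[OF True]
      have "(\<integral>\<^sup>+y. ennreal (inner_part x y) \<partial>lborel) = (\<integral>\<^sup>+z. ennreal (inner_part x (x + z)) \<partial>lborel)"
        by (rule nn_integral_lborel_translate[symmetric]) (simp add: inner_part_def indicator_def, measurable)
      also have "\<dots> = (\<integral>\<^sup>+z. ennreal (dl x powr ((s - 1) * p)) * (ennreal (norm z powr ((p - p * s) - real DIM('a))) * indicator {z. norm z < dl x} (z::'a)) \<partial>lborel)"
        by (intro nn_integral_cong) (auto simp: inner_part_def indicator_def ennreal_mult)
      also have "\<dots> = ennreal (dl x powr ((s - 1) * p)) * (\<integral>\<^sup>+z. (ennreal (norm z powr ((p - p * s) - real DIM('a))) * indicator {z. norm z < dl x} (z::'a)) \<partial>lborel)"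
        by (rule nn_integral_cmult) measurable
      also have "\<dots> \<le> ennreal (dl x powr ((s - 1) * p)) * ennreal (K * dl x powr (p - p * s))"
        using K(2) d by (intro mult_left_mono) auto
      also have "\<dots> = ennreal (K * (dl x powr ((s - 1) * p) * dl x powr (p - p * s)))"
        using K(1) by (subst ennreal_mult[symmetric]) (auto simp: mult_ac)
      also have "dl x powr ((s - 1) * p) * dl x powr (p - p * s) = dl x powr 0"
        unfolding powr_add[symmetric] by (rule arg_cong[of _ _ "\<lambda>e. dl x powr e"]) (simp add: algebra_simps)
      finally show ?thesis using True d by simp
    next
      case False
      then have "inner_part x y = 0" for y unfolding inner_part_def by (simp add: dl_outside indicator_def)
      then show ?thesis by simp
    qed
  qed
  also have "\<dots> = ennreal K * emeasure lborel \<Omega>" by (rule nn_integral_cmult_indicator) simp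
  also have "\<dots> < \<infinity>" using domain_finite by (simp add: ennreal_mult_less_top)
  finally show ?thesis .
qed

text \<open>The tail of \<open>kern s\<close> beyond \<open>dl x\<close> is of order
  \<open>dl x powr (- s)\<close>, which is the weight of \<open>hardy_L1\<close>.\<close>

lemma outer_part_finite: "(\<integral>\<^sup>+x. \<integral>\<^sup>+y. ennreal (outer_part x y) \<partial>lborel \<partial>lborel) < \<infinity>"
proof -
  obtain K where K: "0 \<le> K" "\<forall>r>0. (\<integral>\<^sup>+z. ennreal (kern s z) * indicator {z. r \<le> norm z} (z::'a) \<partial>lborel) \<le> ennreal (K * r powr (- s))"
    by (rule nn_integral_norm_powr_outside[where 'a='a, OF s(1)])
  have "(\<integral>\<^sup>+x. \<integral>\<^sup>+y. ennreal (outer_part x y) \<partial>lborel \<partial>lborel) \<le> (\<integral>\<^sup>+x. ennreal K * ennreal (norm (\<psi> x * dl x powr (- s))) \<partial>lborel)"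
  proof (rule nn_integral_mono)
    fix x
    show "(\<integral>\<^sup>+y. ennreal (outer_part x y) \<partial>lborel) \<le> ennreal K * ennreal (norm (\<psi> x * dl x powr (- s)))"
    proof (cases "\<psi> x = 0")
      case False
      note d = supp_pos[OF False]
      have "(\<integral>\<^sup>+y. ennreal (outer_part x y) \<partial>lborel) = (\<integral>\<^sup>+z. ennreal (outer_part x (x + z)) \<partial>lborel)"
        by (rule nn_integral_lborel_translate[symmetric]) (simp add: outer_part_def indicator_def, measurable)
      also have "\<dots> = (\<integral>\<^sup>+z. ennreal \<bar>\<psi> x\<bar> * (ennreal (kern s z) * indicator {z. dl x \<le> norm z} (z::'a)) \<partial>lborel)"
        by (intro nn_integral_cong) (auto simp: outer_part_def indicator_def ennreal_mult)
      also have "\<dots> = ennreal \<bar>\<psi> x\<bar> * (\<integral>\<^sup>+z. ennreal (kern s z) * indicator {z. dl x \<le> norm z} (z::'a) \<partial>lborel)"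
        by (rule nn_integral_cmult) measurable
      also have "\<dots> \<le> ennreal \<bar>\<psi> x\<bar> * ennreal (K * dl x powr (- s))"
        using K(2) d by (intro mult_left_mono) auto
      also have "\<dots> = ennreal K * ennreal (norm (\<psi> x * dl x powr (- s)))"
        using K(1) by (simp add: ennreal_mult[symmetric] abs_mult mult_ac)
      finally show ?thesis .
    next
      case True
      then show ?thesis unfolding outer_part_def by simp
    qed
  qed
  also have "\<dots> = ennreal K * (\<integral>\<^sup>+x. ennreal (norm (\<psi> x * dl x powr (- s))) \<partial>lborel)" by (rule nn_integral_cmult) measurable
  also have "\<dots> < \<infinity>" using hardy_L1 by (simp add: ennreal_mult_less_top integrable_iff_bounded)
  finally show ?thesis .
qed

lemma form_integrable: "integrable (lborel \<Otimes>\<^sub>M lborel) form"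
proof -
  let ?P = "\<lambda>(x, y). ennreal (\<bar>\<psi> x - \<psi> y\<bar> powr p * ker x y)"
  let ?I = "\<lambda>(x, y). ennreal (inner_part x y)" let ?O = "\<lambda>(x, y). ennreal (outer_part x y)"
  let ?I' = "\<lambda>(x, y). ennreal (inner_part y x)" let ?O' = "\<lambda>(x, y). ennreal (outer_part y x)"
  let ?M = "lborel \<Otimes>\<^sub>M lborel :: ('a \<times> 'a) measure"
  have mP [measurable]: "?P \<in> borel_measurable ?M" unfolding split_beta' by measurable
  have mI [measurable]: "?I \<in> borel_measurable ?M" "?O \<in> borel_measurable ?M"
    using parts_meas by (auto simp: split_beta')
  have mI' [measurable]: "?I' \<in> borel_measurable ?M" "?O' \<in> borel_measurable ?M"
    using measurable_pair_swap[OF mI(1)] measurable_pair_swap[OF mI(2)] by (auto simp: split_beta')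
  have P: "(\<integral>\<^sup>+z. ?P z \<partial>?M) < \<infinity>"
    using seminorm lborel.nn_integral_fst[OF mP] unfolding ker_def by simp
  have I: "(\<integral>\<^sup>+z. ?I z \<partial>?M) < \<infinity>" "(\<integral>\<^sup>+z. ?O z \<partial>?M) < \<infinity>"
    using inner_part_finite outer_part_finite lborel.nn_integral_fst[OF mI(1)] lborel.nn_integral_fst[OF mI(2)] by simp_all
  have I': "(\<integral>\<^sup>+z. ?I' z \<partial>?M) < \<infinity>" "(\<integral>\<^sup>+z. ?O' z \<partial>?M) < \<infinity>"
    using inner_part_finite outer_part_finite lborel_pair.nn_integral_snd[OF mI'(1)] lborel_pair.nn_integral_snd[OF mI'(2)] by simp_all
  have "(\<integral>\<^sup>+z. ennreal (norm (form z)) \<partial>?M) \<le> (\<integral>\<^sup>+z. ?P z + ?I z + ?I' z + ?O z + ?O' z \<partial>?M)"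
  proof (rule nn_integral_mono, clarify)
    fix x y
    have "ennreal (norm (form (x, y))) \<le> ennreal (\<bar>\<psi> x - \<psi> y\<bar> powr p * ker x y + inner_part x y + inner_part y x + outer_part x y + outer_part y x)"
      using form_bound[of x y] by (intro ennreal_leI) simp
    also have "\<dots> = ennreal (\<bar>\<psi> x - \<psi> y\<bar> powr p * ker x y) + ennreal (inner_part x y) + ennreal (inner_part y x) + ennreal (outer_part x y) + ennreal (outer_part y x)"
      by (simp add: ennreal_plus parts_nonneg ker_nonneg add_nonneg_nonneg)
    finally show "ennreal (norm (form (x, y))) \<le> ennreal (\<bar>\<psi> x - \<psi> y\<bar> powr p * ker x y) + ennreal (inner_part x y) + ennreal (inner_part y x) + ennreal (outer_part x y) + ennreal (outer_part y x)" .
  qed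
  also have "\<dots> = (\<integral>\<^sup>+z. ?P z \<partial>?M) + (\<integral>\<^sup>+z. ?I z \<partial>?M) + (\<integral>\<^sup>+z. ?I' z \<partial>?M) + (\<integral>\<^sup>+z. ?O z \<partial>?M) + (\<integral>\<^sup>+z. ?O' z \<partial>?M)"
    using mP mI mI' by (simp only: nn_integral_add borel_measurable_add)
  also have "\<dots> < \<infinity>" using P I I' by simp
  finally show ?thesis using form_meas by (simp add: integrable_iff_bounded)
qed

text \<open>The part of the form carrying \<open>\<psi> x\<close>. Truncation is essential: near the
  diagonal, integrability may rest on the difference \<open>\<psi> x - \<psi> y\<close>, which this
  splitting destroys.\<close>

definition half_form :: "real \<Rightarrow> 'a \<times> 'a \<Rightarrow> real" where
  "half_form \<epsilon> = (\<lambda>(x, y). indicator {w. \<epsilon> < norm (w - x)} y * (\<psi> x * (jump x y * ker x y)))"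

lemma half_form_meas [measurable]: "half_form \<epsilon> \<in> borel_measurable (lborel \<Otimes>\<^sub>M lborel)"
  unfolding half_form_def split_beta' indicator_def by measurable

lemma half_form_integrable:
  assumes \<epsilon>: "0 < \<epsilon>"
  shows "integrable (lborel \<Otimes>\<^sub>M lborel) (half_form \<epsilon>)"
proof -
  obtain K where K: "0 \<le> K" "\<forall>r>0. (\<integral>\<^sup>+z. ennreal (kern s z) * indicator {z. r \<le> norm z} (z::'a) \<partial>lborel) \<le> ennreal (K * r powr (- s))"
    by (rule nn_integral_norm_powr_outside[where 'a='a, OF s(1)])
  have m: "(\<lambda>z. ennreal (norm (half_form \<epsilon> z))) \<in> borel_measurable (lborel \<Otimes>\<^sub>M lborel)" by measurable
  have "(\<integral>\<^sup>+z. ennreal (norm (half_form \<epsilon> z)) \<partial>(lborel \<Otimes>\<^sub>M lborel)) = (\<integral>\<^sup>+x. \<integral>\<^sup>+y. ennreal (norm (half_form \<epsilon> (x, y))) \<partial>lborel \<partial>lborel)"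
    by (rule lborel.nn_integral_fst[OF m, symmetric])
  also have "\<dots> \<le> (\<integral>\<^sup>+x. ennreal (K * \<epsilon> powr (- s)) * ennreal (norm (\<psi> x)) \<partial>lborel)"
  proof (rule nn_integral_mono)
    fix x
    let ?h = "\<lambda>y. ennreal \<bar>\<psi> x\<bar> * (ennreal (kern s (y - x)) * indicator {y. \<epsilon> \<le> norm (y - x)} y)"
    have "(\<integral>\<^sup>+y. ennreal (norm (half_form \<epsilon> (x, y))) \<partial>lborel) \<le> (\<integral>\<^sup>+y. ?h y \<partial>lborel)"
    proof (rule nn_integral_mono)
      fix y
      have "\<bar>\<psi> x * (jump x y * ker x y)\<bar> \<le> \<bar>\<psi> x\<bar> * kern s (y - x)"
        using jump_ker_le[of x y] by (simp add: abs_mult ker_nonneg mult_left_mono)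
      then have "ennreal \<bar>\<psi> x * (jump x y * ker x y)\<bar> \<le> ennreal \<bar>\<psi> x\<bar> * ennreal (kern s (y - x))"
        by (subst ennreal_mult[symmetric]) (auto intro: ennreal_leI)
      then show "ennreal (norm (half_form \<epsilon> (x, y))) \<le> ?h y"
        unfolding half_form_def by (auto simp: indicator_def)
    qed
    also have "\<dots> = (\<integral>\<^sup>+z. ?h (x + z) \<partial>lborel)"
      by (rule nn_integral_lborel_translate[symmetric]) (simp add: indicator_def, measurable)
    also have "\<dots> = (\<integral>\<^sup>+z. ennreal \<bar>\<psi> x\<bar> * (ennreal (kern s z) * indicator {z. \<epsilon> \<le> norm z} (z::'a)) \<partial>lborel)"
      by (intro nn_integral_cong) (simp add: indicator_def)
    also have "\<dots> = ennreal \<bar>\<psi> x\<bar> * (\<integral>\<^sup>+z. (ennreal (kern s z) * indicator {z. \<epsilon> \<le> norm z} (z::'a)) \<partial>lborel)"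
      by (rule nn_integral_cmult) measurable
    also have "\<dots> \<le> ennreal \<bar>\<psi> x\<bar> * ennreal (K * \<epsilon> powr (- s))" using K(2) \<epsilon> by (intro mult_left_mono) auto
    finally show "(\<integral>\<^sup>+y. ennreal (norm (half_form \<epsilon> (x, y))) \<partial>lborel) \<le> ennreal (K * \<epsilon> powr (- s)) * ennreal (norm (\<psi> x))"
      by (simp add: mult.commute)
  qed
  also have "\<dots> = ennreal (K * \<epsilon> powr (- s)) * (\<integral>\<^sup>+x. ennreal (norm (\<psi> x)) \<partial>lborel)" by (rule nn_integral_cmult) measurable
  also have "\<dots> < \<infinity>" using integrable_test by (simp add: ennreal_mult_less_top integrable_iff_bounded)
  finally show ?thesis by (simp add: integrable_iff_bounded)
qed

lemma half_form_integral:
  assumes \<epsilon>: "0 < \<epsilon>"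
  shows "integral\<^sup>L (lborel \<Otimes>\<^sub>M lborel) (half_form \<epsilon>) = (\<integral>x. \<psi> x * truncated_op \<Omega> \<epsilon> x \<partial>lborel)"
proof -
  have "integral\<^sup>L (lborel \<Otimes>\<^sub>M lborel) (half_form \<epsilon>) = (\<integral>x. \<integral>y. half_form \<epsilon> (x, y) \<partial>lborel \<partial>lborel)"
    by (rule lborel_pair.integral_fst'[OF half_form_integrable[OF \<epsilon>], symmetric])
  also have "\<dots> = (\<integral>x. \<psi> x * truncated_op \<Omega> \<epsilon> x \<partial>lborel)"
  proof (rule Bochner_Integration.integral_cong[OF refl])
    fix x
    have m: "(\<lambda>y. half_form \<epsilon> (x, y)) \<in> borel_measurable borel"
      unfolding half_form_def prod.case indicator_def by measurable
    have "(\<integral>y. half_form \<epsilon> (x, y) \<partial>lborel) = (\<integral>y. half_form \<epsilon> (x, y) \<partial>distr lborel borel ((+) x))"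
      by (simp add: lborel_distr_plus)
    also have "\<dots> = (\<integral>z. half_form \<epsilon> (x, x + z) \<partial>lborel)" by (rule integral_distr) (use m in auto)
    also have "\<dots> = (\<integral>z. \<psi> x * (indicator {z. \<epsilon> < norm z} z * (spow (infdist x (- \<Omega>) powr s - infdist (x + z) (- \<Omega>) powr s) (p - 1) * kern (p * s) z)) \<partial>lborel)"
      by (rule Bochner_Integration.integral_cong[OF refl]) (simp add: half_form_def jump_def ker_def dl_def indicator_def)
    also have "\<dots> = \<psi> x * truncated_op \<Omega> \<epsilon> x"
      unfolding truncated_op_def by (rule integral_mult_right_zero)
    finally show "(\<integral>y. half_form \<epsilon> (x, y) \<partial>lborel) = \<psi> x * truncated_op \<Omega> \<epsilon> x" .
  qed
  finally show ?thesis .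
qed

text \<open>\<open>jump\<close> is antisymmetric, while \<open>ker\<close> and the cutoff are
  symmetric, so swapping the coordinates turns the half with \<open>- \<psi> y\<close> into the half
  with \<open>\<psi> x\<close>. Hence the factor 2.\<close>

lemma truncated_form_integral:
  assumes \<epsilon>: "0 < \<epsilon>"
  shows "(\<integral>z. indicator {z. \<epsilon> < norm (snd z - fst z)} z * form z \<partial>(lborel \<Otimes>\<^sub>M lborel)) = 2 * (\<integral>x. \<psi> x * truncated_op \<Omega> \<epsilon> x \<partial>lborel)"
proof -
  let ?M = "lborel \<Otimes>\<^sub>M lborel :: ('a \<times> 'a) measure"
  have sw: "integrable ?M (\<lambda>(x, y). half_form \<epsilon> (y, x))"
    by (rule lborel_pair.integrable_product_swap[OF half_form_integrable[OF \<epsilon>]])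
  have "(\<integral>z. indicator {z. \<epsilon> < norm (snd z - fst z)} z * form z \<partial>?M) = (\<integral>z. half_form \<epsilon> z + (case z of (x, y) \<Rightarrow> half_form \<epsilon> (y, x)) \<partial>?M)"
  proof (rule Bochner_Integration.integral_cong[OF refl])
    fix z :: "'a \<times> 'a"
    obtain x y where z: "z = (x, y)" by (cases z) auto
    show "indicator {z. \<epsilon> < norm (snd z - fst z)} z * form z = half_form \<epsilon> z + (case z of (x, y) \<Rightarrow> half_form \<epsilon> (y, x))"
      unfolding z form_def half_form_def
      by (simp add: indicator_def norm_minus_commute[of x y] jump_antisym[of y x] ker_sym[of y x] algebra_simps)
  qed
  also have "\<dots> = integral\<^sup>L ?M (half_form \<epsilon>) + (\<integral>z. (case z of (x, y) \<Rightarrow> half_form \<epsilon> (y, x)) \<partial>?M)"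
    by (rule Bochner_Integration.integral_add[OF half_form_integrable[OF \<epsilon>] sw])
  also have "(\<integral>z. (case z of (x, y) \<Rightarrow> half_form \<epsilon> (y, x)) \<partial>?M) = integral\<^sup>L ?M (half_form \<epsilon>)"
    by (rule lborel_pair.integral_product_swap) measurable
  finally show ?thesis unfolding half_form_integral[OF \<epsilon>] by simp
qed

lemma truncated_form_tendsto:
  "(\<lambda>k. \<integral>z. indicator {z. 1 / real (Suc k) < norm (snd z - fst z)} z * form z \<partial>(lborel \<Otimes>\<^sub>M lborel)) \<longlonglongrightarrow> integral\<^sup>L (lborel \<Otimes>\<^sub>M lborel) form"
proof (rule integral_dominated_convergence[where w = "\<lambda>z. \<bar>form z\<bar>"])
  show "(\<lambda>z. indicator {z. 1 / real (Suc k) < norm (snd z - fst z)} z * form z) \<in> borel_measurable (lborel \<Otimes>\<^sub>M lborel)" for k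
    unfolding indicator_def by measurable
  show "AE z in lborel \<Otimes>\<^sub>M lborel. (\<lambda>k. indicator {z. 1 / real (Suc k) < norm (snd z - fst z)} z * form z) \<longlonglongrightarrow> form z"
  proof (rule AE_I2)
    fix z :: "'a \<times> 'a"
    obtain x y where z: "z = (x, y)" by (cases z) auto
    show "(\<lambda>k. indicator {z. 1 / real (Suc k) < norm (snd z - fst z)} z * form z) \<longlonglongrightarrow> form z"
    proof (cases "x = y")
      case True
      then show ?thesis unfolding z form_def by simp
    next
      case False
      then have "y - x \<noteq> 0" by simp
      from tendsto_mult[OF indicator_outside_tendsto_1[OF this] tendsto_const[of "form z"]]
      show ?thesis unfolding z by (simp add: indicator_def)
    qed
  qed
qed (use form_integrable in \<open>auto simp: indicator_def\<close>)

lemma weighted_op: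
  defines "L \<equiv> \<lambda>x. lim (\<lambda>k. truncated_op \<Omega> (1 / real (Suc k)) x)"
  shows "integrable lborel (\<lambda>x. \<psi> x * L x)"
    "(\<lambda>k. \<integral>x. \<psi> x * truncated_op \<Omega> (1 / real (Suc k)) x \<partial>lborel) \<longlonglongrightarrow> (\<integral>x. \<psi> x * L x \<partial>lborel)"
proof -
  have [measurable]: "L \<in> borel_measurable borel" "\<And>\<epsilon>. truncated_op \<Omega> \<epsilon> \<in> borel_measurable borel"
    unfolding L_def by (rule truncated_op_lim_meas truncated_op_meas)+
  have m1: "(\<lambda>x. \<psi> x * L x) \<in> borel_measurable lborel" by measurable
  have m2: "(\<lambda>x. \<psi> x * truncated_op \<Omega> (1 / real (Suc k)) x) \<in> borel_measurable lborel" for k by measurable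
  have w: "integrable lborel (\<lambda>x. C * \<bar>\<psi> x * dl x powr (- s)\<bar>)"
    by (intro integrable_mult_right integrable_abs hardy_L1)
  have conv: "AE x in lborel. (\<lambda>k. \<psi> x * truncated_op \<Omega> (1 / real (Suc k)) x) \<longlonglongrightarrow> \<psi> x * L x"
  proof (rule AE_I2)
    fix x
    show "(\<lambda>k. \<psi> x * truncated_op \<Omega> (1 / real (Suc k)) x) \<longlonglongrightarrow> \<psi> x * L x"
    \<comment> \<open>Off the support the limit defining \<open>L x\<close> may fail to exist, but
      both products are 0 there.\<close>
    proof (cases "\<psi> x = 0")
      case False
      then obtain l where "(\<lambda>k. truncated_op \<Omega> (1 / real (Suc k)) x) \<longlonglongrightarrow> l" using lim supp by blast
      then have "(\<lambda>k. truncated_op \<Omega> (1 / real (Suc k)) x) \<longlonglongrightarrow> L x" unfolding L_def by (simp only: limI)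
      then show ?thesis by (intro tendsto_mult tendsto_const)
    qed simp
  qed
  have bnd: "AE x in lborel. norm (\<psi> x * truncated_op \<Omega> (1 / real (Suc k)) x) \<le> C * \<bar>\<psi> x * dl x powr (- s)\<bar>" for k
  proof (rule AE_I2)
    fix x
    show "norm (\<psi> x * truncated_op \<Omega> (1 / real (Suc k)) x) \<le> C * \<bar>\<psi> x * dl x powr (- s)\<bar>"
    proof (cases "\<psi> x = 0")
      case False
      have "0 < 1 / real (Suc k)" by simp
      then have "\<bar>truncated_op \<Omega> (1 / real (Suc k)) x\<bar> \<le> C * dl x powr (- s)"
        using bounds supp[OF False] unfolding dl_def by blast
      then have "\<bar>\<psi> x\<bar> * \<bar>truncated_op \<Omega> (1 / real (Suc k)) x\<bar> \<le> \<bar>\<psi> x\<bar> * (C * dl x powr (- s))"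
        by (intro mult_left_mono) auto
      then show ?thesis by (simp add: abs_mult mult_ac)
    qed simp
  qed
  show "integrable lborel (\<lambda>x. \<psi> x * L x)"
    by (rule integrable_dominated_convergence[OF m1 m2 w conv bnd])
  show "(\<lambda>k. \<integral>x. \<psi> x * truncated_op \<Omega> (1 / real (Suc k)) x \<partial>lborel) \<longlonglongrightarrow> (\<integral>x. \<psi> x * L x \<partial>lborel)"
    by (rule integral_dominated_convergence[OF m1 m2 w conv bnd])
qed

theorem weak_identity:
  defines "L \<equiv> \<lambda>x. lim (\<lambda>k. truncated_op \<Omega> (1 / real (Suc k)) x)"
  shows "integral\<^sup>L (lborel \<Otimes>\<^sub>M lborel) form = (\<integral>x. (2 * L x) * \<psi> x \<partial>lborel)"
proof -
  have eq: "(\<integral>z. indicator {z. 1 / real (Suc k) < norm (snd z - fst z)} z * form z \<partial>(lborel \<Otimes>\<^sub>M lborel))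
     = 2 * (\<integral>x. \<psi> x * truncated_op \<Omega> (1 / real (Suc k)) x \<partial>lborel)" for k
    by (rule truncated_form_integral) simp
  have "(\<lambda>k. 2 * (\<integral>x. \<psi> x * truncated_op \<Omega> (1 / real (Suc k)) x \<partial>lborel)) \<longlonglongrightarrow> 2 * (\<integral>x. \<psi> x * L x \<partial>lborel)"
    unfolding L_def by (intro tendsto_mult tendsto_const weighted_op(2))
  with truncated_form_tendsto have "integral\<^sup>L (lborel \<Otimes>\<^sub>M lborel) form = 2 * (\<integral>x. \<psi> x * L x \<partial>lborel)"
    unfolding eq by (rule LIMSEQ_unique)
  also have "\<dots> = (\<integral>x. 2 * (\<psi> x * L x) \<partial>lborel)" by (rule integral_mult_right_zero[symmetric])
  also have "\<dots> = (\<integral>x. (2 * L x) * \<psi> x \<partial>lborel)" by (simp only: mult_ac)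
  finally show ?thesis .
qed

end

section \<open>From Lebesgue measurable functions to Borel representatives\<close>

lemma AE_eq_borel_lebesgue:
  fixes f g :: "'a::euclidean_space \<Rightarrow> real"
  assumes g: "g \<in> borel_measurable borel" and ae: "AE x in lborel. f x = g x"
  shows "integrable lebesgue f \<longleftrightarrow> integrable lborel g" "integral\<^sup>L lebesgue f = integral\<^sup>L lborel g"
proof -
  have g': "g \<in> borel_measurable lborel" using g by simp
  have gl: "g \<in> borel_measurable lebesgue" by (rule measurable_completion[OF g'])
  have ae': "AE x in lebesgue. g x = f x" using AE_completion[OF ae] by (simp add: eq_commute)
  have fl: "f \<in> borel_measurable lebesgue" by (rule borel_measurable_AE[OF gl ae'])
  show "integrable lebesgue f \<longleftrightarrow> integrable lborel g"
    using integrable_cong_AE[OF gl fl ae'] integrable_completion[OF g'] by simp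
  show "integral\<^sup>L lebesgue f = integral\<^sup>L lborel g"
    using integral_cong_AE[OF gl fl ae'] integral_completion[OF g'] by simp
qed

lemma AE_lborel_pair:
  assumes "AE x in (lborel :: 'a::euclidean_space measure). P x"
  shows "AE z in (lborel :: ('a \<times> 'a) measure). P (fst z) \<and> P (snd z)"
proof -
  obtain N where N: "N \<in> null_sets (lborel :: 'a measure)" "{x. \<not> P x} \<subseteq> N"
    using assms unfolding eventually_ae_filter by auto
  have "N \<times> UNIV \<union> UNIV \<times> N \<in> null_sets (lborel \<Otimes>\<^sub>M lborel :: ('a \<times> 'a) measure)"
    using N(1) by (intro null_sets.Un lborel.times_in_null_sets1 lborel.times_in_null_sets2) auto
  then have "N \<times> UNIV \<union> UNIV \<times> N \<in> null_sets (lborel :: ('a \<times> 'a) measure)" by (simp only: lborel_prod)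
  then show ?thesis by (rule AE_I') (use N(2) in auto)
qed

text \<open>On the diagonal both sides are 0, by the conventions for \<open>0 powr e\<close> and for
  division by 0, so the two forms of the kernel agree everywhere.\<close>

lemma divide_dist_powr: "a / dist x y powr e = a * norm (y - x) powr (- e)"
  by (simp add: powr_minus_divide dist_norm norm_minus_commute)

theorem theorem3p6:
  fixes \<Omega> :: "'a::euclidean_space set" and s p :: real
  assumes "0 < s" "s < 1" "1 < p"
    and "C11_domain \<Omega>"
  shows "\<exists>\<rho>>0. \<exists>f :: 'a \<Rightarrow> real.
           Linfty_on {x \<in> \<Omega>. infdist x (- \<Omega>) < \<rho>} f \<and>
           weak_solution s p (\<lambda>x. infdist x (- \<Omega>) powr s) f
             {x \<in> \<Omega>. infdist x (- \<Omega>) < \<rho>}"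
proof -
  interpret exponents s p by unfold_locales (use assms in auto)
  have op: "open \<Omega>" and bd: "bounded \<Omega>" using assms(4) unfolding C11_domain_def by auto
  obtain R C where R: "0 < R" "R \<le> 1" and C: "0 \<le> C" and main: "\<forall>x\<in>\<Omega>. infdist x (- \<Omega>) \<le> R / 4 \<longrightarrow>
       (\<exists>n. norm n = 1 \<and> ball (x - (2 * infdist x (- \<Omega>)) *\<^sub>R n) (infdist x (- \<Omega>)) \<inter> \<Omega> = {}) \<and>
       (\<exists>l. (\<lambda>k. truncated_op \<Omega> (1 / real (Suc k)) x) \<longlonglongrightarrow> l \<and> \<bar>l\<bar> \<le> C) \<and>
       (\<forall>\<epsilon>>0. \<bar>truncated_op \<Omega> \<epsilon> x\<bar> \<le> C * infdist x (- \<Omega>) powr (- s))"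
    by (rule truncated_op_bounds[OF assms(4)])
  define \<rho> where "\<rho> = R / 4"
  have \<rho>: "0 < \<rho>" unfolding \<rho>_def using R by simp
  have near: "infdist x (- \<Omega>) \<le> R / 4" if "infdist x (- \<Omega>) < \<rho>" for x using that unfolding \<rho>_def by simp
  have ext: "\<forall>x\<in>\<Omega>. infdist x (- \<Omega>) < \<rho> \<longrightarrow> (\<exists>n. norm n = 1 \<and> ball (x - (2 * infdist x (- \<Omega>)) *\<^sub>R n) (infdist x (- \<Omega>)) \<inter> \<Omega> = {})"
    using main near by blast
  have lim_bound: "\<exists>l. (\<lambda>k. truncated_op \<Omega> (1 / real (Suc k)) x) \<longlonglongrightarrow> l \<and> \<bar>l\<bar> \<le> C" if "x \<in> \<Omega>" "infdist x (- \<Omega>) < \<rho>" for x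
    using main near[OF that(2)] that(1) by blast
  have lim: "\<forall>x\<in>\<Omega>. infdist x (- \<Omega>) < \<rho> \<longrightarrow> (\<exists>l. (\<lambda>k. truncated_op \<Omega> (1 / real (Suc k)) x) \<longlonglongrightarrow> l)"
    using lim_bound by blast
  have bounds: "\<forall>x\<in>\<Omega>. infdist x (- \<Omega>) < \<rho> \<longrightarrow> (\<forall>\<epsilon>>0. \<bar>truncated_op \<Omega> \<epsilon> x\<bar> \<le> C * infdist x (- \<Omega>) powr (- s))"
    using main near by blast
  let ?U = "{x \<in> \<Omega>. infdist x (- \<Omega>) < \<rho>}"
  define L where "L x = lim (\<lambda>k. truncated_op \<Omega> (1 / real (Suc k)) x)" for x
  define f where "f x = 2 * L x" for x
  have L_meas [measurable]: "L \<in> borel_measurable borel" unfolding L_def[abs_def] by (rule truncated_op_lim_meas)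
  have f_meas [measurable]: "f \<in> borel_measurable borel" unfolding f_def[abs_def] by measurable
  have L_bound: "\<bar>L x\<bar> \<le> C" if x: "x \<in> ?U" for x
  proof -
    obtain l where "(\<lambda>k. truncated_op \<Omega> (1 / real (Suc k)) x) \<longlonglongrightarrow> l" "\<bar>l\<bar> \<le> C"
      using lim_bound x by blast
    then show ?thesis unfolding L_def by (simp only: limI)
  qed
  have "Linfty_on ?U f"
    unfolding Linfty_on_def
  proof
    have "f \<in> borel_measurable lebesgue" using f_meas by (intro measurable_completion) simp
    then show "f \<in> borel_measurable (restrict_space lebesgue ?U)" by (rule measurable_restrict_space1)
    show "\<exists>C. AE x in lebesgue. x \<in> ?U \<longrightarrow> \<bar>f x\<bar> \<le> C"
    proof (intro exI[of _ "2 * C"] AE_I2 impI)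
      fix x assume "x \<in> ?U"
      from L_bound[OF this] show "\<bar>f x\<bar> \<le> 2 * C" unfolding f_def by (simp add: abs_mult)
    qed
  qed
  moreover have "weak_solution s p (\<lambda>x. infdist x (- \<Omega>) powr s) f ?U"
    unfolding weak_solution_def Let_def
  proof (intro allI impI ballI)
    fix U' :: "'a set" and \<phi> :: "'a \<Rightarrow> real"
    assume U': "open U' \<and> bounded U' \<and> U' \<subseteq> ?U" and \<phi>: "\<phi> \<in> Wsp0 s p U'"
    let ?e = "real DIM('a) + p * s"
    have \<phi>m: "\<phi> \<in> borel_measurable lebesgue" and \<phi>p: "integrable lebesgue (\<lambda>x. \<bar>\<phi> x\<bar> powr p)"
      and \<phi>s: "integrable (lebesgue :: ('a \<times> 'a) measure) (\<lambda>(x, y). \<bar>\<phi> x - \<phi> y\<bar> powr p / dist x y powr ?e)"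
      and \<phi>0: "AE x in lebesgue. x \<notin> U' \<longrightarrow> \<phi> x = 0"
      using \<phi> unfolding Wsp0_def Wsp_def by auto
    obtain \<psi>0 where \<psi>0: "\<psi>0 \<in> borel_measurable lborel" "AE x in lborel. \<phi> x = \<psi>0 x"
      using completion_ex_borel_measurable_real[OF \<phi>m] by blast
    \<comment> \<open>The indicator makes the Borel representative vanish at every point outside
      \<open>U'\<close>; in particular it is exactly 0 on the exterior balls used for the Hardy
      inequality.\<close>
    define \<psi> where "\<psi> x = \<psi>0 x * indicator U' x" for x
    have [measurable]: "\<psi>0 \<in> borel_measurable borel" "U' \<in> sets borel" using \<psi>0 U' by auto
    have \<psi>m [measurable]: "\<psi> \<in> borel_measurable borel" unfolding \<psi>_def[abs_def] by measurable
    have "AE x in lborel. x \<notin> U' \<longrightarrow> \<phi> x = 0" using \<phi>0 by (simp only: AE_completion_iff)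
    with \<psi>0(2) have ae: "AE x in lborel. \<phi> x = \<psi> x"
      by eventually_elim (auto simp: \<psi>_def indicator_def)
    note ae2 = AE_lborel_pair[OF ae]
    have "integrable lborel (\<lambda>x. \<bar>\<psi> x\<bar> powr p)"
    proof (subst AE_eq_borel_lebesgue(1)[symmetric])
      show "AE x in lborel. \<bar>\<phi> x\<bar> powr p = \<bar>\<psi> x\<bar> powr p" using ae by eventually_elim simp
    qed (use \<phi>p in \<open>auto intro: \<phi>p\<close>)
    then have Lp: "(\<integral>\<^sup>+x. ennreal (\<bar>\<psi> x\<bar> powr p) \<partial>lborel) < \<infinity>" by (simp add: integrable_iff_bounded)
    let ?S = "\<lambda>z::'a \<times> 'a. \<bar>\<psi> (fst z) - \<psi> (snd z)\<bar> powr p * norm (snd z - fst z) powr (- ?e)"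
    have S_meas: "?S \<in> borel_measurable borel" unfolding borel_prod[symmetric] by measurable
    have "integrable lborel ?S"
    proof (subst AE_eq_borel_lebesgue(1)[OF S_meas, symmetric])
      show "AE z in lborel. (case z of (x, y) \<Rightarrow> \<bar>\<phi> x - \<phi> y\<bar> powr p / dist x y powr ?e) = ?S z"
        using ae2 by eventually_elim (simp only: split_beta divide_dist_powr)
      show "integrable lebesgue (\<lambda>z::'a \<times> 'a. case z of (x, y) \<Rightarrow> \<bar>\<phi> x - \<phi> y\<bar> powr p / dist x y powr ?e)" by (rule \<phi>s)
    qed
    then have "integrable (lborel \<Otimes>\<^sub>M lborel) ?S" by (simp only: lborel_prod)
    then have "(\<integral>\<^sup>+z. ennreal (?S z) \<partial>(lborel \<Otimes>\<^sub>M lborel)) < \<infinity>" by (simp add: integrable_iff_bounded)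
    moreover have "(\<lambda>z. ennreal (?S z)) \<in> borel_measurable (lborel \<Otimes>\<^sub>M lborel)" by measurable
    ultimately have seminorm: "(\<integral>\<^sup>+x. \<integral>\<^sup>+y. ennreal (\<bar>\<psi> x - \<psi> y\<bar> powr p * norm (y - x) powr (- ?e)) \<partial>lborel \<partial>lborel) < \<infinity>"
      using lborel.nn_integral_fst[of "\<lambda>z. ennreal (?S z)" lborel] by simp
    have supp: "x \<in> \<Omega> \<and> infdist x (- \<Omega>) < \<rho>" if "\<psi> x \<noteq> 0" for x
      using that U' unfolding \<psi>_def by (auto simp: indicator_def split: if_splits)
    interpret T: test_function s p \<Omega> \<rho> C \<psi>
      by unfold_locales (rule op bd C ext lim bounds \<psi>m supp Lp seminorm | assumption)+
    let ?K = "\<lambda>(x, y). spow (infdist x (- \<Omega>) powr s - infdist y (- \<Omega>) powr s) (p - 1) * (\<phi> x - \<phi> y) / dist x y powr ?e"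
    have form_meas: "T.form \<in> borel_measurable borel"
      using T.form_meas by (simp only: lborel_prod) simp
    have aeK: "AE z in lborel. ?K z = T.form z"
      using ae2 by eventually_elim (simp only: split_beta divide_dist_powr T.form_def T.jump_def T.ker_def T.dl_def)
    have iK: "integrable lebesgue ?K"
      using AE_eq_borel_lebesgue(1)[OF form_meas aeK] T.form_integrable by (simp only: lborel_prod)
    have f\<psi>: "(\<lambda>x. f x * \<psi> x) \<in> borel_measurable borel" by measurable
    have aef: "AE x in lborel. f x * \<phi> x = f x * \<psi> x" using ae by eventually_elim simp
    have "integrable lborel (\<lambda>x. 2 * (\<psi> x * L x))"
      unfolding L_def by (intro integrable_mult_right T.weighted_op(1))
    then have "integrable lborel (\<lambda>x. f x * \<psi> x)" unfolding f_def by (simp only: mult_ac)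
    then have if\<phi>: "integrable lebesgue (\<lambda>x. f x * \<phi> x)" using AE_eq_borel_lebesgue(1)[OF f\<psi> aef] by simp
    have "integral\<^sup>L lebesgue ?K = integral\<^sup>L (lborel \<Otimes>\<^sub>M lborel) T.form"
      using AE_eq_borel_lebesgue(2)[OF form_meas aeK] by (simp only: lborel_prod)
    also have "\<dots> = (\<integral>x. f x * \<psi> x \<partial>lborel)" unfolding f_def L_def by (rule T.weak_identity)
    also have "\<dots> = integral\<^sup>L lebesgue (\<lambda>x. f x * \<phi> x)" using AE_eq_borel_lebesgue(2)[OF f\<psi> aef] by simp
    finally show "integrable lebesgue ?K \<and> integrable lebesgue (\<lambda>x. f x * \<phi> x) \<and>
        integral\<^sup>L lebesgue ?K = integral\<^sup>L lebesgue (\<lambda>x. f x * \<phi> x)"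
      using iK if\<phi> by blast
  qed
  ultimately show ?thesis using \<rho> by blast
qed

end
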